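(* Let $d\in\mathbb N^*$, let $(P_{i,n})_{i,n\in\mathbb N}$ be polynomials of degree at most $d$, let $\vec G=(G_j)_{j\in\mathbb N}$ be a sequence of independent standard Gaussian variables, and let $\vec F_n=(F_{i,n})_{i\in\mathbb N}$ be the infinite random vector given by $F_{i,n}=P_{i,n}(\vec G)$, $i,n\in\mathbb N$. Assume that $(\vec F_n)_n$ converges in law. Then there exist polynomials $(Q_i)_{i\in\mathbb N}$ of degree at most $d$ such that $$\vec F_n\xrightarrow[n\to\infty]{\text{law}}(Q_i(\vec G))_{i\in\mathbb N}.$$
   Context: Convergence in law of infinite random vectors means convergence in law of all finite-dimensional marginals. Polynomials may involve countably many variables: $\{P(\vec G):\deg P\le d\}$ denotes the $L^2(\mathbf P)$-closure of the linear space of ordinary polynomials of total degree at most $d$ in finitely many of the $G_j$ (equivalently, the sum of the Wiener chaoses of order at most $d$). *)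

theory Defs
  imports "HOL-Probability.Probability" "HOL-Library.Poly_Mapping"
begin

text \<open>
  Ordinary real polynomials in the variables \<open>x\<^sub>0, x\<^sub>1, \<dots>\<close> are finitely supported maps from
  exponent vectors (themselves finitely supported) to coefficients. The zero polynomial has
  degree at most \<open>d\<close> for every \<open>d\<close>.
\<close>

definition eval_mpoly :: "((nat \<Rightarrow>\<^sub>0 nat) \<Rightarrow>\<^sub>0 real) \<Rightarrow> (nat \<Rightarrow> real) \<Rightarrow> real" where
  "eval_mpoly p x =
     (\<Sum>m\<in>Poly_Mapping.keys p.
        Poly_Mapping.lookup p m * (\<Prod>j\<in>Poly_Mapping.keys m. x j ^ Poly_Mapping.lookup m j))"

definition total_degree_le :: "((nat \<Rightarrow>\<^sub>0 nat) \<Rightarrow>\<^sub>0 real) \<Rightarrow> nat \<Rightarrow> bool" where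
  "total_degree_le p d \<longleftrightarrow>
     (\<forall>m\<in>Poly_Mapping.keys p. (\<Sum>j\<in>Poly_Mapping.keys m. Poly_Mapping.lookup m j) \<le> d)"

definition L2_functions :: "'a measure \<Rightarrow> ('a \<Rightarrow> real) set" where
  "L2_functions M = {X \<in> borel_measurable M. integrable M (\<lambda>\<omega>. (X \<omega>)\<^sup>2)}"

definition L2_closure :: "'a measure \<Rightarrow> ('a \<Rightarrow> real) set \<Rightarrow> ('a \<Rightarrow> real) set" where
  "L2_closure M A =
     {X \<in> L2_functions M.
        \<forall>\<epsilon>>0. \<exists>Y\<in>A \<inter> L2_functions M. sqrt (\<integral>\<omega>. (X \<omega> - Y \<omega>)\<^sup>2 \<partial>M) < \<epsilon>}"

text \<open>
  The set \<open>{P(G) : deg P \<le> d}\<close>, where \<open>P\<close> may involve countably many variables. Its elements are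
  representatives of classes modulo almost sure equality.
\<close>

definition polys_of :: "'a measure \<Rightarrow> (nat \<Rightarrow> 'a \<Rightarrow> real) \<Rightarrow> nat \<Rightarrow> ('a \<Rightarrow> real) set" where
  "polys_of M G d =
     L2_closure M {\<lambda>\<omega>. eval_mpoly p (\<lambda>j. G j \<omega>) | p. total_degree_le p d}"

definition marginal_law ::
  "'a measure \<Rightarrow> (nat \<Rightarrow> 'a \<Rightarrow> real) \<Rightarrow> nat set \<Rightarrow> (nat \<Rightarrow> real) measure" where
  "marginal_law M X I = distr M (\<Pi>\<^sub>M i\<in>I. borel) (\<lambda>\<omega>. \<lambda>i\<in>I. X i \<omega>)"

text \<open>
  Weak convergence of probability measures on \<open>\<real>\<^sup>I\<close>, for finite \<open>I\<close>, tested against bounded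
  continuous functions.
\<close>

definition weak_conv_on ::
  "nat set \<Rightarrow> (nat \<Rightarrow> (nat \<Rightarrow> real) measure) \<Rightarrow> (nat \<Rightarrow> real) measure \<Rightarrow> bool" where
  "weak_conv_on I \<mu> \<nu> \<longleftrightarrow>
     (\<forall>f. continuous_map (product_topology (\<lambda>_. euclideanreal) I) euclideanreal f \<and>
          bounded (f ` (\<Pi>\<^sub>E i\<in>I. UNIV)) \<longrightarrow>
          (\<lambda>n. \<integral>x. f x \<partial>\<mu> n) \<longlonglongrightarrow> (\<integral>x. f x \<partial>\<nu>))"

text \<open>
  In both definitions below, \<open>F i n\<close> is the \<open>i\<close>-th component of the \<open>n\<close>-th random vector.
  The marginal limits in the first one are automatically consistent, hence come from a single
  law on \<open>\<real>\<^sup>\<nat>\<close>.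
\<close>

definition converges_in_law ::
  "'a measure \<Rightarrow> (nat \<Rightarrow> nat \<Rightarrow> 'a \<Rightarrow> real) \<Rightarrow> bool" where
  "converges_in_law M F \<longleftrightarrow>
     (\<forall>I. finite I \<longrightarrow>
        (\<exists>\<nu>. prob_space \<nu> \<and> sets \<nu> = sets (\<Pi>\<^sub>M i\<in>I. borel) \<and>
             weak_conv_on I (\<lambda>n. marginal_law M (\<lambda>i. F i n) I) \<nu>))"

definition converges_in_law_to ::
  "'a measure \<Rightarrow> (nat \<Rightarrow> nat \<Rightarrow> 'a \<Rightarrow> real) \<Rightarrow> (nat \<Rightarrow> 'a \<Rightarrow> real) \<Rightarrow> bool" where
  "converges_in_law_to M F X \<longleftrightarrow>
     (\<forall>I. finite I \<longrightarrow>
        weak_conv_on I (\<lambda>n. marginal_law M (\<lambda>i. F i n) I) (marginal_law M X I))"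

end

theory Submission
  imports Defs
begin

text \<open>
  Let \<open>L\<close> be the number operator, whose eigenspaces are the Wiener chaoses, and \<open>\<Gamma>\<close> its carre du champ. The
  identity \<open>(l + j - k) E[N A B] = 2 E[N \<Gamma>(A, B)]\<close> for \<open>N, A, B\<close> in the chaoses of order \<open>k, l, j\<close> lowers two
  of the orders, so by recursion it yields dimension-free bounds for products of polynomials of bounded degree.

  Take limits along a free ultrafilter. A bounded sequence \<open>N\<close> in the \<open>k\<close>-th chaos that is asymptotically
  orthogonal to all products of sequences of lower order has, by the same recursion, \<open>\<Gamma>(N, N')\<close> asymptotically
  constant for every \<open>N'\<close> of the same kind; Gaussian integration by parts then gives Wick's formula, so
  such sequences are asymptotically jointly Gaussian. Projecting, in the complete ultraproduct of the \<open>k\<close>-th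
  chaos, onto the closure of the products of lower order shows by induction on \<open>k\<close> that every bounded
  sequence of polynomials of degree at most \<open>d\<close> is a limit of polynomials of degree at most \<open>d\<close> in a maximal
  orthonormal family of such asymptotically Gaussian sequences. Replacing this family by the variables
  \<open>G\<^sub>j\<close> produces the limit polynomials \<open>Q\<^sub>i\<close>.
\<close>

subsection \<open>Polynomial functions and the number operator\<close>

text \<open>A sequence inside one chaos of order at least 2 can become Gaussian in the limit, as in
  a central limit theorem, so the limit law cannot be found by passing to the limit in coefficients:
  new independent Gaussian variables appear. Each whole sequence of this kind is therefore treated
  as one variable. The degree survives because such a variable has weight 1 whatever the order of
  its chaos. An ultrafilter, rather than subsequences, makes all bounded scalar sequences converge
  at once, so that sequences of polynomials become vectors of one Hilbert space, where projection
  and Zorn's lemma apply. The maximal family may be uncountable, but the countably many approximants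
  in use meet only countably many members, which inject into the indices of \<open>G\<close>.
  Nothing is lost along the ultrafilter: the full sequence converges in law by hypothesis, and only
  its limit has to be identified. Polynomials are functions over an arbitrary type of variables
  because sequences themselves later serve as variables.\<close>

inductive polyfun :: "'i set \<Rightarrow> nat \<Rightarrow> (('i \<Rightarrow> real) \<Rightarrow> real) \<Rightarrow> bool" for V where
  const: "polyfun V d (\<lambda>x. c)"
| add: "polyfun V d f \<Longrightarrow> polyfun V d g \<Longrightarrow> polyfun V d (\<lambda>x. f x + g x)"
| var_mult: "b \<in> V \<Longrightarrow> polyfun V d f \<Longrightarrow> polyfun V (Suc d) (\<lambda>x. x b * f x)"

definition pdiff :: "'i \<Rightarrow> (('i \<Rightarrow> real) \<Rightarrow> real) \<Rightarrow> ('i \<Rightarrow> real) \<Rightarrow> real" where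
  "pdiff i f x = deriv (\<lambda>t. f (x(i := t))) (x i)"

text \<open>Minus the Ornstein-Uhlenbeck generator in the coordinates \<open>V\<close>; with this
  sign the eigenvalues are the nonnegative chaos orders.\<close>

definition number_op :: "'i set \<Rightarrow> (('i \<Rightarrow> real) \<Rightarrow> real) \<Rightarrow> ('i \<Rightarrow> real) \<Rightarrow> real" where
  "number_op V f x = (\<Sum>i\<in>V. x i * pdiff i f x - pdiff i (pdiff i f) x)"

definition grad_prod ::
  "'i set \<Rightarrow> (('i \<Rightarrow> real) \<Rightarrow> real) \<Rightarrow> (('i \<Rightarrow> real) \<Rightarrow> real) \<Rightarrow> ('i \<Rightarrow> real) \<Rightarrow> real" where
  "grad_prod V f g x = (\<Sum>i\<in>V. pdiff i f x * pdiff i g x)"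

text \<open>The degree bound accompanies the eigenvalue equation so that order 0 means constant, and
  so that differentiation lowers degree and eigenvalue together.\<close>

definition eig :: "'i set \<Rightarrow> nat \<Rightarrow> (('i \<Rightarrow> real) \<Rightarrow> real) \<Rightarrow> bool" where
  "eig V k f \<longleftrightarrow> polyfun V k f \<and> (\<forall>x. number_op V f x = real k * f x)"

lemma polyfun_degree_mono: "polyfun V d f \<Longrightarrow> d \<le> e \<Longrightarrow> polyfun V e f"
proof (induction arbitrary: e rule: polyfun.induct)
  case (var_mult b d f)
  then obtain e' where "e = Suc e'" "d \<le> e'" by (cases e) auto
  then show ?case using var_mult by (auto intro: polyfun.var_mult)
qed (auto intro: polyfun.intros)

lemma polyfun_vars_mono: "polyfun V d f \<Longrightarrow> V \<subseteq> W \<Longrightarrow> polyfun W d f"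
  by (induction rule: polyfun.induct) (auto intro: polyfun.intros)

lemma polyfun_0_const:
  assumes "polyfun V 0 f"
  obtains c where "f = (\<lambda>x. c)"
proof -
  have "polyfun V d f \<Longrightarrow> d = 0 \<Longrightarrow> \<exists>c. f = (\<lambda>x. c)" for d
    by (induction rule: polyfun.induct) auto
  then show ?thesis using assms that by blast
qed

lemma polyfun_scale: "polyfun V d f \<Longrightarrow> polyfun V d (\<lambda>x. c * f x)"
proof (induction rule: polyfun.induct)
  case (var_mult b d f)
  then have "polyfun V (Suc d) (\<lambda>x. x b * (c * f x))" by (intro polyfun.var_mult)
  then show ?case by (simp add: ac_simps)
qed (auto simp: distrib_left intro: polyfun.intros)

lemma polyfun_uminus: "polyfun V d f \<Longrightarrow> polyfun V d (\<lambda>x. - f x)"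
  using polyfun_scale[of V d f "-1"] by simp

lemma polyfun_diff: "polyfun V d f \<Longrightarrow> polyfun V d g \<Longrightarrow> polyfun V d (\<lambda>x. f x - g x)"
  using polyfun.add[of V d f "\<lambda>x. - g x"] polyfun_uminus by auto

lemma polyfun_sum: "(\<And>i. i \<in> I \<Longrightarrow> polyfun V d (f i)) \<Longrightarrow> polyfun V d (\<lambda>x. \<Sum>i\<in>I. f i x)"
  by (induction I rule: infinite_finite_induct) (auto intro: polyfun.intros)

lemma polyfun_mult:
  "polyfun V d f \<Longrightarrow> polyfun V e g \<Longrightarrow> polyfun V (d + e) (\<lambda>x. f x * g x)"
proof (induction rule: polyfun.induct)
  case (const d c)
  then show ?case using polyfun_degree_mono[OF polyfun_scale] by (metis le_add2)
next
  case (add d f g)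
  then show ?case by (auto simp: distrib_right intro: polyfun.intros)
next
  case (var_mult b d f)
  then have "polyfun V (Suc (d + e)) (\<lambda>x. x b * (f x * g x))" by (intro polyfun.var_mult) auto
  then show ?case by (simp add: ac_simps)
qed

lemma polyfun_var: "b \<in> V \<Longrightarrow> 1 \<le> d \<Longrightarrow> polyfun V d (\<lambda>x. x b)"
  using polyfun_degree_mono[OF polyfun.var_mult[OF _ polyfun.const[of V 0 1]]] by simp

lemma polyfun_power: "polyfun V d f \<Longrightarrow> polyfun V (d * k) (\<lambda>x. f x ^ k)"
  by (induction k) (auto intro: polyfun.const polyfun_mult)

lemma polyfun_subst:
  "polyfun V d p \<Longrightarrow> (\<And>b. b \<in> V \<Longrightarrow> polyfun W e (q b)) \<Longrightarrow> polyfun W (d * e) (\<lambda>x. p (\<lambda>b. q b x))"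
  by (induction rule: polyfun.induct) (auto intro: polyfun.intros polyfun_mult)

lemma polyfun_has_pdiff:
  assumes "polyfun V d f"
  shows "((\<lambda>t. f (x(i := t))) has_real_derivative pdiff i f x) (at (x i))"
proof -
  have "\<exists>D. ((\<lambda>t. f (x(i := t))) has_real_derivative D) (at (x i))" using assms
  proof (induction rule: polyfun.induct)
    case (add d f g)
    then show ?case by (auto intro: DERIV_add)
  next
    case (var_mult b d f)
    then obtain D where "((\<lambda>t. f (x(i := t))) has_real_derivative D) (at (x i))" by blast
    moreover obtain D' where "((\<lambda>t. (x(i := t)) b) has_real_derivative D') (at (x i))"
      by (cases "b = i") (auto intro: that derivative_eq_intros)
    ultimately show ?case by (intro exI, rule DERIV_mult[rotated])
  qed (auto intro: DERIV_const)
  then show ?thesis by (auto simp: pdiff_def DERIV_imp_deriv)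
qed

lemma pdiff_eqI: "((\<lambda>t. f (x(i := t))) has_real_derivative D) (at (x i)) \<Longrightarrow> pdiff i f x = D"
  by (simp add: pdiff_def DERIV_imp_deriv)

lemma pdiff_const[simp]: "pdiff i (\<lambda>x. c) = (\<lambda>x. 0)"
  by (rule ext, rule pdiff_eqI) auto

lemma pdiff_add:
  assumes "polyfun V d f" "polyfun W e g"
  shows "pdiff i (\<lambda>x. f x + g x) = (\<lambda>x. pdiff i f x + pdiff i g x)"
  by (rule ext, rule pdiff_eqI, rule DERIV_add) (rule polyfun_has_pdiff[OF assms(1)], rule polyfun_has_pdiff[OF assms(2)])

lemma pdiff_mult:
  assumes "polyfun V d f" "polyfun W e g"
  shows "pdiff i (\<lambda>x. f x * g x) = (\<lambda>x. pdiff i f x * g x + f x * pdiff i g x)"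
proof (rule ext, rule pdiff_eqI)
  fix x
  show "((\<lambda>t. f (x(i := t)) * g (x(i := t))) has_real_derivative pdiff i f x * g x + f x * pdiff i g x) (at (x i))"
    using DERIV_mult[OF polyfun_has_pdiff[OF assms(1), of x i] polyfun_has_pdiff[OF assms(2), of x i]]
    by (simp add: algebra_simps)
qed

lemma pdiff_scale:
  assumes "polyfun V d f"
  shows "pdiff i (\<lambda>x. c * f x) = (\<lambda>x. c * pdiff i f x)"
  using pdiff_mult[OF polyfun.const[of V 0 c] assms, of i] by simp

lemma pdiff_var: "pdiff i (\<lambda>x. x b) = (\<lambda>x. if b = i then 1 else 0)"
  by (rule ext, rule pdiff_eqI) (auto intro!: derivative_eq_intros)

lemma pdiff_var_mult:
  assumes "polyfun V d f"
  shows "pdiff i (\<lambda>x. x b * f x) = (\<lambda>x. (if b = i then f x else 0) + x b * pdiff i f x)"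
  using pdiff_mult[OF polyfun_var[of b UNIV 1] assms, of i] by (auto simp: pdiff_var)

lemma polyfun_pdiff: "polyfun V d f \<Longrightarrow> polyfun V (d - 1) (pdiff i f)"
proof (induction rule: polyfun.induct)
  case (add d f g)
  then show ?case by (auto simp: pdiff_add[of V d f V d g] intro: polyfun.intros)
next
  case (var_mult b d f)
  have 1: "polyfun V d (\<lambda>x. if b = i then f x else 0)"
    using var_mult by (cases "b = i") (auto intro: polyfun.const)
  \<comment> \<open>For \<open>d = 0\<close> the truncated bound \<open>d - 1\<close> is again 0,
    and multiplication by \<open>x b\<close> would overshoot; there \<open>f\<close> is constant and
    the term vanishes.\<close>
  have 2: "polyfun V d (\<lambda>x. x b * pdiff i f x)"
  proof (cases d)
    case 0
    then obtain c where "f = (\<lambda>x. c)" using var_mult polyfun_0_const by blast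
    then show ?thesis by (auto intro: polyfun.const)
  next
    case (Suc e)
    then show ?thesis using var_mult by (auto intro: polyfun.var_mult)
  qed
  show ?case using polyfun.add[OF 1 2] by (simp add: pdiff_var_mult[OF var_mult(2)])
qed (auto intro: polyfun.const)

lemma polyfun_pdiff': "polyfun V d f \<Longrightarrow> polyfun V d (pdiff i f)"
  using polyfun_pdiff polyfun_degree_mono by (metis diff_le_self)

lemma pdiff_sum:
  assumes "\<And>j. j \<in> J \<Longrightarrow> polyfun V d (f j)"
  shows "pdiff i (\<lambda>x. \<Sum>j\<in>J. f j x) = (\<lambda>x. \<Sum>j\<in>J. pdiff i (f j) x)"
  using assms
proof (induction J rule: infinite_finite_induct)
  case (insert j J)
  then show ?case using pdiff_add[OF insert(4)[of j] polyfun_sum[of J V d f], of i] by auto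
qed auto

lemma pdiff_commute: "polyfun V d f \<Longrightarrow> pdiff i (pdiff j f) = pdiff j (pdiff i f)"
proof (induction rule: polyfun.induct)
  case (add d f g)
  then show ?case by (simp add: pdiff_add[of V d f V d g] pdiff_add[OF polyfun_pdiff' polyfun_pdiff'])
next
  case (var_mult b d f)
  note f = var_mult(2)
  have "pdiff i (pdiff j (\<lambda>x. x b * f x))
      = (\<lambda>x. (if b = j then pdiff i f x else 0) + (if b = i then pdiff j f x else 0) + x b * pdiff i (pdiff j f) x)" for i j
  proof -
    have p: "polyfun V d (\<lambda>x. if b = j then f x else 0)"
      using f by (cases "b = j") (auto intro: polyfun.const)
    have q: "polyfun (insert b V) (Suc d) (\<lambda>x. x b * pdiff j f x)"
      using polyfun_vars_mono[OF polyfun_pdiff'[OF f, of j], of "insert b V"] by (auto intro: polyfun.var_mult)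
    have "pdiff i (\<lambda>x. if b = j then f x else 0) = (\<lambda>x. if b = j then pdiff i f x else 0)"
      by (cases "b = j") auto
    then show ?thesis
      by (simp add: pdiff_var_mult[OF f] pdiff_add[OF p q] pdiff_var_mult[OF polyfun_pdiff'[OF f]] add.assoc)
  qed
  note * = this
  show ?case unfolding *[of i j] *[of j i] using var_mult by (auto simp: fun_eq_iff)
qed auto

text \<open>Outer and inner variables may have different types: in the application the outer ones
  are sequences of polynomials and the inner ones Gaussian coordinates.\<close>

lemma pdiff_chain:
  assumes "polyfun W d p" "finite W" "\<And>b. b \<in> W \<Longrightarrow> polyfun V e (q b)"
  shows "pdiff i (\<lambda>x. p (\<lambda>b. q b x)) = (\<lambda>x. \<Sum>b\<in>W. pdiff b p (\<lambda>b. q b x) * pdiff i (q b) x)"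
  using assms(1)
proof (induction rule: polyfun.induct)
  case (add d f g)
  have "polyfun V (d * e) (\<lambda>x. f (\<lambda>b. q b x))" "polyfun V (d * e) (\<lambda>x. g (\<lambda>b. q b x))"
    using polyfun_subst add(1,2) assms(3) by blast+
  note * = pdiff_add[OF this]
  show ?case by (simp add: * add pdiff_add[OF add(1,2)] distrib_right sum.distrib)
next
  case (var_mult a d f)
  have f: "polyfun V (d * e) (\<lambda>x. f (\<lambda>b. q b x))"
    using polyfun_subst var_mult(2) assms(3) by blast
  show ?case
    using \<open>a \<in> W\<close> assms(2)
    by (simp add: pdiff_mult[OF assms(3)[OF var_mult(1)] f] var_mult(3) pdiff_var_mult[OF var_mult(2)] distrib_right sum.distrib
       sum_distrib_left mult.assoc if_distrib[of "\<lambda>z. _ * z"] sum.delta algebra_simps cong: if_cong)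
qed simp

lemma polyfun_grad_prod:
  assumes "polyfun V d f" "polyfun V e g" shows "polyfun V (d - 1 + (e - 1)) (grad_prod V f g)"
  unfolding grad_prod_def
  by (intro polyfun_sum polyfun_mult polyfun_pdiff assms)

lemma number_op_add:
  assumes "polyfun V d f" "polyfun V e g"
  shows "number_op V (\<lambda>x. f x + g x) x = number_op V f x + number_op V g x"
  unfolding number_op_def
  by (simp add: pdiff_add[OF assms] pdiff_add[OF polyfun_pdiff'[OF assms(1)] polyfun_pdiff'[OF assms(2)]]
     flip: sum.distrib) (simp add: algebra_simps)

lemma number_op_scale:
  assumes "polyfun V d f"
  shows "number_op V (\<lambda>x. c * f x) x = c * number_op V f x"
  unfolding number_op_def
  by (simp add: pdiff_scale[OF assms] pdiff_scale[OF polyfun_pdiff'[OF assms]] sum_distrib_left algebra_simps)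

lemma number_op_const[simp]: "number_op V (\<lambda>x. c) x = 0"
  by (simp add: number_op_def)

lemma number_op_sum:
  assumes "\<And>j. j \<in> J \<Longrightarrow> polyfun V d (f j)"
  shows "number_op V (\<lambda>x. \<Sum>j\<in>J. f j x) x = (\<Sum>j\<in>J. number_op V (f j) x)"
  using assms
proof (induction J rule: infinite_finite_induct)
  case (insert j J)
  then show ?case using number_op_add[OF insert(4)[of j] polyfun_sum[of J V d f], of x] by auto
qed auto

text \<open>A second-order operator misses the Leibniz rule by the cross terms of its second
  derivatives, which add up to twice the carre du champ.\<close>

lemma number_op_mult:
  assumes f: "polyfun V d f" and g: "polyfun V e g"
  shows "number_op V (\<lambda>x. f x * g x) x
    = f x * number_op V g x + g x * number_op V f x - 2 * grad_prod V f g x"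
proof -
  have "pdiff i (pdiff i (\<lambda>x. f x * g x)) x
     = pdiff i (pdiff i f) x * g x + 2 * (pdiff i f x * pdiff i g x) + f x * pdiff i (pdiff i g) x" for i
    using pdiff_add[OF polyfun_mult[OF polyfun_pdiff'[OF f, of i] g] polyfun_mult[OF f polyfun_pdiff'[OF g, of i]]]
    by (simp add: pdiff_mult[OF f g] pdiff_mult[OF polyfun_pdiff'[OF f] g] pdiff_mult[OF f polyfun_pdiff'[OF g]])
  then show ?thesis unfolding number_op_def grad_prod_def
    by (simp add: pdiff_mult[OF f g] sum_distrib_left flip: sum.distrib sum_subtractf)
       (simp add: algebra_simps)
qed

lemma grad_prod_commute: "grad_prod V f g x = grad_prod V g f x"
  by (simp add: grad_prod_def mult.commute)

text \<open>Differentiating the coefficient \<open>x i\<close> of the first-order part produces the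
  extra \<open>pdiff i f\<close>; everything else commutes. This relation is why a derivative drops
  the chaos order by exactly one.\<close>

lemma pdiff_number_op:
  assumes f: "polyfun V d f" and "i \<in> V" "finite V"
  shows "pdiff i (number_op V f) x = number_op V (pdiff i f) x + pdiff i f x"
proof -
  have p: "polyfun V (Suc d) (\<lambda>x. x j * pdiff j f x)" if "j \<in> V" for j
    using that polyfun_pdiff'[OF f] by (rule polyfun.var_mult)
  have q: "polyfun V (Suc d) (\<lambda>x. -1 * pdiff j (pdiff j f) x)" for j
    by (rule polyfun_degree_mono[OF polyfun_scale[OF polyfun_pdiff'[OF polyfun_pdiff'[OF f]]]]) simp
  have *: "pdiff i (\<lambda>x. x j * pdiff j f x - pdiff j (pdiff j f) x) x
     = x j * pdiff j (pdiff i f) x - pdiff j (pdiff j (pdiff i f)) x + (if j = i then pdiff i f x else 0)"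
    if "j \<in> V" for j
  proof -
    have "pdiff i (\<lambda>x. x j * pdiff j f x + -1 * pdiff j (pdiff j f) x) x
        = (if j = i then pdiff j f x else 0) + x j * pdiff i (pdiff j f) x - pdiff i (pdiff j (pdiff j f)) x"
      unfolding pdiff_add[OF p[OF that] q] pdiff_var_mult[OF polyfun_pdiff'[OF f]]
        pdiff_scale[OF polyfun_pdiff'[OF polyfun_pdiff'[OF f]]] by simp
    then show ?thesis
      using pdiff_commute[OF f, of i j] pdiff_commute[OF polyfun_pdiff'[OF f, of j], of i j] by auto
  qed
  have "polyfun V (Suc d) (\<lambda>x. x j * pdiff j f x - pdiff j (pdiff j f) x)" if "j \<in> V" for j
    using polyfun.add[OF p[OF that] q[of j]] by simp
  note r = pdiff_sum[where J=V and i=i, OF this]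
  have "pdiff i (number_op V f) x = (\<Sum>j\<in>V. pdiff i (\<lambda>x. x j * pdiff j f x - pdiff j (pdiff j f) x) x)"
    using r unfolding number_op_def[abs_def] by (auto simp: fun_eq_iff)
  also have "\<dots> = number_op V (pdiff i f) x + pdiff i f x"
    using assms by (simp add: * number_op_def sum.distrib sum.delta)
  finally show ?thesis .
qed

text \<open>Euler's identity: the first-order part multiplies the homogeneous part of degree
  \<open>d\<close> by \<open>d\<close>, and second derivatives lower the degree. The second clause
  serves \<open>d = 0\<close>, where \<open>d - 1\<close> is again 0 and the first clause says
  nothing.\<close>

lemma number_op_minus_degree:
  assumes "polyfun V d f" "finite V"
  shows "polyfun V (d - 1) (\<lambda>x. number_op V f x - real d * f x)
    \<and> (d = 0 \<longrightarrow> (\<forall>x. number_op V f x = 0))"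
  using assms(1)
proof (induction rule: polyfun.induct)
  case (const d c)
  then show ?case by (auto intro: polyfun.const)
next
  case (add d f g)
  have "polyfun V (d - 1) (\<lambda>x. (number_op V f x - real d * f x) + (number_op V g x - real d * g x))"
    using add by (intro polyfun.add) auto
  then show ?case using add by (auto simp: number_op_add[OF add(1,2)] algebra_simps)
next
  case (var_mult b d f)
  note f = var_mult(2)
  have v: "polyfun V 1 (\<lambda>x. x b)" using var_mult by (simp add: polyfun_var)
  have Lv: "number_op V (\<lambda>x. x b) x = x b" for x
    using \<open>finite V\<close> var_mult(1) by (simp add: number_op_def pdiff_var sum.delta if_distrib[of "\<lambda>z. _ * z"] if_distrib[of "\<lambda>f. pdiff _ f _"] cong: if_cong)
  have G: "grad_prod V (\<lambda>x. x b) f x = pdiff b f x" for x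
    using \<open>finite V\<close> var_mult(1) by (simp add: grad_prod_def pdiff_var if_distrib[of "\<lambda>z. z * _"] sum.delta cong: if_cong)
  have L: "number_op V (\<lambda>x. x b * f x) x = x b * number_op V f x + f x * x b - 2 * pdiff b f x" for x
    using number_op_mult[OF v f, of x] by (simp add: Lv G)
  have 1: "polyfun V d (\<lambda>x. x b * (number_op V f x - real d * f x))"
  proof (cases d)
    case 0 then show ?thesis using var_mult by (auto intro: polyfun.const)
  next
    case (Suc e) then show ?thesis using var_mult by (auto intro!: polyfun.var_mult)
  qed
  have "polyfun V d (\<lambda>x. x b * (number_op V f x - real d * f x) + -2 * pdiff b f x)"
    by (intro polyfun.add 1 polyfun_scale polyfun_pdiff' f)
  then show ?case by (simp add: L algebra_simps)
qed

lemma eig_polyfun: "eig V k f \<Longrightarrow> polyfun V k f"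
  by (simp add: eig_def)

lemma eig_zero: "eig V k (\<lambda>x. 0)"
  by (auto simp: eig_def intro: polyfun.const)

lemma eig_scale: "eig V k f \<Longrightarrow> eig V k (\<lambda>x. c * f x)"
  by (auto simp: eig_def number_op_scale intro: polyfun_scale)

lemma eig_add: "eig V k f \<Longrightarrow> eig V k g \<Longrightarrow> eig V k (\<lambda>x. f x + g x)"
  by (auto simp: eig_def number_op_add distrib_left intro: polyfun.add)

lemma eig_diff: "eig V k f \<Longrightarrow> eig V k g \<Longrightarrow> eig V k (\<lambda>x. f x - g x)"
  using eig_add[of V k f "\<lambda>x. -1 * g x"] eig_scale[of V k g "-1"] by simp

lemma eig_pdiff:
  assumes "eig V k f" "i \<in> V" "finite V"
  shows "eig V (k - 1) (pdiff i f)"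
proof (cases k)
  case 0
  then obtain c where "f = (\<lambda>x. c)" using assms polyfun_0_const unfolding eig_def by blast
  then show ?thesis by (simp add: eig_zero)
next
  case (Suc l)
  have p: "polyfun V k f" and L: "number_op V f = (\<lambda>x. real k * f x)" using assms by (auto simp: eig_def)
  have "number_op V (pdiff i f) x = real (k - 1) * pdiff i f x" for x
    using pdiff_number_op[OF p assms(2,3), of x] Suc
    unfolding L pdiff_scale[OF p] by (simp add: algebra_simps)
  then show ?thesis using polyfun_pdiff[OF p] by (auto simp: eig_def)
qed

text \<open>
  The operator \<open>number_op V - d\<close> lowers the degree of a polynomial of degree at most \<open>d\<close>; dividing the
  components of its image by \<open>k - d\<close> corrects \<open>f\<close> to an eigenvector.
\<close>

lemma eig_decomposition:
  assumes "polyfun V d f" "finite V"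
  obtains g where "\<And>k. k \<le> d \<Longrightarrow> eig V k (g k)" "\<And>x. f x = (\<Sum>k\<le>d. g k x)"
proof -
  have "\<exists>g. (\<forall>k\<le>d. eig V k (g k)) \<and> (\<forall>x. f x = (\<Sum>k\<le>d. g k x))"
    using assms(1)
  proof (induction d arbitrary: f)
    case 0
    then have "eig V 0 f" using number_op_minus_degree[OF 0 assms(2)] by (auto simp: eig_def)
    then show ?case by (intro exI[of _ "\<lambda>_. f"]) auto
  next
    case (Suc d)
    then have "polyfun V d (\<lambda>x. number_op V f x - real (Suc d) * f x)"
      using number_op_minus_degree[OF Suc.prems assms(2)] by auto
    from Suc.IH[OF this] obtain q where q: "\<And>k. k \<le> d \<Longrightarrow> eig V k (q k)"
      and qs: "\<And>x. number_op V f x - real (Suc d) * f x = (\<Sum>k\<le>d. q k x)" by blast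
    define h where "h k = (\<lambda>x. 1 / (real k - real (Suc d)) * q k x)" for k
    have h: "eig V k (h k)" if "k \<le> d" for k unfolding h_def using q[OF that] by (rule eig_scale)
    have hp: "polyfun V (Suc d) (h k)" if "k \<le> d" for k
      using polyfun_degree_mono[OF eig_polyfun[OF h[OF that]]] that by simp
    define r where "r = (\<lambda>x. f x - (\<Sum>k\<le>d. h k x))"
    have hs: "polyfun V (Suc d) (\<lambda>x. \<Sum>k\<le>d. h k x)" using hp by (intro polyfun_sum) auto
    have rp: "polyfun V (Suc d) r" unfolding r_def by (intro polyfun_diff Suc.prems hs)
    have "number_op V r x = real (Suc d) * r x" for x
    proof -
      have "number_op V r x = number_op V f x - (\<Sum>k\<le>d. number_op V (h k) x)"
        using number_op_add[OF Suc.prems polyfun_scale[OF hs, of "-1"], of x] number_op_scale[OF hs, of "-1" x]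
          number_op_sum[of "{..d}" V "Suc d" h x] hp by (simp add: r_def)
      also have "(\<Sum>k\<le>d. number_op V (h k) x) = (\<Sum>k\<le>d. real k * h k x)"
        using h by (intro sum.cong) (auto simp: eig_def)
      also have "\<dots> = (\<Sum>k\<le>d. q k x + real (Suc d) * h k x)"
      proof (intro sum.cong refl)
        fix k assume "k \<in> {..d}"
        then have "real k - real (Suc d) \<noteq> 0" by auto
        then have "(real k - real (Suc d)) * h k x = q k x" unfolding h_def by simp
        then show "real k * h k x = q k x + real (Suc d) * h k x" by (simp add: algebra_simps)
      qed
      also have "\<dots> = number_op V f x - real (Suc d) * f x + real (Suc d) * (\<Sum>k\<le>d. h k x)"
        unfolding qs by (simp only: sum.distrib sum_distrib_left)
      finally show ?thesis by (simp add: r_def algebra_simps)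
    qed
    then have "eig V (Suc d) r" using rp by (auto simp: eig_def)
    then show ?case using h
      by (intro exI[of _ "\<lambda>k. if k = Suc d then r else h k"]) (auto simp: r_def le_Suc_eq)
  qed
  then show ?thesis using that by blast
qed

subsection \<open>Gaussian expectation of polynomials\<close>

text \<open>Expectations factor by independence on monomials in a fixed finite set of variables, a
  structure that induction along \<open>polyfun\<close> does not expose.\<close>

inductive monomial_span :: "'i set \<Rightarrow> (('i \<Rightarrow> real) \<Rightarrow> real) \<Rightarrow> bool" for V where
  monomial: "monomial_span V (\<lambda>x. c * (\<Prod>j\<in>V. x j ^ a j))"
| add: "monomial_span V f \<Longrightarrow> monomial_span V g \<Longrightarrow> monomial_span V (\<lambda>x. f x + g x)"

lemma monomial_span_var_mult:
  assumes "monomial_span V f" "finite V" "b \<in> V"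
  shows "monomial_span V (\<lambda>x. x b * f x)"
  using assms(1)
proof induction
  case (monomial c a)
  have "(\<lambda>x. x b * (c * (\<Prod>j\<in>V. x j ^ a j))) = (\<lambda>x. c * (\<Prod>j\<in>V. x j ^ (a(b := Suc (a b))) j))"
    by (rule ext) (simp add: prod.remove[OF assms(2,3)])
  then show ?case by (simp only: monomial_span.monomial)
next
  case (add f g)
  then show ?case by (simp add: distrib_left monomial_span.add)
qed

lemma polyfun_imp_monomial_span:
  assumes "polyfun V d f" "finite V"
  shows "monomial_span V f"
  using assms(1)
proof induction
  case (const d c)
  show ?case using monomial_span.monomial[of V c "\<lambda>_. 0"] by simp
next
  case (add d f g)
  then show ?case by (intro monomial_span.add)
next
  case (var_mult b d f)
  then show ?case using assms(2) by (intro monomial_span_var_mult)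
qed

lemma polyfun_monomial:
  "finite W \<Longrightarrow> W \<subseteq> V \<Longrightarrow> polyfun V (sum a W) (\<lambda>x. \<Prod>j\<in>W. x j ^ a j)"
proof (induction W rule: finite_induct)
  case (insert w W)
  then show ?case using polyfun_mult[OF polyfun_power[OF polyfun_var[of w V 1], of "a w"]] by auto
qed (auto intro: polyfun.const)

lemma monomial_span_imp_polyfun:
  assumes "monomial_span V f" "finite V"
  shows "\<exists>d. polyfun V d f"
  using assms(1)
proof induction
  case (monomial c a)
  show ?case using polyfun_scale[OF polyfun_monomial[OF assms(2) order_refl]] by blast
next
  case (add f g)
  then obtain d e where "polyfun V d f" "polyfun V e g" by blast
  then have "polyfun V (d + e) f" "polyfun V (d + e) g" by (auto intro: polyfun_degree_mono)
  then show ?case by (intro exI polyfun.add)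
qed

text \<open>The addition case retains that both summands are polynomial, because additivity of the
  expectation needs their integrability.\<close>

lemma polyfun_monomial_induct:
  assumes "polyfun V d f" "finite V"
    and mono: "\<And>c a. P (\<lambda>x. c * (\<Prod>j\<in>V. x j ^ a j))"
    and add: "\<And>f g d e. polyfun V d f \<Longrightarrow> polyfun V e g \<Longrightarrow> P f \<Longrightarrow> P g \<Longrightarrow> P (\<lambda>x. f x + g x)"
  shows "P f"
  using polyfun_imp_monomial_span[OF assms(1,2)]
proof induction
  case (monomial c a)
  show ?case by (rule mono)
next
  case (add f g)
  obtain d e where "polyfun V d f" "polyfun V e g"
    using monomial_span_imp_polyfun[OF _ assms(2)] add(1,2) by blast
  then show ?case using assms(4) add(3,4) by blast
qed

section \<open>Discriminants and the Cauchy-Schwarz inequality\<close>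

lemma le_of_square_le:
  fixes a b :: real
  shows "0 \<le> a \<Longrightarrow> 0 \<le> b \<Longrightarrow> a * a \<le> b * a \<Longrightarrow> a \<le> b"
  by (cases "a = 0") (auto simp: mult_le_cancel_right)

text \<open>The discriminant criterion. Besides Cauchy-Schwarz it later turns near-minimal distance
  into near-orthogonality.\<close>

lemma quadratic_nonneg_imp_square_le:
  fixes a b c :: real
  assumes "c \<ge> 0" and nonneg: "\<And>t. 0 \<le> a - 2 * t * b + t\<^sup>2 * c"
  shows "b\<^sup>2 \<le> a * c"
proof (cases "c = 0")
  case True
  have "b = 0"
  proof (rule ccontr)
    assume "b \<noteq> 0"
    \<comment> \<open>With \<open>c = 0\<close> the quadratic is affine in \<open>t\<close> and
      takes the value -1 at this point.\<close>
    then show False using nonneg[of "(a + 1) / (2 * b)"] True by simp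
  qed
  then show ?thesis using True by simp
next
  case False
  with assms(1) have "c > 0" by simp
  have "0 \<le> (a - 2 * (b / c) * b + (b / c)\<^sup>2 * c) * c" using nonneg[of "b / c"] \<open>c > 0\<close> by simp
  also have "\<dots> = a * c - b\<^sup>2" using \<open>c > 0\<close> by (simp add: power2_eq_square field_simps)
  finally show ?thesis by simp
qed

lemma integrable_mult_of_squares:
  fixes X Y :: "'a \<Rightarrow> real"
  assumes [measurable]: "X \<in> borel_measurable M" "Y \<in> borel_measurable M"
    and "integrable M (\<lambda>\<omega>. (X \<omega>)\<^sup>2)" "integrable M (\<lambda>\<omega>. (Y \<omega>)\<^sup>2)"
  shows "integrable M (\<lambda>\<omega>. X \<omega> * Y \<omega>)"
proof (rule Bochner_Integration.integrable_bound)
  show "integrable M (\<lambda>\<omega>. (X \<omega>)\<^sup>2 + (Y \<omega>)\<^sup>2)" using assms by simp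
  show "AE \<omega> in M. norm (X \<omega> * Y \<omega>) \<le> norm ((X \<omega>)\<^sup>2 + (Y \<omega>)\<^sup>2)"
  proof (rule AE_I2)
    fix \<omega>
    have "2 * \<bar>X \<omega> * Y \<omega>\<bar> \<le> (X \<omega>)\<^sup>2 + (Y \<omega>)\<^sup>2"
      using sum_squares_bound[of "\<bar>X \<omega>\<bar>" "\<bar>Y \<omega>\<bar>"] by (simp add: abs_mult)
    then show "norm (X \<omega> * Y \<omega>) \<le> norm ((X \<omega>)\<^sup>2 + (Y \<omega>)\<^sup>2)"
      using abs_ge_zero[of "X \<omega> * Y \<omega>"] unfolding real_norm_def by linarith
  qed
qed simp

lemma integral_cauchy_schwarz:
  fixes X Y :: "'a \<Rightarrow> real"
  assumes "X \<in> borel_measurable M" "Y \<in> borel_measurable M"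
    and "integrable M (\<lambda>\<omega>. (X \<omega>)\<^sup>2)" "integrable M (\<lambda>\<omega>. (Y \<omega>)\<^sup>2)"
  shows "\<bar>\<integral>\<omega>. X \<omega> * Y \<omega> \<partial>M\<bar> \<le> sqrt (\<integral>\<omega>. (X \<omega>)\<^sup>2 \<partial>M) * sqrt (\<integral>\<omega>. (Y \<omega>)\<^sup>2 \<partial>M)"
proof -
  note XY = integrable_mult_of_squares[OF assms]
  have "0 \<le> (\<integral>\<omega>. (X \<omega>)\<^sup>2 \<partial>M) - 2 * t * (\<integral>\<omega>. X \<omega> * Y \<omega> \<partial>M) + t\<^sup>2 * (\<integral>\<omega>. (Y \<omega>)\<^sup>2 \<partial>M)" for t
  proof -
    have "0 \<le> (\<integral>\<omega>. (X \<omega> - t * Y \<omega>)\<^sup>2 \<partial>M)" by simp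
    also have "\<dots> = (\<integral>\<omega>. (X \<omega>)\<^sup>2 - 2 * t * (X \<omega> * Y \<omega>) + t\<^sup>2 * (Y \<omega>)\<^sup>2 \<partial>M)"
      by (intro Bochner_Integration.integral_cong) (auto simp: power2_eq_square algebra_simps)
    also have "\<dots> = (\<integral>\<omega>. (X \<omega>)\<^sup>2 \<partial>M) - 2 * t * (\<integral>\<omega>. X \<omega> * Y \<omega> \<partial>M) + t\<^sup>2 * (\<integral>\<omega>. (Y \<omega>)\<^sup>2 \<partial>M)"
      using XY assms by (simp add: mult.assoc)
    finally show ?thesis .
  qed
  then have "\<bar>\<integral>\<omega>. X \<omega> * Y \<omega> \<partial>M\<bar> \<le> sqrt ((\<integral>\<omega>. (X \<omega>)\<^sup>2 \<partial>M) * (\<integral>\<omega>. (Y \<omega>)\<^sup>2 \<partial>M))"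
    by (intro real_le_rsqrt) (simp add: quadratic_nonneg_imp_square_le)
  then show ?thesis by (simp add: real_sqrt_mult)
qed

definition gauss_moment :: "nat \<Rightarrow> real" where
  "gauss_moment k = (\<integral>x. std_normal_density x * x ^ k \<partial>lborel)"

text \<open>Gaussian integration by parts for a power, read off from the explicit moments. The
  factor \<open>real k\<close> makes the truncated index \<open>k - 1\<close> harmless at
  \<open>k = 0\<close>.\<close>

lemma gauss_moment_Suc: "gauss_moment (Suc k) = real k * gauss_moment (k - 1)"
proof (cases "even k")
  case True
  then obtain l where l: "k = 2 * l" by (auto elim: evenE)
  show ?thesis
  proof (cases l)
    case 0 then show ?thesis using integral_std_normal_moment_odd[of 0] by (simp add: l gauss_moment_def)
  next
    case (Suc m)
    then have sk: "Suc k = 2 * l + 1" and pk: "k - 1 = 2 * m + 1" using l by auto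
    have "gauss_moment (Suc k) = 0"
      unfolding sk gauss_moment_def by (rule integral_std_normal_moment_odd)
    moreover have "gauss_moment (k - 1) = 0"
      unfolding pk gauss_moment_def by (rule integral_std_normal_moment_odd)
    ultimately show ?thesis by simp
  qed
next
  case False
  then obtain l where l: "k = 2 * l + 1" by (auto elim: oddE)
  have sk: "Suc k = 2 * (Suc l)" and pk: "k - 1 = 2 * l" using l by auto
  have "gauss_moment (Suc k) = fact (2 * Suc l) / (2 ^ Suc l * fact (Suc l))"
    unfolding sk gauss_moment_def by (rule integral_std_normal_moment_even)
  moreover have "gauss_moment (k - 1) = fact (2 * l) / (2 ^ l * fact l)"
    unfolding pk gauss_moment_def by (rule integral_std_normal_moment_even)
  moreover have "(fact (2 * Suc l) :: real) / (2 ^ Suc l * fact (Suc l)) = real k * (fact (2 * l) / (2 ^ l * fact l))"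
  proof -
    have "(fact (2 * Suc l) :: real) = (2 * real (Suc l)) * (real k * fact (2 * l))"
      using l by (simp add: algebra_simps)
    moreover have "(2 ^ Suc l * fact (Suc l) :: real) = (2 * real (Suc l)) * (2 ^ l * fact l)" by simp
    ultimately show ?thesis by (simp only: mult_divide_mult_cancel_left_if) simp
  qed
  ultimately show ?thesis by simp
qed

section \<open>Integration by parts and orthogonality of the chaoses\<close>

locale gaussian_family = prob_space M for M :: "'a measure" +
  fixes G :: "nat \<Rightarrow> 'a \<Rightarrow> real"
  assumes std_normal: "\<And>j. distributed M lborel (G j) std_normal_density"
    and indep: "indep_vars (\<lambda>_. borel) G UNIV"
begin

definition EG :: "((nat \<Rightarrow> real) \<Rightarrow> real) \<Rightarrow> real" where
  "EG f = expectation (\<lambda>\<omega>. f (\<lambda>j. G j \<omega>))"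

definition nrm :: "((nat \<Rightarrow> real) \<Rightarrow> real) \<Rightarrow> real" where
  "nrm f = sqrt (EG (\<lambda>x. (f x)\<^sup>2))"

lemma G_measurable[measurable]: "G j \<in> borel_measurable M"
  using distributed_measurable[OF std_normal[of j]] by simp

lemma G_power: "integrable M (\<lambda>\<omega>. G j \<omega> ^ k)" "expectation (\<lambda>\<omega>. G j \<omega> ^ k) = gauss_moment k"
  using distributed_integrable[OF std_normal, of "\<lambda>x. x ^ k" j] integrable_std_normal_moment[of k]
    distributed_integral[OF std_normal, of "\<lambda>x. x ^ k" j]
  by (auto simp: gauss_moment_def)

lemma G_monomial:
  assumes "finite V"
  shows "integrable M (\<lambda>\<omega>. \<Prod>j\<in>V. G j \<omega> ^ a j)"
    "expectation (\<lambda>\<omega>. \<Prod>j\<in>V. G j \<omega> ^ a j) = (\<Prod>j\<in>V. gauss_moment (a j))"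
proof -
  have "indep_vars (\<lambda>_. borel) (\<lambda>j \<omega>. G j \<omega> ^ a j) V"
    using indep_vars_compose2[OF indep_vars_subset[OF indep], of V "\<lambda>j x. x ^ a j" "\<lambda>_. borel"] by simp
  then show "integrable M (\<lambda>\<omega>. \<Prod>j\<in>V. G j \<omega> ^ a j)"
    "expectation (\<lambda>\<omega>. \<Prod>j\<in>V. G j \<omega> ^ a j) = (\<Prod>j\<in>V. gauss_moment (a j))"
    using indep_vars_integrable[OF assms, of "\<lambda>j \<omega>. G j \<omega> ^ a j"]
      indep_vars_lebesgue_integral[OF assms, of "\<lambda>j \<omega>. G j \<omega> ^ a j"] by (auto simp: G_power)
qed

lemma polyfun_integrable:
  assumes "polyfun V d f" "finite V"
  shows "integrable M (\<lambda>\<omega>. f (\<lambda>j. G j \<omega>))"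
  by (rule polyfun_monomial_induct[OF assms]) (auto simp: G_monomial assms)

lemma EG_add:
  assumes "polyfun V d f" "polyfun V e g" "finite V"
  shows "EG (\<lambda>x. f x + g x) = EG f + EG g"
  using polyfun_integrable[OF assms(1,3)] polyfun_integrable[OF assms(2,3)] by (simp add: EG_def)

lemma EG_diff:
  assumes "polyfun V d f" "polyfun V e g" "finite V"
  shows "EG (\<lambda>x. f x - g x) = EG f - EG g"
  using polyfun_integrable[OF assms(1,3)] polyfun_integrable[OF assms(2,3)] by (simp add: EG_def)

lemma EG_scale: "EG (\<lambda>x. c * f x) = c * EG f"
  by (simp add: EG_def)

lemma EG_const[simp]: "EG (\<lambda>x. c) = c"
  by (simp add: EG_def prob_space)

lemma EG_sum:
  assumes "\<And>i. i \<in> I \<Longrightarrow> polyfun V d (f i)" "finite V"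
  shows "EG (\<lambda>x. \<Sum>i\<in>I. f i x) = (\<Sum>i\<in>I. EG (f i))"
  unfolding EG_def by (rule Bochner_Integration.integral_sum) (rule polyfun_integrable[OF assms(1) assms(2)])

lemma EG_nonneg: "(\<And>x. f x \<ge> 0) \<Longrightarrow> EG f \<ge> 0"
  by (simp add: EG_def)

text \<open>By linearity a monomial suffices; independence splits off its i-th factor, and there the
  claim is the recursion for the moments of one standard Gaussian.\<close>

lemma EG_by_parts:
  assumes "polyfun V d f" "finite V" "i \<in> V"
  shows "EG (\<lambda>x. x i * f x) = EG (pdiff i f)"
proof (rule polyfun_monomial_induct[OF assms(1,2), where P="\<lambda>f. EG (\<lambda>x. x i * f x) = EG (pdiff i f)"])
  fix c :: real and a :: "nat \<Rightarrow> nat"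
  define W where "W = V - {i}"
  have W: "finite W" "i \<notin> W" "V = insert i W" using assms by (auto simp: W_def)
  have eq: "EG (\<lambda>x. c * (x i ^ k * (\<Prod>j\<in>W. x j ^ a j))) = c * (gauss_moment k * (\<Prod>j\<in>W. gauss_moment (a j)))"
    for c k
  proof -
    have "(\<lambda>x. x i ^ k * (\<Prod>j\<in>W. x j ^ a j)) = (\<lambda>x::nat \<Rightarrow> real. \<Prod>j\<in>V. x j ^ (a(i := k)) j)"
      unfolding W(3) using W(1,2) by (auto simp: fun_eq_iff intro!: disjI2 prod.cong)
    then have "EG (\<lambda>x. x i ^ k * (\<Prod>j\<in>W. x j ^ a j)) = (\<Prod>j\<in>V. gauss_moment ((a(i := k)) j))"
      using G_monomial(2)[OF assms(2), of "a(i := k)"] by (simp only: EG_def)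
    also have "\<dots> = gauss_moment k * (\<Prod>j\<in>W. gauss_moment (a j))"
      unfolding W(3) using W by (auto intro!: prod.cong)
    finally show ?thesis by (simp add: EG_scale)
  qed
  have "pdiff i (\<lambda>x. c * (\<Prod>j\<in>V. x j ^ a j)) = (\<lambda>x. (c * real (a i)) * (x i ^ (a i - 1) * (\<Prod>j\<in>W. x j ^ a j)))"
  proof (rule ext, rule pdiff_eqI)
    fix x :: "nat \<Rightarrow> real"
    have "(\<lambda>t. c * (\<Prod>j\<in>V. (x(i := t)) j ^ a j)) = (\<lambda>t. c * (t ^ a i * (\<Prod>j\<in>W. x j ^ a j)))"
      unfolding W(3) using W(1,2) by (auto simp: fun_eq_iff intro!: disjI2 prod.cong)
    moreover have "((\<lambda>t. c * (t ^ a i * (\<Prod>j\<in>W. x j ^ a j))) has_real_derivative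
       (c * real (a i)) * (x i ^ (a i - 1) * (\<Prod>j\<in>W. x j ^ a j))) (at (x i))"
      by (auto intro!: derivative_eq_intros)
    ultimately show "((\<lambda>t. c * (\<Prod>j\<in>V. (x(i := t)) j ^ a j)) has_real_derivative
       (c * real (a i)) * (x i ^ (a i - 1) * (\<Prod>j\<in>W. x j ^ a j))) (at (x i))" by simp
  qed
  moreover have "(\<lambda>x. x i * (c * (\<Prod>j\<in>V. x j ^ a j))) = (\<lambda>x::nat \<Rightarrow> real. c * (x i ^ Suc (a i) * (\<Prod>j\<in>W. x j ^ a j)))"
    unfolding W(3) using W by (auto simp: fun_eq_iff)
  ultimately show "EG (\<lambda>x. x i * (c * (\<Prod>j\<in>V. x j ^ a j))) = EG (pdiff i (\<lambda>x. c * (\<Prod>j\<in>V. x j ^ a j)))"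
    by (simp only: eq gauss_moment_Suc)
next
  fix f g d e
  assume 2: "polyfun V d f" "polyfun V e g" "EG (\<lambda>x. x i * f x) = EG (pdiff i f)" "EG (\<lambda>x. x i * g x) = EG (pdiff i g)"
  have "polyfun V (Suc d) (\<lambda>x. x i * f x)" "polyfun V (Suc e) (\<lambda>x. x i * g x)"
    using 2 assms(3) by (auto intro: polyfun.var_mult)
  from EG_add[OF this assms(2)] show "EG (\<lambda>x. x i * (f x + g x)) = EG (pdiff i (\<lambda>x. f x + g x))"
    using EG_add[OF polyfun_pdiff'[OF 2(1)] polyfun_pdiff'[OF 2(2)] assms(2), of i i] 2
    by (simp add: distrib_left pdiff_add[OF 2(1,2)])
qed

text \<open>By integration by parts the adjoint of the i-th derivative is multiplication by
  \<open>x i\<close> minus that derivative. Hence the number operator is the sum over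
  \<open>V\<close> of adjoint times derivative, and \<open>grad_prod\<close> is its Dirichlet
  form.\<close>

lemma EG_number_op:
  assumes f: "polyfun V d f" and g: "polyfun V e g" and V: "finite V"
  shows "EG (\<lambda>x. number_op V f x * g x) = EG (grad_prod V f g)"
proof -
  let ?a = "\<lambda>i x. x i * (pdiff i f x * g x)" and ?b = "\<lambda>i x. pdiff i (pdiff i f) x * g x"
  have p: "polyfun V (d + e) (\<lambda>x. pdiff i f x * g x)" for i
    by (intro polyfun_mult polyfun_pdiff' f g)
  have a: "polyfun V (Suc (d + e)) (?a i)" if "i \<in> V" for i
    using that p by (rule polyfun.var_mult)
  have b: "polyfun V (d + e) (?b i)" for i
    by (intro polyfun_mult polyfun_pdiff' f g)
  have c: "polyfun V (d + e) (\<lambda>x. pdiff i f x * pdiff i g x)" for i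
    by (intro polyfun_mult polyfun_pdiff' f g)
  have b': "polyfun V (Suc (d + e)) (?b i)" for i using polyfun_degree_mono[OF b] by simp
  have "EG (\<lambda>x. number_op V f x * g x) = EG (\<lambda>x. \<Sum>i\<in>V. ?a i x - ?b i x)"
    by (simp add: number_op_def sum_distrib_right left_diff_distrib mult.assoc)
  also have "\<dots> = (\<Sum>i\<in>V. EG (?a i) - EG (?b i))"
    using a b' V by (subst EG_sum[where d="Suc (d + e)" and V=V]) (auto intro!: polyfun_diff sum.cong EG_diff)
  also have "\<dots> = (\<Sum>i\<in>V. EG (\<lambda>x. pdiff i f x * pdiff i g x))"
  proof (rule sum.cong)
    fix i assume i: "i \<in> V"
    have "EG (?a i) = EG (\<lambda>x. ?b i x + pdiff i f x * pdiff i g x)"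
      by (simp add: EG_by_parts[OF p V i] pdiff_mult[OF polyfun_pdiff'[OF f] g])
    then show "EG (?a i) - EG (?b i) = EG (\<lambda>x. pdiff i f x * pdiff i g x)"
      by (simp add: EG_add[OF b c V])
  qed simp
  also have "\<dots> = EG (grad_prod V f g)"
    unfolding grad_prod_def[abs_def] using c V by (subst EG_sum[where d="d + e" and V=V]) auto
  finally show ?thesis .
qed

lemma EG_number_op_symmetric:
  assumes f: "polyfun V d f" and g: "polyfun V e g" and V: "finite V"
  shows "EG (\<lambda>x. number_op V f x * g x) = EG (\<lambda>x. f x * number_op V g x)"
proof -
  have "grad_prod V f g = grad_prod V g f" by (rule ext) (rule grad_prod_commute)
  then show ?thesis using EG_number_op[OF f g V] EG_number_op[OF g f V] by (simp only: mult.commute)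
qed

lemma eig_EG_grad_prod:
  assumes f: "eig V k f" and g: "polyfun V e g" and V: "finite V"
  shows "EG (grad_prod V f g) = real k * EG (\<lambda>x. f x * g x)"
  using EG_number_op[OF eig_polyfun[OF f] g V] f by (simp add: eig_def mult.assoc EG_scale)

lemma eig_orthogonal:
  assumes "eig V k f" "eig V l g" "finite V" "k \<noteq> l"
  shows "EG (\<lambda>x. f x * g x) = 0"
proof -
  have "real k * EG (\<lambda>x. f x * g x) = real l * EG (\<lambda>x. f x * g x)"
    using EG_number_op_symmetric[OF eig_polyfun[OF assms(1)] eig_polyfun[OF assms(2)] assms(3)] assms
    by (simp add: eig_def mult.assoc mult.left_commute[of "f _"] EG_scale)
  then show ?thesis using \<open>k \<noteq> l\<close> by auto
qed

lemma nrm_nonneg[simp]: "nrm f \<ge> 0"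
  by (simp add: nrm_def EG_nonneg)

lemma nrm_sq: "(nrm f)\<^sup>2 = EG (\<lambda>x. (f x)\<^sup>2)"
  by (simp add: nrm_def EG_nonneg)

lemma EG_square: "EG (\<lambda>x. f x * f x) = (nrm f)\<^sup>2"
  unfolding nrm_sq by (simp add: power2_eq_square)

lemma nrm_const[simp]: "nrm (\<lambda>x. c) = \<bar>c\<bar>"
  by (simp add: nrm_def)

lemma nrm_scale: "nrm (\<lambda>x. c * f x) = \<bar>c\<bar> * nrm f"
  by (simp add: nrm_def power_mult_distrib EG_scale real_sqrt_mult)

lemma EG_cauchy_schwarz:
  assumes f: "polyfun V d f" and g: "polyfun V e g" and V: "finite V"
  shows "\<bar>EG (\<lambda>x. f x * g x)\<bar> \<le> nrm f * nrm g"
proof -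
  have p: "polyfun V (d + d) (\<lambda>x. f x * f x)" "polyfun V (e + e) (\<lambda>x. g x * g x)"
    by (intro polyfun_mult f g)+
  show ?thesis
    unfolding EG_def nrm_def using p[THEN polyfun_integrable, OF V]
      borel_measurable_integrable[OF polyfun_integrable[OF f V]] borel_measurable_integrable[OF polyfun_integrable[OF g V]]
    by (intro integral_cauchy_schwarz) (auto simp: power2_eq_square)
qed

lemma nrm_triangle:
  assumes f: "polyfun V d f" and g: "polyfun V e g" and V: "finite V"
  shows "nrm (\<lambda>x. f x + g x) \<le> nrm f + nrm g"
proof (rule power2_le_imp_le)
  have p: "polyfun V (d + d) (\<lambda>x. f x * f x)" "polyfun V (d + e) (\<lambda>x. 2 * (f x * g x))" "polyfun V (e + e) (\<lambda>x. g x * g x)"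
    by (intro polyfun_mult f g polyfun_scale)+
  have q: "polyfun V (d + d + (d + e)) (\<lambda>x. f x * f x + 2 * (f x * g x))"
    using p by (auto intro!: polyfun.add intro: polyfun_degree_mono)
  have "(nrm (\<lambda>x. f x + g x))\<^sup>2 = EG (\<lambda>x. f x * f x + 2 * (f x * g x) + g x * g x)"
    unfolding nrm_sq by (simp add: power2_eq_square algebra_simps)
  also have "\<dots> = (nrm f)\<^sup>2 + 2 * EG (\<lambda>x. f x * g x) + (nrm g)\<^sup>2"
    by (simp only: EG_add[OF q p(3) V] EG_add[OF p(1,2) V] EG_square EG_scale)
  also have "\<dots> \<le> (nrm f + nrm g)\<^sup>2"
    using EG_cauchy_schwarz[OF f g V] by (simp add: power2_eq_square algebra_simps)
  finally show "(nrm (\<lambda>x. f x + g x))\<^sup>2 \<le> (nrm f + nrm g)\<^sup>2" .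
qed simp

lemma nrm_minus_commute: "nrm (\<lambda>x. f x - g x) = nrm (\<lambda>x. g x - f x)"
  by (simp add: nrm_def power2_commute)

lemma nrm_triangle3:
  assumes "polyfun V d f" "polyfun V e g" "polyfun V l h" "finite V"
  shows "nrm (\<lambda>x. f x - h x) \<le> nrm (\<lambda>x. f x - g x) + nrm (\<lambda>x. g x - h x)"
proof -
  have "polyfun V (d + e + l) f" "polyfun V (d + e + l) g" "polyfun V (d + e + l) h"
    using assms by (auto intro: polyfun_degree_mono)
  from nrm_triangle[OF polyfun_diff[OF this(1,2)] polyfun_diff[OF this(2,3)] assms(4)] show ?thesis by simp
qed

lemma EG_le_nrm:
  assumes "polyfun V d f" "finite V" shows "\<bar>EG f\<bar> \<le> nrm f"
  using EG_cauchy_schwarz[OF assms(1) polyfun.const[of V 0 1] assms(2)] by simp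

section \<open>Dimension-free bounds for products\<close>

lemma eig_pdiff_nrm:
  assumes f: "eig V k f" and V: "finite V"
  shows "(\<Sum>i\<in>V. (nrm (pdiff i f))\<^sup>2) = real k * (nrm f)\<^sup>2"
proof -
  have p: "polyfun V (k + k) (\<lambda>x. pdiff i f x * pdiff i f x)" for i
    by (intro polyfun_mult polyfun_pdiff' eig_polyfun[OF f])
  show ?thesis
    using eig_EG_grad_prod[OF f eig_polyfun[OF f] V] EG_sum[of V V "k + k" "\<lambda>i x. pdiff i f x * pdiff i f x"] p V
    by (simp add: EG_square grad_prod_def[abs_def])
qed

text \<open>Cauchy-Schwarz over the coordinates, combined with the energy identity
  \<open>eig_pdiff_nrm\<close>. The size of \<open>V\<close> does not enter, and this is where the
  constants of all later product bounds become independent of the number of variables.\<close>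

lemma eig_pdiff_nrm_mult:
  assumes f: "eig V k f" and g: "eig V l g" and V: "finite V"
  shows "(\<Sum>i\<in>V. nrm (pdiff i f) * nrm (pdiff i g)) \<le> sqrt (real k * real l) * (nrm f * nrm g)"
proof -
  have "(\<Sum>i\<in>V. nrm (pdiff i f) * nrm (pdiff i g))
     \<le> L2_set (\<lambda>i. nrm (pdiff i f)) V * L2_set (\<lambda>i. nrm (pdiff i g)) V"
    using L2_set_mult_ineq[of "\<lambda>i. nrm (pdiff i f)" "\<lambda>i. nrm (pdiff i g)" V] by simp
  then show ?thesis
    by (simp add: L2_set_def eig_pdiff_nrm[OF f V] eig_pdiff_nrm[OF g V] real_sqrt_mult ac_simps)
qed

text \<open>Symmetry moves the number operator from \<open>N\<close> to the product of
  \<open>A\<close> and \<open>B\<close>, where the product rule yields the eigenvalue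
  \<open>l + j\<close> and a correction by \<open>grad_prod\<close>.\<close>

lemma eig_product_grad_prod:
  assumes N: "eig V k N" and A: "eig V l A" and B: "eig V j B" and V: "finite V"
  shows "(real l + real j - real k) * EG (\<lambda>x. N x * (A x * B x)) = 2 * EG (\<lambda>x. N x * grad_prod V A B x)"
proof -
  note p = eig_polyfun[OF N] eig_polyfun[OF A] eig_polyfun[OF B]
  have AB: "polyfun V (l + j) (\<lambda>x. A x * B x)" by (intro polyfun_mult p)
  have G: "polyfun V (l + j) (grad_prod V A B)"
    using polyfun_degree_mono[OF polyfun_grad_prod[OF p(2,3)]] by simp
  have q: "polyfun V (k + (l + j)) (\<lambda>x. (real l + real j) * (N x * (A x * B x)))"
    "polyfun V (k + (l + j)) (\<lambda>x. 2 * (N x * grad_prod V A B x))"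
    by (intro polyfun_scale polyfun_mult p G)+
  have "real k * EG (\<lambda>x. N x * (A x * B x)) = EG (\<lambda>x. number_op V N x * (A x * B x))"
    using N by (simp add: eig_def mult.assoc EG_scale)
  also have "\<dots> = EG (\<lambda>x. N x * number_op V (\<lambda>x. A x * B x) x)"
    by (rule EG_number_op_symmetric[OF p(1) AB V])
  also have "\<dots> = EG (\<lambda>x. (real l + real j) * (N x * (A x * B x)) - 2 * (N x * grad_prod V A B x))"
    using A B by (simp add: number_op_mult[OF p(2,3)] eig_def algebra_simps)
  also have "\<dots> = (real l + real j) * EG (\<lambda>x. N x * (A x * B x)) - 2 * EG (\<lambda>x. N x * grad_prod V A B x)"
    by (simp only: EG_diff[OF q V] EG_scale)
  finally show ?thesis by (simp add: algebra_simps)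
qed

lemma eig_product_recursion:
  assumes N: "eig V k N" and A: "eig V l A" and B: "eig V j B" and V: "finite V"
  shows "(real l + real j - real k) * EG (\<lambda>x. N x * (A x * B x))
    = 2 * (\<Sum>i\<in>V. EG (\<lambda>x. N x * (pdiff i A x * pdiff i B x)))"
proof -
  have "EG (\<lambda>x. N x * grad_prod V A B x) = (\<Sum>i\<in>V. EG (\<lambda>x. N x * (pdiff i A x * pdiff i B x)))"
    unfolding grad_prod_def sum_distrib_left using V N A B
    by (intro EG_sum[where V=V and d="k + (l + j)"] polyfun_mult polyfun_pdiff' eig_polyfun)
  then show ?thesis using eig_product_grad_prod[OF assms] by simp
qed

text \<open>The orders are integers, so \<open>l + j \<noteq> k\<close> leaves a coefficient of
  modulus at least 1 in front of the expectation, which may be dropped. The bound is assumed with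
  the product of the two derivative norms because exactly these products can be summed over
  \<open>V\<close> without a loss in dimension.\<close>

lemma eig_product_step:
  assumes N: "eig V k N" and A: "eig V l A" and B: "eig V j B" and V: "finite V"
    and ne: "l + j \<noteq> k" and C: "C \<ge> 0"
    and bound: "\<And>i. i \<in> V \<Longrightarrow> \<bar>EG (\<lambda>x. N x * (pdiff i A x * pdiff i B x))\<bar> \<le> C * (nrm (pdiff i A) * nrm (pdiff i B))"
  shows "\<bar>EG (\<lambda>x. N x * (A x * B x))\<bar> \<le> 2 * sqrt (real l * real j) * C * (nrm A * nrm B)"
proof -
  have "1 \<le> \<bar>real l + real j - real k\<bar>" using ne by linarith
  then have "\<bar>EG (\<lambda>x. N x * (A x * B x))\<bar> \<le> \<bar>real l + real j - real k\<bar> * \<bar>EG (\<lambda>x. N x * (A x * B x))\<bar>"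
    by (simp add: mult_le_cancel_right1)
  also have "\<dots> = 2 * \<bar>\<Sum>i\<in>V. EG (\<lambda>x. N x * (pdiff i A x * pdiff i B x))\<bar>"
    using arg_cong[OF eig_product_recursion[OF N A B V], of abs] by (simp add: abs_mult)
  also have "\<dots> \<le> 2 * (\<Sum>i\<in>V. C * (nrm (pdiff i A) * nrm (pdiff i B)))"
    using bound by (intro mult_left_mono order_trans[OF sum_abs] sum_mono) auto
  also have "\<dots> \<le> 2 * (C * (sqrt (real l * real j) * (nrm A * nrm B)))"
    unfolding sum_distrib_left[symmetric]
    by (intro mult_left_mono eig_pdiff_nrm_mult A B V C) simp
  finally show ?thesis by (simp add: ac_simps)
qed

text \<open>Induction on the total order: each use of the recursion lowers two orders by one. It
  ends when some factor is constant, and then Cauchy-Schwarz for the other two suffices.\<close>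

lemma eig_trilinear_bound:
  "\<exists>C\<ge>0. \<forall>V N A B. finite V \<longrightarrow> eig V k N \<longrightarrow> eig V l A \<longrightarrow> eig V j B \<longrightarrow>
     \<bar>EG (\<lambda>x. N x * (A x * B x))\<bar> \<le> C * (nrm N * (nrm A * nrm B))"
proof (induction "k + l + j" arbitrary: k l j rule: less_induct)
  case less
  have base: ?case if "k = 0 \<or> l = 0 \<or> j = 0"
  proof (intro exI[of _ 1] conjI allI impI)
    fix V :: "nat set" and N A B assume V: "finite V" and N: "eig V k N" and A: "eig V l A" and B: "eig V j B"
    note p = eig_polyfun[OF N] eig_polyfun[OF A] eig_polyfun[OF B]
    note cs = EG_cauchy_schwarz[OF p(1,2) V] EG_cauchy_schwarz[OF p(2,3) V] EG_cauchy_schwarz[OF p(1,3) V]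
    from that show "\<bar>EG (\<lambda>x. N x * (A x * B x))\<bar> \<le> 1 * (nrm N * (nrm A * nrm B))"
    proof (elim disjE)
      assume "k = 0"
      then obtain c where "N = (\<lambda>x. c)" using p polyfun_0_const by blast
      then show ?thesis using cs by (simp add: EG_scale abs_mult mult_left_mono)
    next
      assume "l = 0"
      then obtain c where A: "A = (\<lambda>x. c)" using p polyfun_0_const by blast
      then have "EG (\<lambda>x. N x * (A x * B x)) = c * EG (\<lambda>x. N x * B x)"
        by (simp only: EG_scale[symmetric] mult.left_commute[of _ c])
      then show ?thesis using mult_left_mono[OF cs(3), of "\<bar>c\<bar>"] A by (simp add: abs_mult ac_simps)
    next
      assume "j = 0"
      then obtain c where B: "B = (\<lambda>x. c)" using p polyfun_0_const by blast
      then have "EG (\<lambda>x. N x * (A x * B x)) = c * EG (\<lambda>x. N x * A x)"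
        by (simp only: EG_scale[symmetric] mult.left_commute[of _ c] mult.commute[of _ c])
      then show ?thesis using mult_left_mono[OF cs(1), of "\<bar>c\<bar>"] B by (simp add: abs_mult ac_simps)
    qed
  qed simp
  show ?case
  proof (cases "k = 0 \<or> l = 0 \<or> j = 0")
    case True then show ?thesis by (rule base)
  next
    case pos: False
    show ?thesis
    proof (cases "l + j = k")
      case False
      obtain C where C: "C \<ge> 0" "\<And>V N A B. finite V \<Longrightarrow> eig V k N \<Longrightarrow> eig V (l - 1) A \<Longrightarrow> eig V (j - 1) B \<Longrightarrow>
         \<bar>EG (\<lambda>x. N x * (A x * B x))\<bar> \<le> C * (nrm N * (nrm A * nrm B))"
        using less[of k "l - 1" "j - 1"] pos by auto
      show ?thesis
      proof (intro exI[of _ "2 * sqrt (real l * real j) * C"] conjI allI impI)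
        fix V :: "nat set" and N A B assume V: "finite V" and N: "eig V k N" and A: "eig V l A" and B: "eig V j B"
        have "\<bar>EG (\<lambda>x. N x * (A x * B x))\<bar> \<le> 2 * sqrt (real l * real j) * (C * nrm N) * (nrm A * nrm B)"
        proof (rule eig_product_step[OF N A B V])
          fix i assume i: "i \<in> V"
          show "\<bar>EG (\<lambda>x. N x * (pdiff i A x * pdiff i B x))\<bar> \<le> C * nrm N * (nrm (pdiff i A) * nrm (pdiff i B))"
            using C(2)[OF V N eig_pdiff[OF A i V] eig_pdiff[OF B i V]] by (simp only: mult.assoc)
        qed (use False C(1) in auto)
        then show "\<bar>EG (\<lambda>x. N x * (A x * B x))\<bar> \<le> 2 * sqrt (real l * real j) * C * (nrm N * (nrm A * nrm B))"
          by (simp add: ac_simps)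
      qed (use C in auto)
    next
      \<comment> \<open>The coefficient \<open>l + j - k\<close> vanishes. With the roles of
        \<open>N\<close> and \<open>A\<close> exchanged it becomes \<open>k + j - l = 2 * j\<close>,
        which is positive.\<close>
      case True
      obtain C where C: "C \<ge> 0" "\<And>V N A B. finite V \<Longrightarrow> eig V (k - 1) N \<Longrightarrow> eig V l A \<Longrightarrow> eig V (j - 1) B \<Longrightarrow>
         \<bar>EG (\<lambda>x. N x * (A x * B x))\<bar> \<le> C * (nrm N * (nrm A * nrm B))"
        using less[of "k - 1" l "j - 1"] pos by auto
      show ?thesis
      proof (intro exI[of _ "2 * sqrt (real k * real j) * C"] conjI allI impI)
        fix V :: "nat set" and N A B assume V: "finite V" and N: "eig V k N" and A: "eig V l A" and B: "eig V j B"
        have "\<bar>EG (\<lambda>x. A x * (N x * B x))\<bar> \<le> 2 * sqrt (real k * real j) * (C * nrm A) * (nrm N * nrm B)"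
        proof (rule eig_product_step[OF A N B V])
          fix i assume i: "i \<in> V"
          show "\<bar>EG (\<lambda>x. A x * (pdiff i N x * pdiff i B x))\<bar> \<le> C * nrm A * (nrm (pdiff i N) * nrm (pdiff i B))"
            using C(2)[OF V eig_pdiff[OF N i V] A eig_pdiff[OF B i V]] by (simp only: mult.left_commute mult.assoc)
        qed (use True pos C(1) in auto)
        then show "\<bar>EG (\<lambda>x. N x * (A x * B x))\<bar> \<le> 2 * sqrt (real k * real j) * C * (nrm N * (nrm A * nrm B))"
          by (simp add: ac_simps)
      qed (use C in auto)
    qed
  qed
qed

text \<open>The components are mutually orthogonal, so each of them is an orthogonal projection of
  \<open>f\<close> and cannot be longer than \<open>f\<close>.\<close>

lemma eig_component:
  assumes g: "\<And>k. k \<le> d \<Longrightarrow> eig V k (g k)" and f: "\<And>x. f x = (\<Sum>k\<le>d. g k x)" and V: "finite V" and k: "k \<le> d"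
  shows "EG (\<lambda>x. f x * g k x) = (nrm (g k))\<^sup>2" "nrm (g k) \<le> nrm f"
proof -
  have gp: "polyfun V d (g l)" if "l \<le> d" for l using polyfun_degree_mono[OF eig_polyfun[OF g[OF that]] that] .
  have fp: "polyfun V d f" unfolding f[abs_def] by (intro polyfun_sum gp) simp
  have "EG (\<lambda>x. f x * g k x) = (\<Sum>l\<le>d. EG (\<lambda>x. g l x * g k x))"
    unfolding f sum_distrib_right
  proof (rule EG_sum[OF _ V])
    fix l assume "l \<in> {..d}"
    then show "polyfun V (d + d) (\<lambda>x. g l x * g k x)" using k by (intro polyfun_mult gp) simp_all
  qed
  also have "\<dots> = (\<Sum>l\<le>d. if l = k then (nrm (g k))\<^sup>2 else 0)"
  proof (rule sum.cong)
    fix l assume "l \<in> {..d}"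
    then have l: "l \<le> d" by simp
    show "EG (\<lambda>x. g l x * g k x) = (if l = k then (nrm (g k))\<^sup>2 else 0)"
      using eig_orthogonal[OF g[OF l] g[OF k] V] EG_square[of "g k"] by (cases "l = k") simp_all
  qed simp
  also have "\<dots> = (nrm (g k))\<^sup>2" using k by (simp add: sum.delta)
  finally show *: "EG (\<lambda>x. f x * g k x) = (nrm (g k))\<^sup>2" .
  have "(nrm (g k))\<^sup>2 \<le> nrm f * nrm (g k)"
    using EG_cauchy_schwarz[OF fp gp[OF k] V] unfolding * by linarith
  then show "nrm (g k) \<le> nrm f" unfolding power2_eq_square by (rule le_of_square_le[OF nrm_nonneg nrm_nonneg])
qed

text \<open>A substitute for hypercontractivity, by duality: the squared norm of the product pairs
  the product with itself. Expanding one copy and both factors into chaoses reduces it to trilinear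
  terms, each bounded by the norm of the product times the norms of the factors.\<close>

lemma polyfun_product_bound:
  "\<exists>C\<ge>0. \<forall>V f g. finite V \<longrightarrow> polyfun V d f \<longrightarrow> polyfun V e g \<longrightarrow>
     nrm (\<lambda>x. f x * g x) \<le> C * (nrm f * nrm g)"
proof -
  define bnd where "bnd k l j C \<longleftrightarrow> C \<ge> 0 \<and> (\<forall>V N A B. finite V \<longrightarrow> eig V k N \<longrightarrow> eig V l A \<longrightarrow> eig V j B \<longrightarrow>
     \<bar>EG (\<lambda>x. N x * (A x * B x))\<bar> \<le> C * (nrm N * (nrm A * nrm B)))" for k l j C
  define C where "C k l j = (SOME C. bnd k l j C)" for k l j
  have bnd: "bnd k l j (C k l j)" for k l j
    unfolding C_def by (rule someI_ex) (use eig_trilinear_bound[of k l j] in \<open>simp only: bnd_def\<close>)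
  have C0: "C k l j \<ge> 0" for k l j using bnd by (simp add: bnd_def)
  have C: "\<bar>EG (\<lambda>x. N x * (A x * B x))\<bar> \<le> C k l j * (nrm N * (nrm A * nrm B))"
    if "finite V" "eig V k N" "eig V l A" "eig V j B" for k l j V N A B
    using bnd[of k l j] that by (simp add: bnd_def)
  define K where "K = (\<Sum>k\<le>d + e. \<Sum>l\<le>d. \<Sum>j\<le>e. C k l j)"
  have "nrm (\<lambda>x. f x * g x) \<le> K * (nrm f * nrm g)" if V: "finite V" and f: "polyfun V d f" and g: "polyfun V e g" for V f g
  proof -
    let ?fg = "\<lambda>x. f x * g x"
    obtain a where a: "\<And>k. k \<le> d \<Longrightarrow> eig V k (a k)" "\<And>x. f x = (\<Sum>k\<le>d. a k x)"
      using eig_decomposition[OF f V] by blast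
    obtain b where b: "\<And>k. k \<le> e \<Longrightarrow> eig V k (b k)" "\<And>x. g x = (\<Sum>k\<le>e. b k x)"
      using eig_decomposition[OF g V] by blast
    have fg: "polyfun V (d + e) ?fg" by (intro polyfun_mult f g)
    obtain w where w: "\<And>k. k \<le> d + e \<Longrightarrow> eig V k (w k)" "\<And>x. ?fg x = (\<Sum>k\<le>d + e. w k x)"
      using eig_decomposition[OF fg V] by blast
    have wp: "polyfun V (d + e) (w k)" if "k \<le> d + e" for k
      using polyfun_degree_mono[OF eig_polyfun[OF w(1)[OF that]] that] .
    have ap: "polyfun V d (a l)" if "l \<le> d" for l using polyfun_degree_mono[OF eig_polyfun[OF a(1)[OF that]] that] .
    have bp: "polyfun V e (b l)" if "l \<le> e" for l using polyfun_degree_mono[OF eig_polyfun[OF b(1)[OF that]] that] .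
    have "(nrm ?fg)\<^sup>2 = EG (\<lambda>x. ?fg x * ?fg x)" by (rule EG_square[symmetric])
    also have "\<dots> = EG (\<lambda>x. \<Sum>k\<le>d + e. \<Sum>l\<le>d. \<Sum>j\<le>e. w k x * (a l x * b j x))"
    proof -
      have "?fg x * ?fg x = (\<Sum>k\<le>d + e. w k x) * ((\<Sum>l\<le>d. a l x) * (\<Sum>j\<le>e. b j x))" for x
        using w(2)[of x] a(2)[of x] b(2)[of x] by simp
      then show ?thesis unfolding sum_product by (simp only: sum_distrib_left)
    qed
    also have "\<dots> = (\<Sum>k\<le>d + e. \<Sum>l\<le>d. \<Sum>j\<le>e. EG (\<lambda>x. w k x * (a l x * b j x)))"
    proof -
      have 1: "polyfun V (d + e + (d + e)) (\<lambda>x. w k x * (a l x * b j x))" if "k \<le> d + e" "l \<le> d" "j \<le> e" for k l j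
        using that by (intro polyfun_mult wp ap bp)
      have 2: "polyfun V (d + e + (d + e)) (\<lambda>x. \<Sum>j\<le>e. w k x * (a l x * b j x))" if "k \<le> d + e" "l \<le> d" for k l
        using that by (intro polyfun_sum 1) auto
      have 3: "polyfun V (d + e + (d + e)) (\<lambda>x. \<Sum>l\<le>d. \<Sum>j\<le>e. w k x * (a l x * b j x))" if "k \<le> d + e" for k
        using that by (intro polyfun_sum 2) auto
      show ?thesis
        using EG_sum[of "{..d+e}", OF 3 V] EG_sum[of "{..d}", OF 2 V] EG_sum[of "{..e}", OF 1 V] by simp
    qed
    also have "\<dots> \<le> (\<Sum>k\<le>d + e. \<Sum>l\<le>d. \<Sum>j\<le>e. C k l j * (nrm ?fg * (nrm f * nrm g)))"
    proof (intro sum_mono)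
      fix k l j assume "k \<in> {..d + e}" "l \<in> {..d}" "j \<in> {..e}"
      then have k: "k \<le> d + e" and l: "l \<le> d" and j: "j \<le> e" by auto
      have "EG (\<lambda>x. w k x * (a l x * b j x)) \<le> C k l j * (nrm (w k) * (nrm (a l) * nrm (b j)))"
        using C[OF V w(1)[OF k] a(1)[OF l] b(1)[OF j]] by simp
      also have "\<dots> \<le> C k l j * (nrm ?fg * (nrm f * nrm g))"
        using eig_component(2)[OF w V k] eig_component(2)[OF a V l] eig_component(2)[OF b V j]
        by (intro mult_left_mono mult_mono C0) auto
      finally show "EG (\<lambda>x. w k x * (a l x * b j x)) \<le> C k l j * (nrm ?fg * (nrm f * nrm g))" .
    qed
    also have "\<dots> = K * (nrm f * nrm g) * nrm ?fg" unfolding K_def by (simp add: sum_distrib_right mult.assoc mult.commute[of "nrm ?fg"])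
    \<comment> \<open>The norm of the product occurs on both sides and one copy cancels.\<close>
    finally have "nrm ?fg * nrm ?fg \<le> K * (nrm f * nrm g) * nrm ?fg" by (simp add: power2_eq_square)
    moreover have "K \<ge> 0" unfolding K_def by (intro sum_nonneg C0)
    ultimately show ?thesis
      by (auto intro: le_of_square_le[of "nrm ?fg" "K * (nrm f * nrm g)"])
  qed
  moreover have "K \<ge> 0" unfolding K_def by (intro sum_nonneg C0)
  ultimately show ?thesis by blast
qed

end

section \<open>Elements almost orthogonal to products of lower order\<close>

context gaussian_family
begin

text \<open>
  The recursion \<open>eig_product_recursion\<close> spreads this estimate to all products except those in which one
  factor is fully contracted.
\<close>

definition quasi_orth :: "nat set \<Rightarrow> nat \<Rightarrow> ((nat \<Rightarrow> real) \<Rightarrow> real) \<Rightarrow> real \<Rightarrow> bool" where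
  "quasi_orth V k N \<epsilon> \<longleftrightarrow> (\<forall>i j A B. 0 < i \<longrightarrow> 0 < j \<longrightarrow> i + j = k \<longrightarrow> eig V i A \<longrightarrow> eig V j B \<longrightarrow>
     \<bar>EG (\<lambda>x. N x * (A x * B x))\<bar> \<le> \<epsilon> * (nrm A * nrm B))"

lemma quasi_orthD:
  "quasi_orth V k N \<epsilon> \<Longrightarrow> 0 < i \<Longrightarrow> 0 < j \<Longrightarrow> i + j = k \<Longrightarrow> eig V i A \<Longrightarrow> eig V j B \<Longrightarrow>
     \<bar>EG (\<lambda>x. N x * (A x * B x))\<bar> \<le> \<epsilon> * (nrm A * nrm B)"
  unfolding quasi_orth_def by blast

text \<open>The recursion lowers \<open>l\<close> and \<open>j\<close> together, so both exclusions
  persist. It stops at \<open>l + j = k\<close>, where the estimate is the hypothesis, or at a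
  constant factor, where the exclusions force the remaining factor to have an order different from
  \<open>k\<close> and the expectation is 0.\<close>

lemma quasi_orth_bound:
  assumes "j \<noteq> k + l" "l \<noteq> j + k"
  shows "\<exists>C\<ge>0. \<forall>V N \<epsilon> A B. finite V \<longrightarrow> 0 \<le> \<epsilon> \<longrightarrow> eig V k N \<longrightarrow> quasi_orth V k N \<epsilon> \<longrightarrow> eig V l A \<longrightarrow> eig V j B \<longrightarrow>
     \<bar>EG (\<lambda>x. N x * (A x * B x))\<bar> \<le> C * \<epsilon> * (nrm A * nrm B)"
  using assms
proof (induction l arbitrary: j)
  case 0
  show ?case
  proof (intro exI[of _ 0] conjI allI impI)
    fix V :: "nat set" and N \<epsilon> A B assume V: "finite V" and N: "eig V k N" and A: "eig V 0 A" and B: "eig V j B"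
    obtain c where "A = (\<lambda>x. c)" using eig_polyfun[OF A] polyfun_0_const by blast
    then have "EG (\<lambda>x. N x * (A x * B x)) = c * EG (\<lambda>x. N x * B x)"
      by (simp only: EG_scale[symmetric] mult.left_commute[of _ c])
    then show "\<bar>EG (\<lambda>x. N x * (A x * B x))\<bar> \<le> 0 * \<epsilon> * (nrm A * nrm B)"
      using eig_orthogonal[OF N B V] 0 by simp
  qed simp
next
  case (Suc l)
  consider "j = 0" | "j > 0" "Suc l + j = k" | "j > 0" "Suc l + j \<noteq> k" by auto
  then show ?case
  proof cases
    case 1
    show ?thesis
    proof (intro exI[of _ 0] conjI allI impI)
      fix V :: "nat set" and N \<epsilon> A B assume V: "finite V" and N: "eig V k N" and A: "eig V (Suc l) A" and B: "eig V j B"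
      obtain c where "B = (\<lambda>x. c)" using eig_polyfun[OF B] polyfun_0_const 1 by blast
      then have "EG (\<lambda>x. N x * (A x * B x)) = c * EG (\<lambda>x. N x * A x)"
        by (simp only: EG_scale[symmetric] mult.left_commute[of _ c] mult.commute[of _ c])
      then show "\<bar>EG (\<lambda>x. N x * (A x * B x))\<bar> \<le> 0 * \<epsilon> * (nrm A * nrm B)"
        using eig_orthogonal[OF N A V] Suc.prems 1 by simp
    qed simp
  next
    case 2
    then show ?thesis by (intro exI[of _ 1] conjI allI impI) (simp_all add: quasi_orthD[where i="Suc l" and j=j])
  next
    case 3
    obtain C where C0: "C \<ge> 0" and C: "\<And>V N \<epsilon> A B. finite V \<Longrightarrow> 0 \<le> \<epsilon> \<Longrightarrow> eig V k N \<Longrightarrow> quasi_orth V k N \<epsilon> \<Longrightarrow> eig V l A \<Longrightarrow>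
       eig V (j - 1) B \<Longrightarrow> \<bar>EG (\<lambda>x. N x * (A x * B x))\<bar> \<le> C * \<epsilon> * (nrm A * nrm B)"
    proof -
      have "j - 1 \<noteq> k + l" "l \<noteq> j - 1 + k" using Suc.prems 3 by auto
      from Suc.IH[OF this] show ?thesis using that by blast
    qed
    show ?thesis
    proof (intro exI[of _ "2 * sqrt (real (Suc l) * real j) * C"] conjI allI impI)
      fix V :: "nat set" and N \<epsilon> A B
      assume V: "finite V" and e: "0 \<le> \<epsilon>" and N: "eig V k N" "quasi_orth V k N \<epsilon>" and A: "eig V (Suc l) A" and B: "eig V j B"
      have "\<bar>EG (\<lambda>x. N x * (A x * B x))\<bar> \<le> 2 * sqrt (real (Suc l) * real j) * (C * \<epsilon>) * (nrm A * nrm B)"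
        using C[OF V e N] eig_pdiff[OF A _ V] eig_pdiff[OF B _ V] 3(2) C0 e
        by (intro eig_product_step[OF N(1) A B V]) auto
      then show "\<bar>EG (\<lambda>x. N x * (A x * B x))\<bar> \<le> 2 * sqrt (real (Suc l) * real j) * C * \<epsilon> * (nrm A * nrm B)"
        by (simp only: mult.assoc)
    qed (use C0 in simp)
  qed
qed

lemma nrm_sum:
  assumes "\<And>i. i \<in> I \<Longrightarrow> polyfun V d (f i)" "finite V"
  shows "nrm (\<lambda>x. \<Sum>i\<in>I. f i x) \<le> (\<Sum>i\<in>I. nrm (f i))"
  using assms(1)
proof (induction I rule: infinite_finite_induct)
  case (insert i I)
  then show ?case using nrm_triangle[OF insert(4)[of i] polyfun_sum[of I V d f] assms(2)] by force
qed auto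

text \<open>All chaos components of the product of \<open>N\<close> and \<open>N'\<close> strictly
  between the constant and the top order \<open>k + l\<close> are small. The case
  \<open>l = p + k\<close>, excluded in \<open>quasi_orth_bound\<close>, is the quasi-orthogonality
  of \<open>N'\<close> tested on \<open>N\<close> and \<open>B\<close>.\<close>

lemma quasi_orth_triple_bound:
  assumes "1 \<le> p" "p < k + l"
  shows "\<exists>C\<ge>0. \<forall>V N N' \<epsilon> B. finite V \<longrightarrow> 0 \<le> \<epsilon> \<longrightarrow> 1 \<le> k \<longrightarrow> eig V k N \<longrightarrow> eig V l N' \<longrightarrow> quasi_orth V k N \<epsilon> \<longrightarrow>
     quasi_orth V l N' \<epsilon> \<longrightarrow> eig V p B \<longrightarrow> \<bar>EG (\<lambda>x. B x * (N x * N' x))\<bar> \<le> C * \<epsilon> * (nrm N + nrm N') * nrm B"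
proof (cases "l = p + k")
  case True
  show ?thesis
  proof (intro exI[of _ 1] conjI allI impI)
    fix V :: "nat set" and N N' \<epsilon> B
    assume *: "1 \<le> k" "eig V k N" "quasi_orth V l N' \<epsilon>" "eig V p B" "0 \<le> \<epsilon>"
    then have "\<bar>EG (\<lambda>x. N' x * (N x * B x))\<bar> \<le> \<epsilon> * (nrm N * nrm B)"
      using True assms(1) by (intro quasi_orthD[OF *(3), of k p]) auto
    also have "\<dots> \<le> \<epsilon> * ((nrm N + nrm N') * nrm B)"
      by (intro mult_left_mono mult_right_mono * nrm_nonneg) simp
    finally show "\<bar>EG (\<lambda>x. B x * (N x * N' x))\<bar> \<le> 1 * \<epsilon> * (nrm N + nrm N') * nrm B"
      by (simp add: ac_simps)
  qed simp
next
  case False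
  obtain C where C0: "C \<ge> 0" and C: "\<And>V N \<epsilon> A B. finite V \<Longrightarrow> 0 \<le> \<epsilon> \<Longrightarrow> eig V k N \<Longrightarrow> quasi_orth V k N \<epsilon> \<Longrightarrow> eig V l A \<Longrightarrow>
       eig V p B \<Longrightarrow> \<bar>EG (\<lambda>x. N x * (A x * B x))\<bar> \<le> C * \<epsilon> * (nrm A * nrm B)"
    using quasi_orth_bound[of p k l] assms False by auto
  show ?thesis
  proof (intro exI[of _ C] conjI allI impI)
    fix V :: "nat set" and N N' \<epsilon> B
    assume *: "finite V" "0 \<le> \<epsilon>" "eig V k N" "eig V l N'" "quasi_orth V k N \<epsilon>" "eig V p B"
    have "\<bar>EG (\<lambda>x. N x * (N' x * B x))\<bar> \<le> C * \<epsilon> * (nrm N' * nrm B)" by (rule C[OF *(1,2,3,5,4,6)])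
    also have "\<dots> \<le> C * \<epsilon> * ((nrm N + nrm N') * nrm B)"
      by (intro mult_left_mono mult_right_mono mult_nonneg_nonneg C0 * nrm_nonneg) simp
    finally show "\<bar>EG (\<lambda>x. B x * (N x * N' x))\<bar> \<le> C * \<epsilon> * (nrm N + nrm N') * nrm B"
      by (simp add: ac_simps)
  qed (rule C0)
qed

text \<open>For the component \<open>w p\<close> of the carre du champ, the product identity
  expresses twice its squared norm as \<open>k + l - p\<close> times the expectation of
  \<open>w p * (N * N')\<close>. That expectation is small for every \<open>p \<ge> 1\<close>, so
  only the constant component remains.\<close>

lemma quasi_orth_grad_prod:
  assumes "1 \<le> k" "1 \<le> l"
  shows "\<exists>C\<ge>0. \<forall>V N N' \<epsilon>. finite V \<longrightarrow> 0 \<le> \<epsilon> \<longrightarrow> eig V k N \<longrightarrow> eig V l N' \<longrightarrow> quasi_orth V k N \<epsilon> \<longrightarrow>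
     quasi_orth V l N' \<epsilon> \<longrightarrow>
     nrm (\<lambda>x. grad_prod V N N' x - real k * EG (\<lambda>x. N x * N' x)) \<le> C * \<epsilon> * (nrm N + nrm N')"
proof -
  \<comment> \<open>The degree of \<open>grad_prod V N N'\<close>. It lies below
    \<open>k + l\<close>, so the triple bound covers every nonconstant component.\<close>
  define m where "m = k - 1 + (l - 1)"
  define bnd where "bnd p C \<longleftrightarrow> C \<ge> 0 \<and> (\<forall>V N N' \<epsilon> B. finite V \<longrightarrow> 0 \<le> \<epsilon> \<longrightarrow> 1 \<le> k \<longrightarrow> eig V k N \<longrightarrow> eig V l N' \<longrightarrow>
    quasi_orth V k N \<epsilon> \<longrightarrow> quasi_orth V l N' \<epsilon> \<longrightarrow> eig V p B \<longrightarrow>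
    \<bar>EG (\<lambda>x. B x * (N x * N' x))\<bar> \<le> C * \<epsilon> * (nrm N + nrm N') * nrm B)" for p C
  define C where "C p = (SOME C. bnd p C)" for p
  have bnd: "bnd p (C p)" if "1 \<le> p" "p \<le> m" for p
    unfolding C_def by (rule someI_ex) (use quasi_orth_triple_bound[of p k l] that assms in \<open>simp add: bnd_def m_def\<close>)
  define K where "K = (\<Sum>p = 1..m. real (k + l) * C p)"
  have C0: "C p \<ge> 0" if "1 \<le> p" "p \<le> m" for p using bnd[OF that] by (simp add: bnd_def)
  have "nrm (\<lambda>x. grad_prod V N N' x - real k * EG (\<lambda>x. N x * N' x)) \<le> K * \<epsilon> * (nrm N + nrm N')"
    if V: "finite V" and e: "0 \<le> \<epsilon>" and N: "eig V k N" and N': "eig V l N'" and qN: "quasi_orth V k N \<epsilon>"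
      and qN': "quasi_orth V l N' \<epsilon>" for V N N' \<epsilon>
  proof -
    let ?\<Gamma> = "grad_prod V N N'"
    have \<Gamma>: "polyfun V m ?\<Gamma>" unfolding m_def by (intro polyfun_grad_prod eig_polyfun N N')
    obtain w where w: "\<And>p. p \<le> m \<Longrightarrow> eig V p (w p)" "\<And>x. ?\<Gamma> x = (\<Sum>p\<le>m. w p x)"
      using eig_decomposition[OF \<Gamma> V] by blast
    have wp: "polyfun V m (w p)" if "p \<le> m" for p using polyfun_degree_mono[OF eig_polyfun[OF w(1)[OF that]] that] .
    obtain c where c: "w 0 = (\<lambda>x. c)" using eig_polyfun[OF w(1)[of 0]] polyfun_0_const by blast
    have split: "?\<Gamma> x = c + (\<Sum>p = 1..m. w p x)" for x
    proof -
      have "{..m} = insert 0 {1..m}" by auto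
      then show ?thesis by (simp add: w(2) c)
    qed
    have ps: "polyfun V m (\<lambda>x. \<Sum>p = 1..m. w p x)" by (intro polyfun_sum wp) simp
    have 0: "EG (w p) = 0" if "1 \<le> p" "p \<le> m" for p
    proof -
      have "eig V 0 (\<lambda>x. 1)" by (simp add: eig_def polyfun.const)
      from eig_orthogonal[OF this w(1)[OF that(2)] V] show ?thesis using that(1) by simp
    qed
    have "EG ?\<Gamma> = c + (\<Sum>p = 1..m. EG (w p))"
      using EG_add[OF polyfun.const[of V m c] ps V] EG_sum[of "{1..m}" V m w] wp V
      by (simp add: split[abs_def])
    \<comment> \<open>Components of positive order have mean 0, so the constant component is the
      mean of the carre du champ.\<close>
    then have "c = real k * EG (\<lambda>x. N x * N' x)"
      using eig_EG_grad_prod[OF N eig_polyfun[OF N'] V] 0 by simp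
    then have "nrm (\<lambda>x. ?\<Gamma> x - real k * EG (\<lambda>x. N x * N' x)) = nrm (\<lambda>x. \<Sum>p = 1..m. w p x)"
      by (simp add: split)
    also have "\<dots> \<le> (\<Sum>p = 1..m. nrm (w p))" by (rule nrm_sum[OF _ V]) (rule wp, simp)
    also have "\<dots> \<le> (\<Sum>p = 1..m. real (k + l) * C p * (\<epsilon> * (nrm N + nrm N')))"
    proof (rule sum_mono)
      fix p assume "p \<in> {1..m}"
      then have p: "1 \<le> p" "p \<le> m" by auto
      let ?t = "EG (\<lambda>x. w p x * (N x * N' x))"
      have t: "\<bar>?t\<bar> \<le> C p * \<epsilon> * (nrm N + nrm N') * nrm (w p)"
        using bnd[OF p] V e N N' qN qN' w(1)[OF p(2)] assms(1) by (simp add: bnd_def)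
      have "2 * (nrm (w p))\<^sup>2 = (real k + real l - real p) * ?t"
        using eig_product_grad_prod[OF w(1)[OF p(2)] N N' V] eig_component(1)[OF w V p(2)]
        by (simp add: mult.commute)
      also have "\<dots> \<le> \<bar>real k + real l - real p\<bar> * \<bar>?t\<bar>" by (simp add: abs_mult[symmetric])
      also have "\<dots> \<le> (2 * real (k + l)) * (C p * \<epsilon> * (nrm N + nrm N') * nrm (w p))"
        using p(2) by (intro mult_mono t) (auto simp: m_def)
      finally have "nrm (w p) * nrm (w p) \<le> real (k + l) * C p * (\<epsilon> * (nrm N + nrm N')) * nrm (w p)"
        unfolding power2_eq_square by argo
      then show "nrm (w p) \<le> real (k + l) * C p * (\<epsilon> * (nrm N + nrm N'))"
        by (rule le_of_square_le[rotated 2]) (use C0[OF p] e in auto)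
    qed
    also have "\<dots> = K * \<epsilon> * (nrm N + nrm N')" unfolding K_def sum_distrib_right by (simp only: mult.assoc)
    finally show ?thesis .
  qed
  moreover have "K \<ge> 0" unfolding K_def using C0 by (intro sum_nonneg) auto
  ultimately show ?thesis by blast
qed

end

subsection \<open>Limits along an ultrafilter\<close>

text \<open>Finer filters are smaller, so an ultrafilter is a minimal proper filter below
  \<open>sequentially\<close>, and Zorn's lemma is used with the order reversed. The infimum of a
  chain stays proper because each of its events already belongs to one member.\<close>

lemma free_ultrafilter_exists:
  "\<exists>U :: nat filter. U \<noteq> bot \<and> U \<le> sequentially \<and> (\<forall>P. eventually P U \<or> eventually (\<lambda>n. \<not> P n) U)"
proof -
  define A where "A = {F :: nat filter. F \<noteq> bot \<and> F \<le> sequentially}"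
  have "\<exists>m\<in>A. \<forall>a\<in>A. a \<le> m \<longrightarrow> a = m"
  proof (rule predicate_Zorn[where P="\<lambda>F F'. F' \<le> F"])
    show "partial_order_on A (relation_of (\<lambda>F F'. F' \<le> F) A)"
      by (rule partial_order_on_relation_ofI) auto
  next
    fix C assume C: "C \<in> Chains (relation_of (\<lambda>F F'. F' \<le> F) A)"
    then have CA: "C \<subseteq> A" and tot: "\<And>F F'. F \<in> C \<Longrightarrow> F' \<in> C \<Longrightarrow> F \<le> F' \<or> F' \<le> F"
      unfolding Chains_def relation_of_def by auto
    show "\<exists>u\<in>A. \<forall>a\<in>C. u \<le> a"
    proof (cases "C = {}")
      case True
      then show ?thesis by (auto simp: A_def intro!: exI[of _ sequentially])
    next
      case False
      have ev: "eventually P (Inf C) \<longleftrightarrow> (\<exists>F\<in>C. eventually P F)" for P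
      proof (rule eventually_Inf_base[OF False])
        fix F F' assume "F \<in> C" "F' \<in> C"
        then show "\<exists>x\<in>C. x \<le> inf F F'" using tot[of F F'] by (metis inf.absorb1 inf.absorb2 order_refl)
      qed
      have "Inf C \<noteq> bot"
        using ev[of "\<lambda>_. False"] CA by (auto simp: A_def trivial_limit_def)
      moreover have "Inf C \<le> sequentially" using False CA by (auto simp: A_def intro: Inf_lower2)
      ultimately show ?thesis by (intro bexI[of _ "Inf C"]) (auto simp: A_def Inf_lower)
    qed
  qed
  then obtain U where U: "U \<noteq> bot" "U \<le> sequentially" and min: "\<And>F. F \<noteq> bot \<Longrightarrow> F \<le> sequentially \<Longrightarrow> F \<le> U \<Longrightarrow> F = U"
    by (auto simp: A_def)
  have "eventually P U \<or> eventually (\<lambda>n. \<not> P n) U" for P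
  \<comment> \<open>The trace of \<open>U\<close> on the set where \<open>P\<close> holds is either
    improper, which makes the complement an event of \<open>U\<close>, or equal to \<open>U\<close>
    by minimality.\<close>
  proof (cases "inf U (principal {n. P n}) = bot")
    case True
    then have "eventually (\<lambda>n. False) (inf U (principal {n. P n}))" by simp
    then show ?thesis by (simp add: eventually_inf_principal)
  next
    case False
    then have "inf U (principal {n. P n}) = U" using U by (intro min) (auto intro: le_infI1)
    moreover have "eventually P (inf U (principal {n. P n}))" by (simp add: eventually_inf_principal)
    ultimately show ?thesis by simp
  qed
  then show ?thesis using U by blast
qed

locale free_ultrafilter =
  fixes U :: "nat filter"
  assumes not_bot: "U \<noteq> bot" and le_sequentially: "U \<le> sequentially"
    and ultra: "\<And>P. eventually P U \<or> eventually (\<lambda>n. \<not> P n) U"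
begin

lemma bounded_tendsto:
  fixes f :: "nat \<Rightarrow> real"
  assumes "\<And>n. \<bar>f n\<bar> \<le> B"
  shows "(f \<longlongrightarrow> Lim U f) U"
proof -
  \<comment> \<open>The limit is the supremum of the eventual lower bounds. Above it the ultrafilter
    property turns the failure of \<open>a \<le> f n\<close> to hold eventually into
    \<open>f n < a\<close> eventually.\<close>
  define S where "S = {r. eventually (\<lambda>n. r \<le> f n) U}"
  define l where "l = Sup S"
  have inS: "- B \<in> S" unfolding S_def using assms by (auto simp: abs_le_iff minus_le_iff)
  have bdd: "bdd_above S"
  proof (rule bdd_aboveI[of _ B])
    fix r assume "r \<in> S"
    then obtain n where "r \<le> f n" unfolding S_def using eventually_happens not_bot by auto
    then show "r \<le> B" using assms[of n] by auto
  qed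
  have "(f \<longlongrightarrow> l) U"
  proof (rule order_tendstoI)
    fix a assume "a < l"
    then obtain r where "r \<in> S" "a < r" using less_cSup_iff[OF _ bdd] inS by (auto simp: l_def)
    then show "eventually (\<lambda>n. a < f n) U" by (auto simp: S_def elim: eventually_mono)
  next
    fix a assume "l < a"
    then have "a \<notin> S" using cSup_upper[OF _ bdd] by (fastforce simp: l_def)
    then have "eventually (\<lambda>n. \<not> a \<le> f n) U" using ultra[of "\<lambda>n. a \<le> f n"] by (auto simp: S_def)
    then show "eventually (\<lambda>n. f n < a) U" by (auto elim: eventually_mono)
  qed
  then show ?thesis using tendsto_Lim[OF not_bot] by metis
qed

lemma eventually_ge: "eventually (\<lambda>n. m \<le> n) U"
  using le_sequentially eventually_ge_at_top[of m] by (auto simp: le_filter_def)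

end

section \<open>Bounded sequences as elements of an ultraproduct\<close>

type_synonym rseq = "nat \<Rightarrow> (nat \<Rightarrow> real) \<Rightarrow> real"

text \<open>The valuation at stage \<open>n\<close> and point \<open>x\<close> of polynomials whose
  variables are sequences.\<close>

definition eval_at :: "nat \<Rightarrow> (nat \<Rightarrow> real) \<Rightarrow> rseq \<Rightarrow> real" where
  "eval_at n x b = b n x"

text \<open>\<open>V n\<close> holds the variables available at stage \<open>n\<close>. No bound on
  its size is imposed, so only estimates with constants independent of the variables pass to the
  limit.\<close>

locale wiener_ultraproduct = gaussian_family M G + free_ultrafilter U
  for M :: "'a measure" and G :: "nat \<Rightarrow> 'a \<Rightarrow> real" and U :: "nat filter" +
  fixes V :: "nat \<Rightarrow> nat set"
  assumes fin: "finite (V n)"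
begin

text \<open>No quotient is formed: a bounded sequence represents its class, and two sequences count
  as equal when \<open>unrm\<close> of their difference is 0.\<close>

definition bpoly :: "nat \<Rightarrow> rseq \<Rightarrow> bool" where
  "bpoly d u \<longleftrightarrow> (\<forall>n. polyfun (V n) d (u n)) \<and> (\<exists>B. \<forall>n. nrm (u n) \<le> B)"

definition beig :: "nat \<Rightarrow> rseq \<Rightarrow> bool" where
  "beig k u \<longleftrightarrow> (\<forall>n. eig (V n) k (u n)) \<and> (\<exists>B. \<forall>n. nrm (u n) \<le> B)"

definition EU :: "rseq \<Rightarrow> real" where
  "EU u = Lim U (\<lambda>n. EG (u n))"

definition unrm :: "rseq \<Rightarrow> real" where
  "unrm u = Lim U (\<lambda>n. nrm (u n))"

lemma bpoly_polyfun: "bpoly d u \<Longrightarrow> polyfun (V n) d (u n)"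
  by (simp add: bpoly_def)

lemma bpoly_bound:
  assumes "bpoly d u" obtains B where "\<And>n. nrm (u n) \<le> B" "B \<ge> 0"
  using assms nrm_nonneg order_trans unfolding bpoly_def by meson

lemma bpolyI: "(\<And>n. polyfun (V n) d (u n)) \<Longrightarrow> (\<And>n. nrm (u n) \<le> B) \<Longrightarrow> bpoly d u"
  by (auto simp: bpoly_def)

lemma bpoly_mono: "bpoly d u \<Longrightarrow> d \<le> e \<Longrightarrow> bpoly e u"
  by (auto simp: bpoly_def intro: polyfun_degree_mono)

lemma bpoly_const: "bpoly d (\<lambda>n x. c)"
  by (auto simp: bpoly_def intro: polyfun.const)

lemma bpoly_scale:
  assumes "bpoly d u" shows "bpoly d (\<lambda>n x. c * u n x)"
proof -
  obtain B where B: "\<And>n. nrm (u n) \<le> B" using bpoly_bound[OF assms] by blast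
  show ?thesis
    by (rule bpolyI[of _ _ "\<bar>c\<bar> * B"]) (auto simp: nrm_scale intro: mult_left_mono B polyfun_scale bpoly_polyfun[OF assms])
qed

lemma bpoly_add:
  assumes "bpoly d u" "bpoly d v" shows "bpoly d (\<lambda>n x. u n x + v n x)"
proof -
  obtain B where B: "\<And>n. nrm (u n) \<le> B" using bpoly_bound[OF assms(1)] by blast
  obtain B' where B': "\<And>n. nrm (v n) \<le> B'" using bpoly_bound[OF assms(2)] by blast
  show ?thesis
    by (rule bpolyI[of _ _ "B + B'"])
       (auto intro: polyfun.add bpoly_polyfun assms order_trans[OF nrm_triangle[OF bpoly_polyfun[OF assms(1)] bpoly_polyfun[OF assms(2)] fin] add_mono[OF B B']])
qed

lemma bpoly_diff:
  assumes "bpoly d u" "bpoly d v" shows "bpoly d (\<lambda>n x. u n x - v n x)"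
  using bpoly_add[OF assms(1) bpoly_scale[OF assms(2), of "-1"]] by simp

lemma bpoly_diff':
  assumes "bpoly d u" "bpoly e v" shows "bpoly (d + e) (\<lambda>n x. u n x - v n x)"
  using assms by (intro bpoly_diff) (auto intro: bpoly_mono)

text \<open>Boundedness of the product is where the dimension-free estimate enters; it makes the
  bounded sequences an algebra, with no higher moments to be assumed.\<close>

lemma bpoly_mult:
  assumes "bpoly d u" "bpoly e v" shows "bpoly (d + e) (\<lambda>n x. u n x * v n x)"
proof -
  obtain B where B: "\<And>n. nrm (u n) \<le> B" "B \<ge> 0" using bpoly_bound[OF assms(1)] by blast
  obtain B' where B': "\<And>n. nrm (v n) \<le> B'" using bpoly_bound[OF assms(2)] by blast
  obtain C where C: "C \<ge> 0" "\<And>V f g. finite V \<Longrightarrow> polyfun V d f \<Longrightarrow> polyfun V e g \<Longrightarrow> nrm (\<lambda>x. f x * g x) \<le> C * (nrm f * nrm g)"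
    using polyfun_product_bound[of d e] by auto
  show ?thesis
  proof (rule bpolyI[of _ _ "C * (B * B')"])
    fix n
    show "polyfun (V n) (d + e) (\<lambda>x. u n x * v n x)" by (intro polyfun_mult bpoly_polyfun assms)
    have "nrm (\<lambda>x. u n x * v n x) \<le> C * (nrm (u n) * nrm (v n))"
      by (rule C(2)[OF fin bpoly_polyfun[OF assms(1)] bpoly_polyfun[OF assms(2)]])
    also have "\<dots> \<le> C * (B * B')" by (intro mult_left_mono mult_mono B B' C nrm_nonneg)
    finally show "nrm (\<lambda>x. u n x * v n x) \<le> C * (B * B')" .
  qed
qed

lemma bpoly_sum: "(\<And>i. i \<in> I \<Longrightarrow> bpoly d (f i)) \<Longrightarrow> bpoly d (\<lambda>n x. \<Sum>i\<in>I. f i n x)"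
  by (induction I rule: infinite_finite_induct) (auto intro: bpoly_const bpoly_add)

lemma beig_eig: "beig k u \<Longrightarrow> eig (V n) k (u n)"
  by (simp add: beig_def)

lemma beig_bpoly: "beig k u \<Longrightarrow> bpoly k u"
  by (auto simp: beig_def bpoly_def eig_polyfun)

lemma beigI: "(\<And>n. eig (V n) k (u n)) \<Longrightarrow> bpoly d u \<Longrightarrow> beig k u"
  by (auto simp: beig_def bpoly_def)

lemma beig_scale: "beig k u \<Longrightarrow> beig k (\<lambda>n x. c * u n x)"
  by (rule beigI[OF _ bpoly_scale[OF beig_bpoly]]) (auto intro: eig_scale beig_eig)

lemma beig_add: "beig k u \<Longrightarrow> beig k v \<Longrightarrow> beig k (\<lambda>n x. u n x + v n x)"
  by (rule beigI[OF _ bpoly_add[OF beig_bpoly beig_bpoly]]) (auto intro: eig_add beig_eig)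

lemma beig_diff: "beig k u \<Longrightarrow> beig k v \<Longrightarrow> beig k (\<lambda>n x. u n x - v n x)"
  by (rule beigI[OF _ bpoly_diff[OF beig_bpoly beig_bpoly]]) (auto intro: eig_diff beig_eig)

lemma beig_zero: "beig k (\<lambda>n x. 0)"
  by (auto simp: beig_def eig_zero)

lemma EU_tendsto:
  assumes "bpoly d u" shows "((\<lambda>n. EG (u n)) \<longlongrightarrow> EU u) U"
proof -
  obtain B where B: "\<And>n. nrm (u n) \<le> B" using bpoly_bound[OF assms] by blast
  show ?thesis unfolding EU_def
    by (rule bounded_tendsto[of _ B]) (rule order_trans[OF EG_le_nrm[OF bpoly_polyfun[OF assms] fin] B])
qed

lemma unrm_tendsto:
  assumes "bpoly d u" shows "((\<lambda>n. nrm (u n)) \<longlongrightarrow> unrm u) U"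
proof -
  obtain B where B: "\<And>n. nrm (u n) \<le> B" using bpoly_bound[OF assms] by blast
  show ?thesis unfolding unrm_def by (rule bounded_tendsto[of _ B]) (simp add: B)
qed

lemma EU_eqI: "((\<lambda>n. EG (u n)) \<longlongrightarrow> l) U \<Longrightarrow> EU u = l"
  unfolding EU_def by (rule tendsto_Lim[OF not_bot])

lemma unrm_eqI: "((\<lambda>n. nrm (u n)) \<longlongrightarrow> l) U \<Longrightarrow> unrm u = l"
  unfolding unrm_def by (rule tendsto_Lim[OF not_bot])

lemma EU_add:
  assumes "bpoly d u" "bpoly e v" shows "EU (\<lambda>n x. u n x + v n x) = EU u + EU v"
  by (rule EU_eqI) (simp add: EG_add[OF bpoly_polyfun[OF assms(1)] bpoly_polyfun[OF assms(2)] fin] tendsto_add[OF EU_tendsto[OF assms(1)] EU_tendsto[OF assms(2)]])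

lemma EU_diff:
  assumes "bpoly d u" "bpoly e v" shows "EU (\<lambda>n x. u n x - v n x) = EU u - EU v"
  by (rule EU_eqI) (simp add: EG_diff[OF bpoly_polyfun[OF assms(1)] bpoly_polyfun[OF assms(2)] fin] tendsto_diff[OF EU_tendsto[OF assms(1)] EU_tendsto[OF assms(2)]])

lemma EU_scale:
  assumes "bpoly d u" shows "EU (\<lambda>n x. c * u n x) = c * EU u"
  by (rule EU_eqI) (simp only: EG_scale tendsto_mult_left[OF EU_tendsto[OF assms]])

lemma EU_const[simp]: "EU (\<lambda>n x. c) = c"
  by (rule EU_eqI) simp

lemma EU_sum:
  assumes "\<And>i. i \<in> I \<Longrightarrow> bpoly d (f i)" shows "EU (\<lambda>n x. \<Sum>i\<in>I. f i n x) = (\<Sum>i\<in>I. EU (f i))"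
  using assms
proof (induction I rule: infinite_finite_induct)
  case (insert i I)
  then show ?case using EU_add[of d "f i" d "\<lambda>n x. \<Sum>i\<in>I. f i n x"] bpoly_sum[of I d f] by simp
qed simp_all

lemma unrm_nonneg[simp]: assumes "bpoly d u" shows "unrm u \<ge> 0"
  by (rule tendsto_lowerbound[OF unrm_tendsto[OF assms] _ not_bot]) simp

lemma unrm_const[simp]: "unrm (\<lambda>n x. c) = \<bar>c\<bar>"
  by (rule unrm_eqI) simp

lemma unrm_scale: assumes "bpoly d u" shows "unrm (\<lambda>n x. c * u n x) = \<bar>c\<bar> * unrm u"
  by (rule unrm_eqI) (simp only: nrm_scale tendsto_mult_left[OF unrm_tendsto[OF assms]])

lemma EU_square: assumes "bpoly d u" shows "EU (\<lambda>n x. u n x * u n x) = (unrm u)\<^sup>2"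
  by (rule EU_eqI) (simp only: EG_square tendsto_power[OF unrm_tendsto[OF assms]])

lemma EU_cauchy_schwarz:
  assumes "bpoly d u" "bpoly e v" shows "\<bar>EU (\<lambda>n x. u n x * v n x)\<bar> \<le> unrm u * unrm v"
proof (rule tendsto_le[OF not_bot])
  show "((\<lambda>n. nrm (u n) * nrm (v n)) \<longlongrightarrow> unrm u * unrm v) U"
    by (intro tendsto_mult unrm_tendsto[OF assms(1)] unrm_tendsto[OF assms(2)])
  show "((\<lambda>n. \<bar>EG (\<lambda>x. u n x * v n x)\<bar>) \<longlongrightarrow> \<bar>EU (\<lambda>n x. u n x * v n x)\<bar>) U"
    by (intro tendsto_rabs EU_tendsto[OF bpoly_mult[OF assms]])
  show "\<forall>\<^sub>F n in U. \<bar>EG (\<lambda>x. u n x * v n x)\<bar> \<le> nrm (u n) * nrm (v n)"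
    by (intro always_eventually allI EG_cauchy_schwarz[OF bpoly_polyfun[OF assms(1)] bpoly_polyfun[OF assms(2)] fin])
qed

lemma unrm_triangle:
  assumes "bpoly d u" "bpoly e v" shows "unrm (\<lambda>n x. u n x + v n x) \<le> unrm u + unrm v"
proof (rule tendsto_le[OF not_bot])
  have "bpoly (d + e) u" "bpoly (d + e) v" using assms by (auto intro: bpoly_mono)
  from unrm_tendsto[OF bpoly_add[OF this]]
  show "((\<lambda>n. nrm (\<lambda>x. u n x + v n x)) \<longlongrightarrow> unrm (\<lambda>n x. u n x + v n x)) U" .
  show "((\<lambda>n. nrm (u n) + nrm (v n)) \<longlongrightarrow> unrm u + unrm v) U"
    by (intro tendsto_add unrm_tendsto[OF assms(1)] unrm_tendsto[OF assms(2)])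
  show "\<forall>\<^sub>F n in U. nrm (\<lambda>x. u n x + v n x) \<le> nrm (u n) + nrm (v n)"
    by (intro always_eventually allI nrm_triangle[OF bpoly_polyfun[OF assms(1)] bpoly_polyfun[OF assms(2)] fin])
qed

lemma unrm_triangle3:
  assumes "bpoly d u" "bpoly e v" "bpoly l w"
  shows "unrm (\<lambda>n x. u n x - w n x) \<le> unrm (\<lambda>n x. u n x - v n x) + unrm (\<lambda>n x. v n x - w n x)"
  using unrm_triangle[OF bpoly_diff'[OF assms(1,2)] bpoly_diff'[OF assms(2,3)]] by simp

lemma unrm_minus_commute: "unrm (\<lambda>n x. u n x - v n x) = unrm (\<lambda>n x. v n x - u n x)"
  unfolding unrm_def by (subst nrm_minus_commute) (rule refl)

lemma unrm_product_bound:
  "\<exists>C\<ge>0. \<forall>u v. bpoly d u \<longrightarrow> bpoly e v \<longrightarrow> unrm (\<lambda>n x. u n x * v n x) \<le> C * (unrm u * unrm v)"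
proof -
  obtain C where C: "C \<ge> 0" "\<And>V f g. finite V \<Longrightarrow> polyfun V d f \<Longrightarrow> polyfun V e g \<Longrightarrow> nrm (\<lambda>x. f x * g x) \<le> C * (nrm f * nrm g)"
    using polyfun_product_bound[of d e] by auto
  have "unrm (\<lambda>n x. u n x * v n x) \<le> C * (unrm u * unrm v)" if u: "bpoly d u" and v: "bpoly e v" for u v
  proof (rule tendsto_le[OF not_bot])
    show "((\<lambda>n. nrm (\<lambda>x. u n x * v n x)) \<longlongrightarrow> unrm (\<lambda>n x. u n x * v n x)) U"
      by (rule unrm_tendsto[OF bpoly_mult[OF u v]])
    show "((\<lambda>n. C * (nrm (u n) * nrm (v n))) \<longlongrightarrow> C * (unrm u * unrm v)) U"
      by (intro tendsto_mult tendsto_const unrm_tendsto[OF u] unrm_tendsto[OF v])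
    show "\<forall>\<^sub>F n in U. nrm (\<lambda>x. u n x * v n x) \<le> C * (nrm (u n) * nrm (v n))"
      by (intro always_eventually allI C(2)[OF fin bpoly_polyfun[OF u] bpoly_polyfun[OF v]])
  qed
  then show ?thesis using C(1) by blast
qed

lemma beig_orthogonal:
  assumes "beig k u" "beig l v" "k \<noteq> l" shows "EU (\<lambda>n x. u n x * v n x) = 0"
  by (rule EU_eqI) (simp add: eig_orthogonal[OF beig_eig[OF assms(1)] beig_eig[OF assms(2)] fin assms(3)])

lemma bpoly_decomposition:
  assumes "bpoly d u"
  obtains w where "\<And>k. k \<le> d \<Longrightarrow> beig k (w k)" "\<And>n x. u n x = (\<Sum>k\<le>d. w k n x)"
proof -
  have "\<forall>n. \<exists>g. (\<forall>k\<le>d. eig (V n) k (g k)) \<and> (\<forall>x. u n x = (\<Sum>k\<le>d. g k x))"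
  proof
    fix n
    obtain g where "\<And>k. k \<le> d \<Longrightarrow> eig (V n) k (g k)" "\<And>x. u n x = (\<Sum>k\<le>d. g k x)"
      using eig_decomposition[OF bpoly_polyfun[OF assms, of n] fin] by blast
    then show "\<exists>g. (\<forall>k\<le>d. eig (V n) k (g k)) \<and> (\<forall>x. u n x = (\<Sum>k\<le>d. g k x))" by blast
  qed
  from choice[OF this] obtain g where g: "\<And>n k. k \<le> d \<Longrightarrow> eig (V n) k (g n k)"
    and s: "\<And>n x. u n x = (\<Sum>k\<le>d. g n k x)" by blast
  obtain B where B: "\<And>n. nrm (u n) \<le> B" using bpoly_bound[OF assms] by blast
  have "beig k (\<lambda>n. g n k)" if "k \<le> d" for k
    unfolding beig_def using g[OF that] order_trans[OF eig_component(2)[OF g s fin that] B] by blast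
  then show ?thesis using that[of "\<lambda>k n. g n k"] s by blast
qed

subsection \<open>Asymptotically Gaussian elements\<close>

text \<open>Orthogonality to decomposable elements. For \<open>k = 1\<close> there are no admissible
  \<open>i\<close> and \<open>j\<close>, so every element of order 1 is primitive.\<close>

definition primitive :: "nat \<Rightarrow> rseq \<Rightarrow> bool" where
  "primitive k u \<longleftrightarrow> 1 \<le> k \<and> beig k u \<and> (\<forall>i j A B. 0 < i \<longrightarrow> 0 < j \<longrightarrow> i + j = k \<longrightarrow> beig i A \<longrightarrow> beig j B \<longrightarrow>
     EU (\<lambda>n x. u n x * (A n x * B n x)) = 0)"

text \<open>Orthogonality to each pair of sequences upgrades to an estimate uniform over all pairs
  at almost every stage. Otherwise almost every stage, in the sense of \<open>U\<close>, carries a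
  violating pair; normalised, these pairs assemble into two bounded sequences that contradict
  primitivity.\<close>

lemma primitive_quasi_orth_fixed:
  assumes u: "primitive k u" and e: "\<epsilon> > 0" and ij: "0 < i" "0 < j" "i + j = k"
  shows "\<forall>\<^sub>F n in U. \<forall>A B. eig (V n) i A \<longrightarrow> eig (V n) j B \<longrightarrow> \<bar>EG (\<lambda>x. u n x * (A x * B x))\<bar> \<le> \<epsilon> * (nrm A * nrm B)"
    (is "\<forall>\<^sub>F n in U. ?good n")
proof (rule ccontr)
  assume "\<not> (\<forall>\<^sub>F n in U. ?good n)"
  then have bad: "\<forall>\<^sub>F n in U. \<not> ?good n" using ultra by blast
  have ub: "beig k u" using u by (simp add: primitive_def)
  have "\<exists>p. eig (V n) i (fst p) \<and> eig (V n) j (snd p) \<and> nrm (fst p) \<le> 1 \<and> nrm (snd p) \<le> 1 \<and>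
      (\<not> ?good n \<longrightarrow> \<epsilon> < \<bar>EG (\<lambda>x. u n x * (fst p x * snd p x))\<bar>)" for n
  proof (cases "?good n")
    case True
    \<comment> \<open>Stages without a violation are filled with zeros, which keeps the sequences in
      their chaoses.\<close>
    then show ?thesis by (intro exI[of _ "(\<lambda>x. 0, \<lambda>x. 0)"]) (simp add: eig_zero)
  next
    case False
    then obtain A B where A: "eig (V n) i A" and B: "eig (V n) j B"
      and gt: "\<epsilon> * (nrm A * nrm B) < \<bar>EG (\<lambda>x. u n x * (A x * B x))\<bar>" by (auto simp: not_le)
    \<comment> \<open>The trilinear bound makes the expectation vanish when a factor has norm 0. A
      violating pair therefore has nonzero norms and can be normalised.\<close>
    obtain C where C: "\<bar>EG (\<lambda>x. u n x * (A x * B x))\<bar> \<le> C * (nrm (u n) * (nrm A * nrm B))"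
      using eig_trilinear_bound[of k i j] fin[of n] beig_eig[OF ub, of n] A B by blast
    have "0 \<le> \<epsilon> * (nrm A * nrm B)" using e by simp
    then have "0 < C * (nrm (u n) * (nrm A * nrm B))" using gt C by linarith
    then have "nrm A \<noteq> 0" "nrm B \<noteq> 0" by auto
    then have pos: "nrm A > 0" "nrm B > 0" using nrm_nonneg[of A] nrm_nonneg[of B] by linarith+
    have "EG (\<lambda>x. u n x * ((1 / nrm A * A x) * (1 / nrm B * B x))) = 1 / (nrm A * nrm B) * EG (\<lambda>x. u n x * (A x * B x))"
      by (simp only: EG_scale[symmetric]) (simp add: mult.left_commute)
    then have "\<epsilon> < \<bar>EG (\<lambda>x. u n x * ((1 / nrm A * A x) * (1 / nrm B * B x)))\<bar>"
      using gt pos by (simp add: abs_mult pos_less_divide_eq)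
    then show ?thesis
      using pos eig_scale[OF A, of "1 / nrm A"] eig_scale[OF B, of "1 / nrm B"] nrm_scale[of "1 / nrm A" A] nrm_scale[of "1 / nrm B" B]
      by (intro exI[of _ "(\<lambda>x. 1 / nrm A * A x, \<lambda>x. 1 / nrm B * B x)"]) simp
  qed
  then have "\<forall>n. \<exists>p. eig (V n) i (fst p) \<and> eig (V n) j (snd p) \<and> nrm (fst p) \<le> 1 \<and> nrm (snd p) \<le> 1 \<and>
      (\<not> ?good n \<longrightarrow> \<epsilon> < \<bar>EG (\<lambda>x. u n x * (fst p x * snd p x))\<bar>)" ..
  from choice[OF this] obtain p where p: "\<forall>n. eig (V n) i (fst (p n)) \<and> eig (V n) j (snd (p n)) \<and> nrm (fst (p n)) \<le> 1 \<and>
      nrm (snd (p n)) \<le> 1 \<and> (\<not> ?good n \<longrightarrow> \<epsilon> < \<bar>EG (\<lambda>x. u n x * (fst (p n) x * snd (p n) x))\<bar>)" ..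
  define A where "A n = fst (p n)" for n
  define B where "B n = snd (p n)" for n
  have A: "\<And>n. eig (V n) i (A n)" and B: "\<And>n. eig (V n) j (B n)"
    and n1: "\<And>n. nrm (A n) \<le> 1" "\<And>n. nrm (B n) \<le> 1"
    and gt: "\<And>n. \<not> ?good n \<Longrightarrow> \<epsilon> < \<bar>EG (\<lambda>x. u n x * (A n x * B n x))\<bar>"
    using p unfolding A_def B_def by blast+
  have AB: "beig i A" "beig j B" using A B n1 by (auto simp: beig_def)
  then have 0: "EU (\<lambda>n x. u n x * (A n x * B n x)) = 0"
    using u ij unfolding primitive_def by blast
  have "((\<lambda>n. EG (\<lambda>x. u n x * (A n x * B n x))) \<longlongrightarrow> 0) U"
    using EU_tendsto[OF bpoly_mult[OF beig_bpoly[OF ub] bpoly_mult[OF AB[THEN beig_bpoly]]]] unfolding 0 .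
  then have "\<forall>\<^sub>F n in U. \<bar>EG (\<lambda>x. u n x * (A n x * B n x))\<bar> < \<epsilon>"
    using e by (auto simp: tendsto_iff)
  with bad have "\<forall>\<^sub>F n in U. False"
  proof eventually_elim
    case (elim n)
    show ?case using gt[OF elim(1)] elim(2) by linarith
  qed
  then show False using not_bot by simp
qed

lemma primitive_quasi_orth:
  assumes u: "primitive k u" and e: "\<epsilon> > 0"
  shows "\<forall>\<^sub>F n in U. quasi_orth (V n) k (u n) \<epsilon>"
proof -
  have "\<forall>\<^sub>F n in U. \<forall>i\<in>{0<..<k}. \<forall>A B. eig (V n) i A \<longrightarrow> eig (V n) (k - i) B \<longrightarrow>
      \<bar>EG (\<lambda>x. u n x * (A x * B x))\<bar> \<le> \<epsilon> * (nrm A * nrm B)"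
  proof (rule eventually_ball_finite, simp, rule ballI)
    fix i assume "i \<in> {0<..<k}"
    then have "0 < i" "0 < k - i" "i + (k - i) = k" by auto
    then show "\<forall>\<^sub>F n in U. \<forall>A B. eig (V n) i A \<longrightarrow> eig (V n) (k - i) B \<longrightarrow>
      \<bar>EG (\<lambda>x. u n x * (A x * B x))\<bar> \<le> \<epsilon> * (nrm A * nrm B)"
      by (rule primitive_quasi_orth_fixed[OF u e])
  qed
  then show ?thesis
  proof eventually_elim
    case (elim n)
    show ?case unfolding quasi_orth_def
    proof (intro allI impI)
      fix i j A B assume ij: "0 < i" "0 < j" "i + j = k" and A: "eig (V n) i A" and B: "eig (V n) j B"
      have "i \<in> {0<..<k}" "j = k - i" using ij by auto
      then show "\<bar>EG (\<lambda>x. u n x * (A x * B x))\<bar> \<le> \<epsilon> * (nrm A * nrm B)"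
        using elim[rule_format, of i A B] A B by simp
    qed
  qed
qed

lemma primitive_grad_prod:
  assumes u: "primitive k u" and v: "primitive l v"
  shows "((\<lambda>n. nrm (\<lambda>x. grad_prod (V n) (u n) (v n) x - real k * EG (\<lambda>x. u n x * v n x))) \<longlongrightarrow> 0) U"
proof (rule tendstoI)
  fix e :: real assume e: "e > 0"
  have ub: "beig k u" and vb: "beig l v" and k1: "1 \<le> k" and l1: "1 \<le> l" using u v by (auto simp: primitive_def)
  obtain B where B: "\<And>n. nrm (u n) \<le> B" "B \<ge> 0" using bpoly_bound[OF beig_bpoly[OF ub]] by blast
  obtain B' where B': "\<And>n. nrm (v n) \<le> B'" "B' \<ge> 0" using bpoly_bound[OF beig_bpoly[OF vb]] by blast
  obtain C where C0: "C \<ge> 0" and C: "\<And>V N N' \<epsilon>. finite V \<Longrightarrow> 0 \<le> \<epsilon> \<Longrightarrow> eig V k N \<Longrightarrow> eig V l N' \<Longrightarrow> quasi_orth V k N \<epsilon> \<Longrightarrow>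
     quasi_orth V l N' \<epsilon> \<Longrightarrow>
     nrm (\<lambda>x. grad_prod V N N' x - real k * EG (\<lambda>x. N x * N' x)) \<le> C * \<epsilon> * (nrm N + nrm N')"
    using quasi_orth_grad_prod[OF k1 l1] by blast
  \<comment> \<open>The added 1 keeps the quotient defined when \<open>C * (B + B')\<close> is 0 and
    makes the final estimate strict.\<close>
  define \<epsilon> where "\<epsilon> = e / (C * (B + B') + 1)"
  have pos: "C * (B + B') + 1 > 0" using C0 B(2) B'(2) by (simp add: add_nonneg_pos)
  then have \<epsilon>: "\<epsilon> > 0" using e by (simp add: \<epsilon>_def)
  from primitive_quasi_orth[OF u \<epsilon>] primitive_quasi_orth[OF v \<epsilon>]
  show "\<forall>\<^sub>F n in U. dist (nrm (\<lambda>x. grad_prod (V n) (u n) (v n) x - real k * EG (\<lambda>x. u n x * v n x))) 0 < e"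
  proof eventually_elim
    case (elim n)
    have "nrm (\<lambda>x. grad_prod (V n) (u n) (v n) x - real k * EG (\<lambda>x. u n x * v n x)) \<le> C * \<epsilon> * (nrm (u n) + nrm (v n))"
      by (rule C[OF fin less_imp_le[OF \<epsilon>] beig_eig[OF ub] beig_eig[OF vb] elim])
    also have "\<dots> \<le> C * \<epsilon> * (B + B')" using C0 \<epsilon> B(1) B'(1) by (intro mult_left_mono add_mono) auto
    also have "\<dots> < \<epsilon> * (C * (B + B') + 1)" using \<epsilon> by (simp add: algebra_simps)
    also have "\<dots> = e" using pos by (simp add: \<epsilon>_def)
    finally show ?case by simp
  qed
qed

lemma bpoly_subst:
  assumes "polyfun W d q" "\<And>b. b \<in> W \<Longrightarrow> bpoly D b"
  shows "bpoly (d * D) (\<lambda>n x. q (eval_at n x))"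
  using assms(1)
proof induction
  case (const d c)
  show ?case by (rule bpoly_const)
next
  case (add d f g)
  show ?case by (rule bpoly_add[OF add.IH])
next
  case (var_mult b d f)
  show ?case using bpoly_mult[OF assms(2)[OF var_mult(1)] var_mult(3)] by (simp add: eval_at_def)
qed

text \<open>With \<open>Q\<close> the substituted polynomial and \<open>k\<close> the order of
  \<open>a\<close>, \<open>k\<close> times the mean of \<open>a * Q\<close> is the mean of
  \<open>grad_prod\<close> of \<open>a\<close> and \<open>Q\<close>. By the chain rule this is a sum
  over \<open>b\<close> of \<open>pdiff b q\<close> times \<open>grad_prod\<close> of
  \<open>a\<close> and \<open>b\<close>, and the latter is asymptotically the constant
  \<open>k\<close> times the covariance of \<open>a\<close> and \<open>b\<close>. The factor
  \<open>k\<close> cancels, so primitives of different orders can be mixed.\<close>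

lemma primitive_wick:
  assumes W: "finite W" and prim: "\<And>b. b \<in> W \<Longrightarrow> \<exists>k\<le>D. primitive k b" and a: "a \<in> W" and q: "polyfun W d q"
  shows "EU (\<lambda>n x. a n x * q (eval_at n x)) = (\<Sum>b\<in>W. EU (\<lambda>n x. a n x * b n x) * EU (\<lambda>n x. pdiff b q (eval_at n x)))"
proof -
  have bp: "bpoly D b" if "b \<in> W" for b
    using prim[OF that] bpoly_mono beig_bpoly unfolding primitive_def by blast
  obtain k where k: "primitive k a" using prim[OF a] by blast
  then have k1: "1 \<le> k" and ab: "beig k a" by (auto simp: primitive_def)
  define Q where "Q = (\<lambda>n x. q (eval_at n x))"
  define R where "R b = (\<lambda>n x. pdiff b q (eval_at n x))" for b
  have Q: "bpoly (d * D) Q" unfolding Q_def by (rule bpoly_subst[OF q bp])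
  have R: "bpoly (d * D) (R b)" for b unfolding R_def by (rule bpoly_subst[OF polyfun_pdiff'[OF q] bp])
  \<comment> \<open>The deviation of the carre du champ from its limiting constant;
    \<open>primitive_grad_prod\<close> sends its norm to 0.\<close>
  define err where "err b n = (\<lambda>x. grad_prod (V n) (a n) (b n) x - real k * EG (\<lambda>x. a n x * b n x))" for b :: rseq and n
  have errp: "polyfun (V n) (k + D) (err b n)" if "b \<in> W" for b n
  proof -
    have "polyfun (V n) (k + D) (grad_prod (V n) (a n) (b n))"
      using polyfun_degree_mono[OF polyfun_grad_prod[OF eig_polyfun[OF beig_eig[OF ab]] bpoly_polyfun[OF bp[OF that]]]] by simp
    then show ?thesis unfolding err_def by (intro polyfun_diff polyfun.const)
  qed
  have eq: "real k * EG (\<lambda>x. a n x * Q n x)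
     = real k * (\<Sum>b\<in>W. EG (\<lambda>x. a n x * b n x) * EG (R b n)) + (\<Sum>b\<in>W. EG (\<lambda>x. R b n x * err b n x))" for n
  proof -
    have "grad_prod (V n) (a n) (Q n) x = (\<Sum>b\<in>W. R b n x * grad_prod (V n) (a n) (b n) x)" for x
    proof -
      have "grad_prod (V n) (a n) (Q n) x = (\<Sum>i\<in>V n. \<Sum>b\<in>W. R b n x * (pdiff i (a n) x * pdiff i (b n) x))"
      proof -
        have "pdiff i (Q n) x = (\<Sum>b\<in>W. R b n x * pdiff i (b n) x)" for i
        proof -
          have "pdiff i (\<lambda>x. q (\<lambda>b. b n x)) = (\<lambda>x. \<Sum>b\<in>W. pdiff b q (\<lambda>b. b n x) * pdiff i (b n) x)"
            by (rule pdiff_chain[where q="\<lambda>b. b n", OF q W]) (rule bpoly_polyfun[OF bp])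
          then show ?thesis unfolding Q_def R_def eval_at_def[abs_def] by simp
        qed
        then show ?thesis unfolding grad_prod_def by (simp add: sum_distrib_left mult.left_commute)
      qed
      also have "\<dots> = (\<Sum>b\<in>W. R b n x * grad_prod (V n) (a n) (b n) x)"
        by (subst sum.swap) (simp add: grad_prod_def sum_distrib_left)
      finally show ?thesis .
    qed
    then have g: "grad_prod (V n) (a n) (Q n) = (\<lambda>x. \<Sum>b\<in>W. real k * EG (\<lambda>x. a n x * b n x) * R b n x + R b n x * err b n x)"
      by (auto simp: err_def algebra_simps fun_eq_iff)
    have p1: "polyfun (V n) (d * D + (k + D)) (\<lambda>x. c * R b n x)" for b c
      by (rule polyfun_scale) (rule polyfun_degree_mono[OF bpoly_polyfun[OF R]], simp)
    have p2: "polyfun (V n) (d * D + (k + D)) (\<lambda>x. R b n x * err b n x)" if "b \<in> W" for b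
      by (intro polyfun_mult bpoly_polyfun[OF R] errp that)
    have "real k * EG (\<lambda>x. a n x * Q n x) = EG (grad_prod (V n) (a n) (Q n))"
      using eig_EG_grad_prod[OF beig_eig[OF ab] bpoly_polyfun[OF Q] fin] by simp
    also have "\<dots> = (\<Sum>b\<in>W. EG (\<lambda>x. real k * EG (\<lambda>x. a n x * b n x) * R b n x + R b n x * err b n x))"
      unfolding g by (rule EG_sum[OF _ fin]) (rule polyfun.add[OF p1 p2])
    also have "\<dots> = (\<Sum>b\<in>W. real k * EG (\<lambda>x. a n x * b n x) * EG (R b n) + EG (\<lambda>x. R b n x * err b n x))"
      by (intro sum.cong refl) (simp only: EG_add[OF p1 p2 fin] EG_scale)
    finally show ?thesis by (simp add: sum.distrib sum_distrib_left mult.assoc)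
  qed
  have err0: "((\<lambda>n. EG (\<lambda>x. R b n x * err b n x)) \<longlongrightarrow> 0) U" if b: "b \<in> W" for b
  proof -
    obtain B where B: "\<And>n. nrm (R b n) \<le> B" using bpoly_bound[OF R] by blast
    obtain l where l: "primitive l b" using prim[OF b] by blast
    have "((\<lambda>n. B * nrm (err b n)) \<longlongrightarrow> B * 0) U"
      unfolding err_def by (intro tendsto_mult tendsto_const primitive_grad_prod[OF k l])
    then have lim: "((\<lambda>n. B * nrm (err b n)) \<longlongrightarrow> 0) U" by simp
    show ?thesis
    proof (rule Lim_null_comparison[OF _ lim], rule always_eventually, rule allI)
      fix n
      have "\<bar>EG (\<lambda>x. R b n x * err b n x)\<bar> \<le> nrm (R b n) * nrm (err b n)"
        by (rule EG_cauchy_schwarz[OF bpoly_polyfun[OF R] errp[OF b] fin])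
      also have "\<dots> \<le> B * nrm (err b n)" by (intro mult_right_mono B nrm_nonneg)
      finally show "norm (EG (\<lambda>x. R b n x * err b n x)) \<le> B * nrm (err b n)" by simp
    qed
  qed
  have "((\<lambda>n. real k * (\<Sum>b\<in>W. EG (\<lambda>x. a n x * b n x) * EG (R b n)) + (\<Sum>b\<in>W. EG (\<lambda>x. R b n x * err b n x)))
     \<longlongrightarrow> real k * (\<Sum>b\<in>W. EU (\<lambda>n x. a n x * b n x) * EU (R b)) + (\<Sum>b\<in>W. 0)) U"
    by (intro tendsto_add tendsto_mult tendsto_const tendsto_sum EU_tendsto[OF R] err0
        EU_tendsto[OF bpoly_mult[OF bp[OF a] bp]])
  moreover have "((\<lambda>n. real k * EG (\<lambda>x. a n x * Q n x)) \<longlongrightarrow> real k * EU (\<lambda>n x. a n x * Q n x)) U"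
    by (intro tendsto_mult tendsto_const EU_tendsto[OF bpoly_mult[OF bp[OF a] Q]])
  ultimately have "real k * EU (\<lambda>n x. a n x * Q n x) = real k * (\<Sum>b\<in>W. EU (\<lambda>n x. a n x * b n x) * EU (R b))"
    unfolding eq using tendsto_unique[OF not_bot] by fastforce
  then show ?thesis using k1 unfolding Q_def R_def by simp
qed

definition orthonormal :: "rseq set \<Rightarrow> bool" where
  "orthonormal W \<longleftrightarrow> (\<forall>a\<in>W. \<forall>b\<in>W. EU (\<lambda>n x. a n x * b n x) = (if a = b then 1 else 0))"

text \<open>Wick's formula for an orthonormal family and integration by parts for the coordinates
  \<open>idx b\<close> give both sides the same recursion in the degree.\<close>

lemma primitive_gaussian:
  assumes W: "finite W" and prim: "\<And>b. b \<in> W \<Longrightarrow> \<exists>k\<le>D. primitive k b" and on: "orthonormal W"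
    and inj: "inj_on idx W" and q: "polyfun W d q"
  shows "EU (\<lambda>n x. q (eval_at n x)) = EG (\<lambda>x. q (\<lambda>b. x (idx b)))"
  using q
proof (induction d arbitrary: q rule: less_induct)
  case (less d)
  have bp: "bpoly D b" if "b \<in> W" for b
    using prim[OF that] bpoly_mono beig_bpoly unfolding primitive_def by blast
  have idx: "polyfun (idx ` W) 1 (\<lambda>x. x (idx b))" if "b \<in> W" for b using that by (intro polyfun_var) auto
  \<comment> \<open>The structural induction takes sums and products apart. The outer induction on
    the degree supplies the claim for the derivative \<open>pdiff a f\<close>, which is not a
    constituent of the polynomial.\<close>
  from less.prems less.IH show ?case
  proof (induction rule: polyfun.induct)
    case (add d f g)
    have "polyfun (idx ` W) (d * 1) (\<lambda>x. f (\<lambda>b. x (idx b)))" "polyfun (idx ` W) (d * 1) (\<lambda>x. g (\<lambda>b. x (idx b)))"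
      using add idx by (auto intro!: polyfun_subst[of W d _ "idx ` W" 1 "\<lambda>b x. x (idx b)", simplified])
    from EG_add[OF this] have "EG (\<lambda>x. f (\<lambda>b. x (idx b)) + g (\<lambda>b. x (idx b))) = EG (\<lambda>x. f (\<lambda>b. x (idx b))) + EG (\<lambda>x. g (\<lambda>b. x (idx b)))"
      using W by simp
    then show ?case using add EU_add[OF bpoly_subst[OF add(1) bp] bpoly_subst[OF add(2) bp]] by simp
  next
    case (var_mult a d f)
    have f': "polyfun (idx ` W) d (\<lambda>x. f (\<lambda>b. x (idx b)))"
      using polyfun_subst[OF var_mult(2), of "idx ` W" 1 "\<lambda>b x. x (idx b)"] idx by simp
    \<comment> \<open>Injectivity of \<open>idx\<close> keeps distinct members of \<open>W\<close>
      on distinct coordinates, so only the variable \<open>a\<close> reacts to the coordinate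
      \<open>idx a\<close>.\<close>
    have "pdiff (idx a) (\<lambda>x. f (\<lambda>b. x (idx b))) x = (\<Sum>b\<in>W. pdiff b f (\<lambda>b. x (idx b)) * (if b = a then 1 else 0))" for x
      unfolding pdiff_chain[where q="\<lambda>b x. x (idx b)" and i="idx a", OF var_mult(2) W idx, simplified] using inj var_mult(1)
      by (intro sum.cong refl) (auto simp: pdiff_var inj_on_eq_iff)
    then have pd: "pdiff (idx a) (\<lambda>x. f (\<lambda>b. x (idx b))) = (\<lambda>x. pdiff a f (\<lambda>b. x (idx b)))"
      using W var_mult(1) by (intro ext) (simp add: if_distrib[of "\<lambda>z. _ * z"] sum.delta cong: if_cong)
    have "EU (\<lambda>n x. a n x * f (eval_at n x)) = (\<Sum>b\<in>W. EU (\<lambda>n x. a n x * b n x) * EU (\<lambda>n x. pdiff b f (eval_at n x)))"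
      by (rule primitive_wick[OF W prim var_mult(1,2)])
    also have "\<dots> = (\<Sum>b\<in>W. if a = b then EU (\<lambda>n x. pdiff b f (eval_at n x)) else 0)"
      using on var_mult(1) by (intro sum.cong refl) (auto simp: orthonormal_def)
    also have "\<dots> = EU (\<lambda>n x. pdiff a f (eval_at n x))" using W var_mult(1) by (simp add: sum.delta)
    also have "\<dots> = EG (\<lambda>x. pdiff a f (\<lambda>b. x (idx b)))"
      using polyfun_pdiff'[OF var_mult(2)] by (intro var_mult(4)[of d]) auto
    also have "\<dots> = EG (\<lambda>x. x (idx a) * f (\<lambda>b. x (idx b)))"
      using EG_by_parts[OF f', of "idx a"] W var_mult(1) unfolding pd by simp
    finally show ?case by (simp only: eval_at_def[of _ _ a])
  qed simp
qed

end

context wiener_ultraproduct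
begin

subsection \<open>Completeness and orthogonal projection\<close>

text \<open>Diagonal argument: at stage \<open>n\<close> follow the sequence as long as it is already Cauchy there.\<close>

lemma beig_complete:
  assumes u: "\<And>r. beig k (u r)"
    and step: "\<And>r. \<forall>\<^sub>F n in U. nrm (\<lambda>x. u r n x - u (Suc r) n x) \<le> (1/2) ^ r"
  obtains v where "beig k v" "\<And>r. unrm (\<lambda>n x. u r n x - v n x) \<le> 2 * (1/2) ^ r"
proof -
  define P where "P r n \<longleftrightarrow> r \<le> n \<and> (\<forall>j<r. nrm (\<lambda>x. u j n x - u (Suc j) n x) \<le> (1/2) ^ j)" for r n
  define \<kappa> where "\<kappa> n = (GREATEST r. P r n)" for n
  have P0: "P 0 n" for n by (simp add: P_def)
  have bound: "P r n \<Longrightarrow> r \<le> n" for r n by (simp add: P_def)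
  have P\<kappa>: "P (\<kappa> n) n" for n unfolding \<kappa>_def by (rule GreatestI_nat[of "\<lambda>r. P r n", OF P0]) (rule bound)
  have \<kappa>_ge: "r \<le> \<kappa> n" if "P r n" for r n unfolding \<kappa>_def by (rule Greatest_le_nat[of "\<lambda>r. P r n", OF that]) (rule bound)
  define v where "v n = u (\<kappa> n) n" for n
  have up: "polyfun (V n) k (u r n)" for r n by (rule eig_polyfun[OF beig_eig[OF u]])
  have dist: "nrm (\<lambda>x. u r n x - u s n x) \<le> 2 * (1/2) ^ r - 2 * (1/2) ^ s" if "r \<le> s" "P s n" for r s n
    using that
  proof (induction s rule: dec_induct)
    case base then show ?case by simp
  next
    case (step s)
    then have "P s n" and le: "nrm (\<lambda>x. u s n x - u (Suc s) n x) \<le> (1/2) ^ s" by (auto simp: P_def)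
    then have "nrm (\<lambda>x. u r n x - u s n x) \<le> 2 * (1/2) ^ r - 2 * (1/2) ^ s" using step by blast
    then show ?case using nrm_triangle3[OF up[of n r] up[of n s] up[of n "Suc s"] fin] le by simp
  qed
  have vdist: "nrm (\<lambda>x. u r n x - v n x) \<le> 2 * (1/2) ^ r" if "P r n" for r n
  proof -
    have "(0::real) \<le> 2 * (1/2) ^ \<kappa> n" by simp
    then show ?thesis using dist[OF \<kappa>_ge[OF that] P\<kappa>] unfolding v_def by linarith
  qed
  have evP: "\<forall>\<^sub>F n in U. P r n" for r
  proof -
    have "\<forall>\<^sub>F n in U. \<forall>j\<in>{..<r}. nrm (\<lambda>x. u j n x - u (Suc j) n x) \<le> (1/2) ^ j"
      by (rule eventually_ball_finite) (auto intro: step)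
    with eventually_ge[of r] show ?thesis by eventually_elim (auto simp: P_def)
  qed
  obtain B where B: "\<And>n. nrm (u 0 n) \<le> B" using bpoly_bound[OF beig_bpoly[OF u]] by blast
  have "nrm (v n) \<le> B + 2" for n
  proof -
    have "nrm (\<lambda>x. v n x - 0) \<le> nrm (\<lambda>x. v n x - u 0 n x) + nrm (\<lambda>x. u 0 n x - 0)"
      unfolding v_def by (rule nrm_triangle3[OF up up polyfun.const fin])
    then show ?thesis using vdist[OF P0, of n] B[of n] by (simp add: nrm_minus_commute[of "v n"])
  qed
  then have v: "beig k v" unfolding beig_def v_def using beig_eig[OF u] by blast
  have "unrm (\<lambda>n x. u r n x - v n x) \<le> 2 * (1/2) ^ r" for r
  proof (rule tendsto_upperbound[OF unrm_tendsto[OF bpoly_diff[OF beig_bpoly[OF u] beig_bpoly[OF v]]] _ not_bot])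
    show "\<forall>\<^sub>F n in U. nrm (\<lambda>x. u r n x - v n x) \<le> 2 * (1/2) ^ r"
      using evP[of r] by eventually_elim (rule vdist)
  qed
  with v show ?thesis using that by blast
qed

lemma unrm_diff_scale_sq:
  assumes "bpoly d u" "bpoly d v"
  shows "(unrm (\<lambda>n x. u n x - t * v n x))\<^sup>2 = (unrm u)\<^sup>2 - 2 * t * EU (\<lambda>n x. u n x * v n x) + t\<^sup>2 * (unrm v)\<^sup>2"
proof -
  note b = bpoly_mult[OF assms(1) assms(1)] bpoly_mult[OF assms] bpoly_mult[OF assms(2) assms(2)]
  have "(unrm (\<lambda>n x. u n x - t * v n x))\<^sup>2 = EU (\<lambda>n x. (u n x - t * v n x) * (u n x - t * v n x))"
    by (rule EU_square[OF bpoly_diff[OF assms(1) bpoly_scale[OF assms(2)]], symmetric])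
  also have "(\<lambda>n x. (u n x - t * v n x) * (u n x - t * v n x))
     = (\<lambda>n x. (u n x * u n x - (2 * t) * (u n x * v n x)) + t\<^sup>2 * (v n x * v n x))"
    by (auto simp: fun_eq_iff algebra_simps power2_eq_square)
  also have "EU \<dots> = EU (\<lambda>n x. u n x * u n x) - 2 * t * EU (\<lambda>n x. u n x * v n x) + t\<^sup>2 * EU (\<lambda>n x. v n x * v n x)"
    by (simp only: EU_add[OF bpoly_diff[OF b(1) bpoly_scale[OF b(2)]] bpoly_scale[OF b(3)]]
        EU_diff[OF b(1) bpoly_scale[OF b(2)]] EU_scale[OF b(2)] EU_scale[OF b(3)])
  finally show ?thesis by (simp only: EU_square[OF assms(1)] EU_square[OF assms(2)])
qed

text \<open>The Hilbert space projection onto the closure of \<open>S\<close>, with \<open>w\<close>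
  the residual. The minimising sequence converges because near-minimality implies near-orthogonality
  to \<open>S\<close>, and differences of its members lie in \<open>S\<close> themselves.\<close>

lemma beig_projection:
  assumes S: "\<And>s. s \<in> S \<Longrightarrow> beig k s" and zero: "(\<lambda>n x. 0) \<in> S"
    and add: "\<And>s t. s \<in> S \<Longrightarrow> t \<in> S \<Longrightarrow> (\<lambda>n x. s n x + t n x) \<in> S"
    and scale: "\<And>s c. s \<in> S \<Longrightarrow> (\<lambda>n x. c * s n x) \<in> S"
    and u: "beig k u"
  obtains w where "beig k w" "\<And>s. s \<in> S \<Longrightarrow> EU (\<lambda>n x. w n x * s n x) = 0"
    "\<And>\<epsilon>. \<epsilon> > 0 \<Longrightarrow> \<exists>s\<in>S. unrm (\<lambda>n x. u n x - w n x - s n x) < \<epsilon>"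
proof -
  define D where "D = (\<lambda>s. (unrm (\<lambda>n x. u n x - s n x))\<^sup>2) ` S"
  define \<delta> where "\<delta> = Inf D"
  have D: "D \<noteq> {}" "bdd_below D" using zero by (auto simp: D_def intro!: bdd_belowI[of _ 0])
  have \<delta>: "\<delta> \<le> (unrm (\<lambda>n x. u n x - s n x))\<^sup>2" if "s \<in> S" for s
    unfolding \<delta>_def using that D by (intro cInf_lower) (auto simp: D_def)
  \<comment> \<open>The exponent \<open>r + 2\<close> makes consecutive distances at most
    \<open>(1/2)^(r+3) + (1/2)^(r+2)\<close>, strictly below \<open>(1/2)^r\<close>. Strictness is
    needed to pass from the limit \<open>unrm\<close> to the norms at almost all stages.\<close>
  have "\<exists>s\<in>S. (unrm (\<lambda>n x. u n x - s n x))\<^sup>2 < \<delta> + ((1/2) ^ (r + 2))\<^sup>2" for r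
  proof -
    have "Inf D < \<delta> + ((1/2) ^ (r + 2))\<^sup>2" by (simp add: \<delta>_def)
    then show ?thesis using cInf_less_iff[OF D] by (auto simp: D_def)
  qed
  then have "\<forall>r. \<exists>s. s \<in> S \<and> (unrm (\<lambda>n x. u n x - s n x))\<^sup>2 < \<delta> + ((1/2) ^ (r + 2))\<^sup>2" by blast
  from choice[OF this] obtain s where sS: "\<And>r. s r \<in> S"
    and s: "\<And>r. (unrm (\<lambda>n x. u n x - s r n x))\<^sup>2 < \<delta> + ((1/2) ^ (r + 2))\<^sup>2" by blast
  have bS: "bpoly k t" if "t \<in> S" for t using beig_bpoly[OF S[OF that]] .
  have bu: "bpoly k u" using beig_bpoly[OF u] .
  have bw: "bpoly k (\<lambda>n x. u n x - t n x)" if "t \<in> S" for t by (rule bpoly_diff[OF bu bS[OF that]])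
  have orth: "\<bar>EU (\<lambda>n x. (u n x - s r n x) * t n x)\<bar> \<le> (1/2) ^ (r + 2) * unrm t" if t: "t \<in> S" for t r
  proof -
    let ?b = "EU (\<lambda>n x. (u n x - s r n x) * t n x)"
    have "?b\<^sup>2 \<le> ((1/2) ^ (r + 2))\<^sup>2 * (unrm t)\<^sup>2"
    proof (rule quadratic_nonneg_imp_square_le)
      \<comment> \<open>Moving from \<open>s r\<close> by a multiple of \<open>t\<close> stays in
        \<open>S\<close>, hence at squared distance at least \<delta> from \<open>u\<close>. So the
        resulting quadratic in \<open>c\<close> is nonnegative, and its discriminant gives the
        bound.\<close>
      fix c :: real
      have "(\<lambda>n x. s r n x + c * t n x) \<in> S" by (intro add scale sS t)
      from \<delta>[OF this] have "\<delta> \<le> (unrm (\<lambda>n x. (u n x - s r n x) - c * t n x))\<^sup>2"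
        by (simp add: algebra_simps)
      also have "\<dots> = (unrm (\<lambda>n x. u n x - s r n x))\<^sup>2 - 2 * c * ?b + c\<^sup>2 * (unrm t)\<^sup>2"
        by (rule unrm_diff_scale_sq[OF bw[OF sS] bS[OF t]])
      finally show "0 \<le> ((1/2) ^ (r + 2))\<^sup>2 - 2 * c * ?b + c\<^sup>2 * (unrm t)\<^sup>2" using s[of r] by linarith
    qed simp
    then have "?b\<^sup>2 \<le> ((1/2) ^ (r + 2) * unrm t)\<^sup>2" by (simp only: power_mult_distrib)
    then have "\<bar>?b\<bar> \<le> \<bar>(1/2) ^ (r + 2) * unrm t\<bar>" by (simp only: abs_le_square_iff)
    then show ?thesis using unrm_nonneg[OF bS[OF t]] by (simp add: abs_mult)
  qed
  have cauchy: "unrm (\<lambda>n x. s r n x - s (Suc r) n x) < (1/2) ^ r" for r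
  proof -
    let ?d = "\<lambda>n x. s r n x - s (Suc r) n x"
    have dS: "?d \<in> S" using add[OF sS[of r] scale[OF sS[of "Suc r"], of "-1"]] by simp
    \<comment> \<open>The difference of two near-minimisers belongs to \<open>S\<close>, so
      near-orthogonality can be tested on the difference itself.\<close>
    have "unrm ?d * unrm ?d = EU (\<lambda>n x. ?d n x * ?d n x)" using EU_square[OF bS[OF dS]] by (simp add: power2_eq_square)
    also have "\<dots> = EU (\<lambda>n x. (u n x - s (Suc r) n x) * ?d n x - (u n x - s r n x) * ?d n x)"
      by (simp add: algebra_simps)
    also have "\<dots> = EU (\<lambda>n x. (u n x - s (Suc r) n x) * ?d n x) - EU (\<lambda>n x. (u n x - s r n x) * ?d n x)"
      by (rule EU_diff[OF bpoly_mult[OF bw[OF sS] bS[OF dS]] bpoly_mult[OF bw[OF sS] bS[OF dS]]])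
    also have "\<dots> \<le> (1/2) ^ (Suc r + 2) * unrm ?d + (1/2) ^ (r + 2) * unrm ?d"
      using orth[OF dS, of r] orth[OF dS, of "Suc r"] by linarith
    finally have "unrm ?d * unrm ?d \<le> ((1/2) ^ (Suc r + 2) + (1/2) ^ (r + 2)) * unrm ?d"
      by (simp only: distrib_right)
    then have "unrm ?d \<le> (1/2) ^ (Suc r + 2) + (1/2) ^ (r + 2)"
      by (rule le_of_square_le[rotated 2]) (use unrm_nonneg[OF bS[OF dS]] in auto)
    also have "\<dots> < (1/2) ^ r" by simp
    finally show ?thesis .
  qed
  have "\<forall>\<^sub>F n in U. nrm (\<lambda>x. s r n x - s (Suc r) n x) \<le> (1/2) ^ r" for r
    using order_tendstoD(2)[OF unrm_tendsto[OF bpoly_diff[OF bS[OF sS] bS[OF sS]]] cauchy[of r]]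
    by eventually_elim simp
  from beig_complete[of k s, OF S[OF sS] this]
  obtain v where v: "beig k v" and vs: "\<And>r. unrm (\<lambda>n x. s r n x - v n x) \<le> 2 * (1/2) ^ r" by blast
  have bv: "bpoly k v" using beig_bpoly[OF v] .
  have lim: "((\<lambda>r. c * (1/2) ^ r) \<longlonglongrightarrow> 0)" for c :: real
    using tendsto_mult_left[OF LIMSEQ_realpow_zero[of "1/2"], of c] by simp
  show ?thesis
  proof (rule that[of "\<lambda>n x. u n x - v n x"])
    show "beig k (\<lambda>n x. u n x - v n x)" by (rule beig_diff[OF u v])
  next
    fix t assume t: "t \<in> S"
    have "\<bar>EU (\<lambda>n x. (u n x - v n x) * t n x)\<bar> \<le> (3 * unrm t) * (1/2) ^ r" for r
    proof -
      have "EU (\<lambda>n x. (u n x - v n x) * t n x) = EU (\<lambda>n x. (u n x - s r n x) * t n x + (s r n x - v n x) * t n x)"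
        by (simp add: algebra_simps)
      also have "\<dots> = EU (\<lambda>n x. (u n x - s r n x) * t n x) + EU (\<lambda>n x. (s r n x - v n x) * t n x)"
        by (rule EU_add[OF bpoly_mult[OF bw[OF sS] bS[OF t]] bpoly_mult[OF bpoly_diff[OF bS[OF sS] bv] bS[OF t]]])
      finally have "\<bar>EU (\<lambda>n x. (u n x - v n x) * t n x)\<bar> \<le> (1/2) ^ (r + 2) * unrm t + unrm (\<lambda>n x. s r n x - v n x) * unrm t"
        using orth[OF t, of r] EU_cauchy_schwarz[OF bpoly_diff[OF bS[OF sS[of r]] bv] bS[OF t]] by linarith
      also have "\<dots> \<le> (1/2) ^ r * unrm t + (2 * (1/2) ^ r) * unrm t"
        using vs unrm_nonneg[OF bS[OF t]] by (intro add_mono mult_right_mono) auto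
      finally show ?thesis by (simp add: algebra_simps)
    qed
    then have "\<bar>EU (\<lambda>n x. (u n x - v n x) * t n x)\<bar> \<le> 0"
      by (intro LIMSEQ_le_const[OF lim]) auto
    then show "EU (\<lambda>n x. (u n x - v n x) * t n x) = 0" by simp
  next
    fix \<epsilon> :: real assume "\<epsilon> > 0"
    then have "\<forall>\<^sub>F r in sequentially. 2 * (1/2) ^ r < \<epsilon>" by (rule order_tendstoD(2)[OF lim])
    then obtain r where "2 * (1/2) ^ r < \<epsilon>" by (auto simp: eventually_sequentially)
    then have "unrm (\<lambda>n x. u n x - (u n x - v n x) - s r n x) < \<epsilon>"
      using vs[of r] unrm_minus_commute[of "s r" v] by simp
    then show "\<exists>s\<in>S. unrm (\<lambda>n x. u n x - (u n x - v n x) - s n x) < \<epsilon>" using sS by blast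
  qed
qed

subsection \<open>Density of polynomials in asymptotically Gaussian elements\<close>

definition psub :: "((rseq \<Rightarrow> real) \<Rightarrow> real) \<Rightarrow> rseq" where
  "psub p n x = p (eval_at n x)"

text \<open>The degree \<open>k\<close> counts each element of \<open>B\<close> with weight 1,
  whatever its chaos order. The first conjunct only secures boundedness; its degree is left open
  because substitution multiplies degrees.\<close>

definition appr :: "rseq set \<Rightarrow> nat \<Rightarrow> rseq \<Rightarrow> bool" where
  "appr B k u \<longleftrightarrow> (\<exists>d. bpoly d u) \<and> (\<forall>\<epsilon>>0. \<exists>W p. finite W \<and> W \<subseteq> B \<and> polyfun W k p \<and>
     unrm (\<lambda>n x. u n x - psub p n x) < \<epsilon>)"

lemma apprD:
  assumes "appr B k u" "\<epsilon> > 0"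
  obtains W p where "finite W" "W \<subseteq> B" "polyfun W k p" "unrm (\<lambda>n x. u n x - psub p n x) < \<epsilon>"
proof -
  have "\<exists>W p. finite W \<and> W \<subseteq> B \<and> polyfun W k p \<and> unrm (\<lambda>n x. u n x - psub p n x) < \<epsilon>"
    using assms unfolding appr_def by simp
  then show thesis by (elim exE conjE) (rule that)
qed

lemma appr_bpoly: "appr B k u \<Longrightarrow> \<exists>d. bpoly d u"
  unfolding appr_def by blast

lemma apprI:
  assumes "bpoly d u"
    and "\<And>\<epsilon>. \<epsilon> > 0 \<Longrightarrow> \<exists>W p. finite W \<and> W \<subseteq> B \<and> polyfun W k p \<and> unrm (\<lambda>n x. u n x - psub p n x) < \<epsilon>"
  shows "appr B k u"
  unfolding appr_def by (intro conjI exI[of _ d] allI impI assms)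

lemma appr_mono:
  assumes "appr B k u" "k \<le> l" shows "appr B l u"
proof -
  obtain d where d: "bpoly d u" using appr_bpoly[OF assms(1)] by blast
  show ?thesis
  proof (rule apprI[OF d])
    fix \<epsilon> :: real assume "\<epsilon> > 0"
    from apprD[OF assms(1) this] obtain W p where "finite W" "W \<subseteq> B" "polyfun W k p" "unrm (\<lambda>n x. u n x - psub p n x) < \<epsilon>" by blast
    moreover from this(3) have "polyfun W l p" using assms(2) by (rule polyfun_degree_mono)
    ultimately show "\<exists>W p. finite W \<and> W \<subseteq> B \<and> polyfun W l p \<and> unrm (\<lambda>n x. u n x - psub p n x) < \<epsilon>" by blast
  qed
qed

lemma appr_mem:
  assumes "b \<in> B" "bpoly d b" shows "appr B 1 b"
proof (rule apprI[OF assms(2)])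
  fix \<epsilon> :: real assume "\<epsilon> > 0"
  moreover have "psub (\<lambda>y. y b) = b" by (auto simp: psub_def eval_at_def fun_eq_iff)
  moreover have "polyfun {b} 1 (\<lambda>y. y b)" by (rule polyfun_var) auto
  ultimately show "\<exists>W p. finite W \<and> W \<subseteq> B \<and> polyfun W 1 p \<and> unrm (\<lambda>n x. b n x - psub p n x) < \<epsilon>"
    using assms(1) by (intro exI[of _ "{b}"] exI[of _ "\<lambda>y. y b"]) simp
qed

text \<open>An element of order 0 is a bounded sequence of constants and coincides in the
  ultraproduct with its limit, so no member of \<open>B\<close> is needed.\<close>

lemma appr_beig_0:
  assumes "beig 0 u" shows "appr B k u"
proof -
  note bu = beig_bpoly[OF assms]
  have "\<forall>n. \<exists>c. u n = (\<lambda>x. c)" using polyfun_0_const[OF bpoly_polyfun[OF bu]] by blast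
  from choice[OF this] obtain c where c: "\<And>n. u n = (\<lambda>x. c n)" by blast
  obtain C where C: "\<And>n. nrm (u n) \<le> C" using bpoly_bound[OF bu] by blast
  have "\<And>n. \<bar>c n\<bar> \<le> C" using C by (simp add: c)
  from bounded_tendsto[of c, OF this] obtain l where l: "(c \<longlongrightarrow> l) U" by blast
  have "((\<lambda>n. \<bar>c n - l\<bar>) \<longlongrightarrow> \<bar>l - l\<bar>) U" by (intro tendsto_rabs tendsto_diff l tendsto_const)
  then have "unrm (\<lambda>n x. u n x - psub (\<lambda>y. l) n x) = 0" by (intro unrm_eqI) (simp add: c psub_def)
  moreover have "polyfun {} k (\<lambda>y. l)" by (rule polyfun.const)
  ultimately have "finite {} \<and> {} \<subseteq> B \<and> polyfun {} k (\<lambda>y. l) \<and> unrm (\<lambda>n x. u n x - psub (\<lambda>y. l) n x) < \<epsilon>" if "\<epsilon> > 0" for \<epsilon>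
    using that by simp
  then show ?thesis using apprI[OF bu] by blast
qed

context
  fixes B :: "rseq set" and D :: nat
  assumes B: "\<And>b. b \<in> B \<Longrightarrow> bpoly D b"
begin

lemma bpoly_psub: "W \<subseteq> B \<Longrightarrow> polyfun W k p \<Longrightarrow> bpoly (k * D) (psub p)"
  unfolding psub_def[abs_def] by (rule bpoly_subst) (use B in auto)

lemma appr_scale:
  assumes "appr B k u" shows "appr B k (\<lambda>n x. c * u n x)"
proof -
  obtain d where d: "bpoly d u" using appr_bpoly[OF assms] by blast
  show ?thesis
  proof (rule apprI[OF bpoly_scale[OF d]])
    fix \<epsilon> :: real assume \<epsilon>: "\<epsilon> > 0"
    have pos: "\<bar>c\<bar> + 1 > 0" by simp
    then have "\<epsilon> / (\<bar>c\<bar> + 1) > 0" using \<epsilon> by simp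
    from apprD[OF assms this] obtain W p where W: "finite W" "W \<subseteq> B" "polyfun W k p"
      and p: "unrm (\<lambda>n x. u n x - psub p n x) < \<epsilon> / (\<bar>c\<bar> + 1)" by blast
    note b = bpoly_diff'[OF d bpoly_psub[OF W(2,3)]]
    have "unrm (\<lambda>n x. c * u n x - psub (\<lambda>y. c * p y) n x) = \<bar>c\<bar> * unrm (\<lambda>n x. u n x - psub p n x)"
      using unrm_scale[OF b, of c] by (simp add: right_diff_distrib psub_def)
    also have "\<dots> \<le> (\<bar>c\<bar> + 1) * unrm (\<lambda>n x. u n x - psub p n x)" using unrm_nonneg[OF b] by (intro mult_right_mono) auto
    also have "\<dots> < \<epsilon>" using p pos by (simp add: pos_less_divide_eq mult.commute)
    finally show "\<exists>W p. finite W \<and> W \<subseteq> B \<and> polyfun W k p \<and> unrm (\<lambda>n x. c * u n x - psub p n x) < \<epsilon>"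
      using W polyfun_scale[OF W(3), of c] by blast
  qed
qed

lemma appr_add:
  assumes "appr B k u" "appr B k v" shows "appr B k (\<lambda>n x. u n x + v n x)"
proof -
  obtain d e where d: "bpoly d u" "bpoly e v" using appr_bpoly[OF assms(1)] appr_bpoly[OF assms(2)] by blast
  then have "bpoly (d + e) (\<lambda>n x. u n x + v n x)" by (intro bpoly_add) (auto intro: bpoly_mono)
  then show ?thesis
  proof (rule apprI)
    fix \<epsilon> :: real assume "\<epsilon> > 0"
    then have e: "\<epsilon> / 2 > 0" by simp
    from apprD[OF assms(1) e] obtain W p where W: "finite W" "W \<subseteq> B" "polyfun W k p"
      and p: "unrm (\<lambda>n x. u n x - psub p n x) < \<epsilon> / 2" by blast
    from apprD[OF assms(2) e] obtain W' q where W': "finite W'" "W' \<subseteq> B" "polyfun W' k q"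
      and q: "unrm (\<lambda>n x. v n x - psub q n x) < \<epsilon> / 2" by blast
    have pq: "polyfun (W \<union> W') k (\<lambda>y. p y + q y)"
      using polyfun_vars_mono[OF W(3), of "W \<union> W'"] polyfun_vars_mono[OF W'(3), of "W \<union> W'"] by (intro polyfun.add) auto
    have "unrm (\<lambda>n x. (u n x + v n x) - psub (\<lambda>y. p y + q y) n x) < \<epsilon>"
      using unrm_triangle[OF bpoly_diff'[OF d(1) bpoly_psub[OF W(2,3)]] bpoly_diff'[OF d(2) bpoly_psub[OF W'(2,3)]]] p q
      by (simp add: psub_def add_diff_add)
    moreover have "finite (W \<union> W')" "W \<union> W' \<subseteq> B" using W W' by auto
    ultimately show "\<exists>W p. finite W \<and> W \<subseteq> B \<and> polyfun W k p \<and> unrm (\<lambda>n x. (u n x + v n x) - psub p n x) < \<epsilon>"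
      using pq by blast
  qed
qed

lemma appr_diff:
  assumes "appr B k u" "appr B k v" shows "appr B k (\<lambda>n x. u n x - v n x)"
  using appr_add[OF assms(1) appr_scale[OF assms(2), of "-1"]] by simp

lemma appr_sum:
  assumes "\<And>i. i \<in> I \<Longrightarrow> appr B k (f i)" shows "appr B k (\<lambda>n x. \<Sum>i\<in>I. f i n x)"
  using assms
proof (induction I rule: infinite_finite_induct)
  case (insert i I)
  then show ?case using appr_add[OF insert(4)[of i], of "\<lambda>n x. \<Sum>i\<in>I. f i n x"] by simp
qed (simp_all add: appr_beig_0 beig_zero)

lemma appr_closed:
  assumes "bpoly d u" and "\<And>\<epsilon>. \<epsilon> > 0 \<Longrightarrow> \<exists>v. appr B k v \<and> unrm (\<lambda>n x. u n x - v n x) < \<epsilon>"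
  shows "appr B k u"
proof (rule apprI[OF assms(1)])
  fix \<epsilon> :: real assume "\<epsilon> > 0"
  then have e: "\<epsilon> / 2 > 0" by simp
  from assms(2)[OF this] obtain v where v: "appr B k v" and uv: "unrm (\<lambda>n x. u n x - v n x) < \<epsilon> / 2" by blast
  obtain e where bv: "bpoly e v" using appr_bpoly[OF v] by blast
  from apprD[OF v e] obtain W p where W: "finite W" "W \<subseteq> B" "polyfun W k p"
    and p: "unrm (\<lambda>n x. v n x - psub p n x) < \<epsilon> / 2" by blast
  have "unrm (\<lambda>n x. u n x - psub p n x) < \<epsilon>"
    using unrm_triangle3[OF assms(1) bv bpoly_psub[OF W(2,3)]] uv p by linarith
  then show "\<exists>W p. finite W \<and> W \<subseteq> B \<and> polyfun W k p \<and> unrm (\<lambda>n x. u n x - psub p n x) < \<epsilon>"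
    using W by blast
qed

text \<open>The degrees of all possible approximants are known beforehand, so the constants of the
  product bound can be fixed first. Then \<open>q\<close> is chosen according to the size of
  \<open>u\<close>, and only afterwards \<open>p\<close>, whose tolerance depends on the size of
  \<open>psub q\<close>.\<close>

lemma appr_mult:
  assumes u: "appr B i u" and v: "appr B j v" shows "appr B (i + j) (\<lambda>n x. u n x * v n x)"
proof -
  obtain d where d: "bpoly d u" using appr_bpoly[OF u] by blast
  obtain e where e: "bpoly e v" using appr_bpoly[OF v] by blast
  obtain C where C: "C \<ge> 0" "\<And>f g. bpoly d f \<Longrightarrow> bpoly (e + j * D) g \<Longrightarrow> unrm (\<lambda>n x. f n x * g n x) \<le> C * (unrm f * unrm g)"
    using unrm_product_bound[of d "e + j * D"] by blast
  obtain C' where C': "C' \<ge> 0" "\<And>f g. bpoly (j * D) f \<Longrightarrow> bpoly (d + i * D) g \<Longrightarrow> unrm (\<lambda>n x. f n x * g n x) \<le> C' * (unrm f * unrm g)"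
    using unrm_product_bound[of "j * D" "d + i * D"] by blast
  have small: "\<exists>\<eta>>0. \<forall>t. 0 \<le> t \<longrightarrow> t < \<eta> \<longrightarrow> K * t < \<epsilon>" if "K \<ge> 0" "\<epsilon> > 0" for K \<epsilon> :: real
  proof (intro exI[of _ "\<epsilon> / (K + 1)"] conjI allI impI)
    show "0 < \<epsilon> / (K + 1)" using that by simp
    fix t assume t: "0 \<le> t" "t < \<epsilon> / (K + 1)"
    have "K * t \<le> (K + 1) * t" using t by (simp add: distrib_right)
    also have "\<dots> < \<epsilon>" using t that by (simp add: pos_less_divide_eq mult.commute)
    finally show "K * t < \<epsilon>" .
  qed
  show ?thesis
  proof (rule apprI[OF bpoly_mult[OF d e]])
    fix \<epsilon> :: real assume "\<epsilon> > 0"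
    then have e2: "\<epsilon> / 2 > 0" by simp
    have "C * unrm u \<ge> 0" using C(1) unrm_nonneg[OF d] by simp
    from small[OF this e2] obtain \<eta> where \<eta>: "\<eta> > 0" "\<And>t. 0 \<le> t \<Longrightarrow> t < \<eta> \<Longrightarrow> C * unrm u * t < \<epsilon> / 2" by blast
    from apprD[OF v \<eta>(1)] obtain W' q where W': "finite W'" "W' \<subseteq> B" "polyfun W' j q"
      and q: "unrm (\<lambda>n x. v n x - psub q n x) < \<eta>" by blast
    note bq = bpoly_psub[OF W'(2,3)]
    have "C' * unrm (psub q) \<ge> 0" using C'(1) unrm_nonneg[OF bq] by simp
    from small[OF this e2] obtain \<theta> where \<theta>: "\<theta> > 0" "\<And>t. 0 \<le> t \<Longrightarrow> t < \<theta> \<Longrightarrow> C' * unrm (psub q) * t < \<epsilon> / 2" by blast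
    from apprD[OF u \<theta>(1)] obtain W p where W: "finite W" "W \<subseteq> B" "polyfun W i p"
      and p: "unrm (\<lambda>n x. u n x - psub p n x) < \<theta>" by blast
    note bp = bpoly_psub[OF W(2,3)]
    note b1 = bpoly_diff'[OF e bq] and b2 = bpoly_diff'[OF d bp]
    have "unrm (\<lambda>n x. u n x * v n x - psub (\<lambda>y. p y * q y) n x)
       = unrm (\<lambda>n x. u n x * (v n x - psub q n x) + psub q n x * (u n x - psub p n x))"
      by (simp add: psub_def algebra_simps)
    also have "\<dots> \<le> unrm (\<lambda>n x. u n x * (v n x - psub q n x)) + unrm (\<lambda>n x. psub q n x * (u n x - psub p n x))"
      by (rule unrm_triangle[OF bpoly_mult[OF d b1] bpoly_mult[OF bq b2]])
    also have "\<dots> \<le> C * (unrm u * unrm (\<lambda>n x. v n x - psub q n x)) + C' * (unrm (psub q) * unrm (\<lambda>n x. u n x - psub p n x))"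
      by (intro add_mono C(2)[OF d b1] C'(2)[OF bq b2])
    also have "\<dots> < \<epsilon>"
      using \<eta>(2)[OF unrm_nonneg[OF b1] q] \<theta>(2)[OF unrm_nonneg[OF b2] p] by (simp add: mult.assoc)
    finally have lt: "unrm (\<lambda>n x. u n x * v n x - psub (\<lambda>y. p y * q y) n x) < \<epsilon>" .
    have pq: "polyfun (W \<union> W') (i + j) (\<lambda>y. p y * q y)"
      using polyfun_vars_mono[OF W(3), of "W \<union> W'"] polyfun_vars_mono[OF W'(3), of "W \<union> W'"] by (intro polyfun_mult) auto
    have "finite (W \<union> W')" "W \<union> W' \<subseteq> B" using W W' by auto
    then show "\<exists>W p. finite W \<and> W \<subseteq> B \<and> polyfun W (i + j) p \<and> unrm (\<lambda>n x. u n x * v n x - psub p n x) < \<epsilon>"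
      using pq lt by blast
  qed
qed

end

definition gaussian_system :: "nat \<Rightarrow> rseq set \<Rightarrow> bool" where
  "gaussian_system D B \<longleftrightarrow> (\<forall>b\<in>B. \<exists>k\<le>D. primitive k b) \<and> orthonormal B"

text \<open>The defining conditions concern at most two members at a time, so the union of a chain
  satisfies them and Zorn's lemma applies.\<close>

lemma maximal_gaussian_system:
  obtains B where "gaussian_system D B" "\<And>B'. gaussian_system D B' \<Longrightarrow> B \<subseteq> B' \<Longrightarrow> B' = B"
proof -
  have "\<exists>B\<in>{B. gaussian_system D B}. \<forall>B'\<in>{B. gaussian_system D B}. B \<subseteq> B' \<longrightarrow> B' = B"
  proof (rule subset_Zorn')
    fix C assume C: "subset.chain {B. gaussian_system D B} C"
    have "orthonormal (\<Union>C)" unfolding orthonormal_def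
    proof (intro ballI)
      fix a b assume "a \<in> \<Union>C" "b \<in> \<Union>C"
      then obtain X Y where XY: "X \<in> C" "Y \<in> C" "a \<in> X" "b \<in> Y" by blast
      then have "X \<subseteq> Y \<or> Y \<subseteq> X" using C by (auto simp: subset.chain_def)
      then obtain Z where "Z \<in> C" "a \<in> Z" "b \<in> Z" using XY by blast
      moreover from this have "orthonormal Z" using C by (auto simp: subset.chain_def gaussian_system_def)
      ultimately show "EU (\<lambda>n x. a n x * b n x) = (if a = b then 1 else 0)" unfolding orthonormal_def by blast
    qed
    moreover have "\<forall>b\<in>\<Union>C. \<exists>k\<le>D. primitive k b" using C by (fastforce simp: subset.chain_def gaussian_system_def)
    ultimately show "\<Union>C \<in> {B. gaussian_system D B}" by (simp add: gaussian_system_def)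
  qed
  then show ?thesis using that by blast
qed

lemma gaussian_system_bpoly: "gaussian_system D B \<Longrightarrow> b \<in> B \<Longrightarrow> bpoly D b"
  unfolding gaussian_system_def primitive_def using bpoly_mono beig_bpoly by blast

lemma primitive_scale: "primitive k u \<Longrightarrow> primitive k (\<lambda>n x. c * u n x)"
proof -
  assume u: "primitive k u"
  then have ub: "beig k u" and 1: "1 \<le> k" by (auto simp: primitive_def)
  show ?thesis unfolding primitive_def
  proof (intro conjI allI impI)
    fix i j A B' assume *: "0 < i" "0 < j" "i + j = k" "beig i A" "beig j B'"
    then have "EU (\<lambda>n x. u n x * (A n x * B' n x)) = 0" using u unfolding primitive_def by blast
    then show "EU (\<lambda>n x. c * u n x * (A n x * B' n x)) = 0"
      using EU_scale[OF bpoly_mult[OF beig_bpoly[OF ub] bpoly_mult[OF *(4,5)[THEN beig_bpoly]]], of c] by (simp add: mult.assoc)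
  qed (use 1 beig_scale[OF ub] in auto)
qed

text \<open>The projection is onto all approximable elements of order \<open>k\<close>. These
  include the order-\<open>k\<close> components of products of lower-order elements, so the residual
  is primitive, and the members of \<open>B\<close> of order \<open>k\<close>, so the normalised
  residual would enlarge \<open>B\<close>. Maximality forces the residual to have norm 0.\<close>

lemma maximal_gaussian_system_dense:
  assumes gs: "gaussian_system D B" and max: "\<And>B'. gaussian_system D B' \<Longrightarrow> B \<subseteq> B' \<Longrightarrow> B' = B"
    and "beig k u" "k \<le> D"
  shows "appr B k u"
  using assms(3,4)
proof (induction k arbitrary: u rule: less_induct)
  case (less k)
  note Bp = gaussian_system_bpoly[OF gs]
  show ?case
  proof (cases "k = 0")
    case True
    then show ?thesis using less.prems appr_beig_0 by blast
  next
    case k: False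
    define S where "S = {s. beig k s \<and> appr B k s}"
    have S: "beig k s" if "s \<in> S" for s using that by (simp add: S_def)
    have S0: "(\<lambda>n x. 0) \<in> S" by (simp add: S_def beig_zero appr_beig_0)
    have S1: "(\<lambda>n x. s n x + t n x) \<in> S" if "s \<in> S" "t \<in> S" for s t
      using that unfolding S_def by (simp add: beig_add appr_add[OF Bp])
    have S2: "(\<lambda>n x. c * s n x) \<in> S" if "s \<in> S" for s c
      using that unfolding S_def by (simp add: beig_scale appr_scale[OF Bp])
    from beig_projection[OF S S0 S1 S2 less.prems(1)]
    obtain w where w: "beig k w" and orth: "\<And>s. s \<in> S \<Longrightarrow> EU (\<lambda>n x. w n x * s n x) = 0"
      and near: "\<And>\<epsilon>. \<epsilon> > 0 \<Longrightarrow> \<exists>s\<in>S. unrm (\<lambda>n x. u n x - w n x - s n x) < \<epsilon>"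
      by blast
    note bw = beig_bpoly[OF w]
    have pw: "primitive k w" unfolding primitive_def
    proof (intro conjI allI impI)
      fix i j A A' assume *: "0 < i" "0 < j" "i + j = k" "beig i A" "beig j A'"
      have iD: "i < k" "i \<le> D" "j < k" "j \<le> D" using * less.prems(2) by auto
      have "bpoly k (\<lambda>n x. A n x * A' n x)" using bpoly_mult[OF *(4,5)[THEN beig_bpoly]] *(3) by simp
      from bpoly_decomposition[OF this] obtain z where z: "\<And>p. p \<le> k \<Longrightarrow> beig p (z p)"
        and zs: "\<And>n x. A n x * A' n x = (\<Sum>p\<le>k. z p n x)" by blast
      have ap: "appr B k (\<lambda>n x. A n x * A' n x)"
        using appr_mult[OF Bp less.IH[OF iD(1) *(4) iD(2)] less.IH[OF iD(3) *(5) iD(4)]] *(3) by simp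
      have az: "appr B k (\<lambda>n x. \<Sum>p<k. z p n x)"
      proof (rule appr_sum[OF Bp])
        fix p assume "p \<in> {..<k}"
        then have "p < k" "p \<le> k" "p \<le> D" using less.prems(2) by auto
        then show "appr B k (z p)" using less.IH[OF _ z, of p] appr_mono by blast
      qed
      \<comment> \<open>The top component is the product minus its lower components. The product is
        approximable as a product of approximable factors and the rest by induction, so the top
        component lies in \<open>S\<close>; all other components are orthogonal to \<open>w\<close>
        by their order.\<close>
      have "z k = (\<lambda>n x. A n x * A' n x - (\<Sum>p<k. z p n x))"
        by (auto simp: fun_eq_iff zs lessThan_Suc_atMost[symmetric])
      then have "z k \<in> S" using appr_diff[OF Bp ap az] z[of k] by (simp add: S_def)
      have "EU (\<lambda>n x. w n x * (A n x * A' n x)) = EU (\<lambda>n x. \<Sum>p\<le>k. w n x * z p n x)"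
        by (simp add: zs sum_distrib_left)
      also have "\<dots> = (\<Sum>p\<le>k. EU (\<lambda>n x. w n x * z p n x))"
      proof (rule EU_sum)
        fix p assume "p \<in> {..k}"
        then show "bpoly (k + k) (\<lambda>n x. w n x * z p n x)"
          using bpoly_mult[OF bw beig_bpoly[OF z[of p]]] by (auto intro: bpoly_mono)
      qed
      also have "\<dots> = 0"
      proof (rule sum.neutral, rule ballI)
        fix p assume "p \<in> {..k}"
        then show "EU (\<lambda>n x. w n x * z p n x) = 0"
          using orth[OF \<open>z k \<in> S\<close>] beig_orthogonal[OF w z[of p]] by (cases "p = k") auto
      qed
      finally show "EU (\<lambda>n x. w n x * (A n x * A' n x)) = 0" .
    qed (use k w in auto)
    have "unrm w = 0"
    proof (rule ccontr)
      assume nz: "unrm w \<noteq> 0"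
      define w' where "w' = (\<lambda>n x. 1 / unrm w * w n x)"
      have pw': "primitive k w'" unfolding w'_def by (rule primitive_scale[OF pw])
      have bw': "bpoly k w'" unfolding w'_def by (rule bpoly_scale[OF bw])
      have "unrm w' = 1"
        unfolding w'_def using nz unrm_scale[OF bw, of "1 / unrm w"] unrm_nonneg[OF bw] by simp
      then have one: "EU (\<lambda>n x. w' n x * w' n x) = 1" using EU_square[OF bw'] by simp
      have zero: "EU (\<lambda>n x. w' n x * b n x) = 0" if b: "b \<in> B" for b
      proof -
        obtain l where l: "primitive l b" using gs b by (auto simp: gaussian_system_def)
        then have bl: "beig l b" by (simp add: primitive_def)
        have "EU (\<lambda>n x. w n x * b n x) = 0"
        proof (cases "l = k")
          case True
          have "appr B k b" using appr_mem[OF b Bp[OF b]] k by (intro appr_mono[of B 1 b k]) auto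
          then show ?thesis using orth bl True by (simp add: S_def)
        next
          case False
          then show ?thesis using beig_orthogonal[OF w bl] by simp
        qed
        then show ?thesis using EU_scale[OF bpoly_mult[OF bw Bp[OF b]], of "1 / unrm w"] by (simp add: w'_def mult.assoc)
      qed
      have zero': "EU (\<lambda>n x. b n x * w' n x) = 0" if "b \<in> B" for b
        using zero[OF that] by (simp only: mult.commute)
      have "orthonormal (insert w' B)"
        using one zero zero' gs unfolding orthonormal_def gaussian_system_def by (auto split: if_splits)
      then have "gaussian_system D (insert w' B)"
        using gs pw' less.prems(2) by (auto simp: gaussian_system_def)
      from max[OF this] have "w' \<in> B" by blast
      \<comment> \<open>A member of \<open>B\<close> would be orthogonal to \<open>w'\<close>, but
        \<open>w'\<close> has norm 1.\<close>
      from zero[OF this] one show False by simp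
    qed
    show ?thesis
    proof (rule appr_closed[OF Bp beig_bpoly[OF less.prems(1)]])
      fix \<epsilon> :: real assume "\<epsilon> > 0"
      from near[OF this] obtain s where s: "s \<in> S" "unrm (\<lambda>n x. u n x - w n x - s n x) < \<epsilon>" by blast
      have bs: "bpoly k s" using s(1) beig_bpoly by (simp add: S_def)
      have "unrm (\<lambda>n x. (u n x - w n x - s n x) + w n x) \<le> unrm (\<lambda>n x. u n x - w n x - s n x) + unrm w"
        by (rule unrm_triangle[OF bpoly_diff[OF bpoly_diff[OF beig_bpoly[OF less.prems(1)] bw] bs] bw])
      then have "unrm (\<lambda>n x. u n x - s n x) < \<epsilon>" using s(2) \<open>unrm w = 0\<close> by (simp add: algebra_simps)
      then show "\<exists>v. appr B k v \<and> unrm (\<lambda>n x. u n x - v n x) < \<epsilon>" using s(1) by (auto simp: S_def)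
    qed
  qed
qed

lemma maximal_gaussian_system_dense_bpoly:
  assumes gs: "gaussian_system D B" and max: "\<And>B'. gaussian_system D B' \<Longrightarrow> B \<subseteq> B' \<Longrightarrow> B' = B"
    and u: "bpoly D u"
  shows "appr B D u"
proof -
  obtain w where w: "\<And>k. k \<le> D \<Longrightarrow> beig k (w k)" and s: "\<And>n x. u n x = (\<Sum>k\<le>D. w k n x)"
    using bpoly_decomposition[OF u] by blast
  have "appr B D (\<lambda>n x. \<Sum>k\<le>D. w k n x)"
  proof (rule appr_sum[OF gaussian_system_bpoly[OF gs]])
    fix k assume "k \<in> {..D}"
    then have "k \<le> D" by simp
    from appr_mono[OF maximal_gaussian_system_dense[OF gs max w[OF this] this] this] show "appr B D (w k)" by simp
  qed
  then show ?thesis by (simp add: s[abs_def])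
qed

end

subsection \<open>Weak convergence from convergence of moments\<close>

lemma polyfun_cong: "polyfun V d f \<Longrightarrow> (\<And>j. j \<in> V \<Longrightarrow> x j = y j) \<Longrightarrow> f x = f y"
  by (induction rule: polyfun.induct) auto

lemma polyfun_continuous:
  fixes f :: "('i \<Rightarrow> real) \<Rightarrow> real"
  shows "polyfun V d f \<Longrightarrow> continuous_on S f"
  by (induction rule: polyfun.induct) (auto intro!: continuous_intros continuous_on_product_coordinates intro: continuous_on_subset)

text \<open>Stone-Weierstrass on a compact product. Coordinates outside \<open>J\<close> are pinned
  to 0, so that polynomials in the coordinates of \<open>J\<close> separate points.\<close>

lemma polyfun_dense_on_cube:
  fixes h :: "(nat \<Rightarrow> real) \<Rightarrow> real"
  assumes "continuous_on UNIV h" "e > 0" "finite J"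
  obtains d q where "polyfun J d q" "\<And>y. (\<And>j. j \<in> J \<Longrightarrow> \<bar>y j\<bar> \<le> 1) \<Longrightarrow> (\<And>j. j \<notin> J \<Longrightarrow> y j = 0) \<Longrightarrow> \<bar>h y - q y\<bar> < e"
proof -
  define A where "A j = (if j \<in> J then {-1..1} else {0::real})" for j
  define S where "S = PiE UNIV A"
  interpret function_ring_on "{q. \<exists>d. polyfun J d q}" S
  proof
    have "compactin (product_topology (\<lambda>i. euclidean) UNIV) (PiE UNIV A)"
      by (subst compactin_PiE) (auto simp: A_def)
    then show "compact S" by (simp add: S_def euclidean_product_topology)
  next
    fix f :: "(nat \<Rightarrow> real) \<Rightarrow> real" assume "f \<in> {q. \<exists>d. polyfun J d q}"
    then show "continuous_on S f" using polyfun_continuous by blast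
  next
    fix f g :: "(nat \<Rightarrow> real) \<Rightarrow> real" assume "f \<in> {q. \<exists>d. polyfun J d q}" "g \<in> {q. \<exists>d. polyfun J d q}"
    then obtain d e where de: "polyfun J d f" "polyfun J e g" by blast
    then have "polyfun J (d + e) f" "polyfun J (d + e) g" by (auto intro: polyfun_degree_mono)
    from polyfun.add[OF this] show "(\<lambda>x. f x + g x) \<in> {q. \<exists>d. polyfun J d q}" by blast
    from polyfun_mult[OF de] show "(\<lambda>x. f x * g x) \<in> {q. \<exists>d. polyfun J d q}" by blast
  next
    fix c show "(\<lambda>_. c) \<in> {q. \<exists>d. polyfun J d q}" using polyfun.const by blast
  next
    fix x y :: "nat \<Rightarrow> real" assume "x \<in> S" "y \<in> S" "x \<noteq> y"
    then obtain j where j: "x j \<noteq> y j" by auto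
    have "x j \<in> A j" "y j \<in> A j" using \<open>x \<in> S\<close> \<open>y \<in> S\<close> by (auto simp: S_def)
    then have "j \<in> J" using j by (cases "j \<in> J") (auto simp: A_def)
    then have "polyfun J 1 (\<lambda>x. x j)" by (intro polyfun_var) auto
    then show "\<exists>f\<in>{q. \<exists>d. polyfun J d q}. f x \<noteq> f y" using j by (intro bexI[of _ "\<lambda>x. x j"]) auto
  qed
  obtain q where q: "q \<in> {q. \<exists>d. polyfun J d q}" "\<forall>y\<in>S. \<bar>h y - q y\<bar> < e"
    using Stone_Weierstrass_basic[OF continuous_on_subset[OF assms(1)] assms(2)] by blast
  have "y \<in> S" if "\<And>j. j \<in> J \<Longrightarrow> \<bar>y j\<bar> \<le> 1" "\<And>j. j \<notin> J \<Longrightarrow> y j = 0" for y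
    using that by (auto simp: S_def A_def abs_le_iff minus_le_iff)
  then show ?thesis using q that by blast
qed

context prob_space
begin

lemma integrable_bounded:
  fixes f :: "'a \<Rightarrow> real"
  shows "f \<in> borel_measurable M \<Longrightarrow> (\<And>\<omega>. \<bar>f \<omega>\<bar> \<le> K) \<Longrightarrow> integrable M f"
  by (rule integrable_const_bound[where B=K]) auto

lemma expectation_diff_le:
  fixes f g b :: "'a \<Rightarrow> real"
  assumes "integrable M f" "integrable M g" "integrable M b" "\<And>\<omega>. \<bar>f \<omega> - g \<omega>\<bar> \<le> b \<omega>"
  shows "\<bar>expectation f - expectation g\<bar> \<le> expectation b"
proof -
  have "\<bar>expectation f - expectation g\<bar> = \<bar>expectation (\<lambda>\<omega>. f \<omega> - g \<omega>)\<bar>" using assms by simp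
  also have "\<dots> \<le> expectation (\<lambda>\<omega>. \<bar>f \<omega> - g \<omega>\<bar>)" by (rule integral_abs_bound)
  also have "\<dots> \<le> expectation b" using assms by (intro integral_mono) auto
  finally show ?thesis .
qed

text \<open>The method of moments by direct approximation. Moments control cosines and sines of
  linear forms through Taylor polynomials, and \<open>tail\<close> makes the remainders small.
  Products of such functions give polynomials in bounded sines, which approximate \<open>h\<close>
  uniformly on a large cube; outside the cube second moments pay for the error.\<close>

lemma moments_imp_weak_convergence:
  fixes X :: "nat \<Rightarrow> 'a \<Rightarrow> nat \<Rightarrow> real" and Y :: "'a \<Rightarrow> nat \<Rightarrow> real" and U :: "nat filter"
    and h :: "(nat \<Rightarrow> real) \<Rightarrow> real" and K :: real
  assumes J: "finite J"
    and X[measurable]: "\<And>n. X n \<in> borel_measurable M" and Y[measurable]: "Y \<in> borel_measurable M"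
    and X0: "\<And>n \<omega> j. j \<notin> J \<Longrightarrow> X n \<omega> j = 0" and Y0: "\<And>\<omega> j. j \<notin> J \<Longrightarrow> Y \<omega> j = 0"
    and intX: "\<And>n d q. polyfun J d q \<Longrightarrow> integrable M (\<lambda>\<omega>. q (X n \<omega>))"
    and intY: "\<And>d q. polyfun J d q \<Longrightarrow> integrable M (\<lambda>\<omega>. q (Y \<omega>))"
    and mom: "\<And>d q. polyfun J d q \<Longrightarrow> ((\<lambda>n. expectation (\<lambda>\<omega>. q (X n \<omega>))) \<longlongrightarrow> expectation (\<lambda>\<omega>. q (Y \<omega>))) U"
    and tail: "\<And>t. (\<lambda>k. expectation (\<lambda>\<omega>. (\<Sum>j\<in>J. t j * Y \<omega> j) ^ (2 * k)) / fact (2 * k)) \<longlonglongrightarrow> 0"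
    and h: "continuous_on UNIV h" and hK: "\<And>x. \<bar>h x\<bar> \<le> K"
  shows "((\<lambda>n. expectation (\<lambda>\<omega>. h (X n \<omega>))) \<longlongrightarrow> expectation (\<lambda>\<omega>. h (Y \<omega>))) U"
proof -
  define good where "good \<phi> \<longleftrightarrow> \<phi> \<in> borel_measurable borel \<and> (\<exists>C. \<forall>x. \<bar>\<phi> x\<bar> \<le> C) \<and>
    ((\<lambda>n. expectation (\<lambda>\<omega>. \<phi> (X n \<omega>))) \<longlongrightarrow> expectation (\<lambda>\<omega>. \<phi> (Y \<omega>))) U" for \<phi> :: "(nat \<Rightarrow> real) \<Rightarrow> real"
  have good_int: "integrable M (\<lambda>\<omega>. \<phi> (X n \<omega>))" "integrable M (\<lambda>\<omega>. \<phi> (Y \<omega>))"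
    if m: "\<phi> \<in> borel_measurable borel" and C: "\<And>x. \<bar>\<phi> x\<bar> \<le> C" for \<phi> :: "(nat \<Rightarrow> real) \<Rightarrow> real" and n C
    using integrable_bounded[OF measurable_compose[OF X m] C] integrable_bounded[OF measurable_compose[OF Y m] C] by auto
  have coord[measurable]: "(\<lambda>x::nat \<Rightarrow> real. x j) \<in> borel_measurable borel" for j
    by (rule borel_measurable_continuous_onI[OF continuous_on_product_coordinates])
  have good_add: "good (\<lambda>x. \<phi> x + \<psi> x)" if "good \<phi>" "good \<psi>" for \<phi> \<psi>
  proof -
    obtain C C' where C: "\<And>x. \<bar>\<phi> x\<bar> \<le> C" "\<And>x. \<bar>\<psi> x\<bar> \<le> C'" using \<open>good \<phi>\<close> \<open>good \<psi>\<close> unfolding good_def by blast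
    have m: "\<phi> \<in> borel_measurable borel" "\<psi> \<in> borel_measurable borel" using that by (auto simp: good_def)
    have "\<bar>\<phi> x + \<psi> x\<bar> \<le> C + C'" for x using C[of x] by linarith
    moreover have "((\<lambda>n. expectation (\<lambda>\<omega>. \<phi> (X n \<omega>)) + expectation (\<lambda>\<omega>. \<psi> (X n \<omega>)))
        \<longlongrightarrow> expectation (\<lambda>\<omega>. \<phi> (Y \<omega>)) + expectation (\<lambda>\<omega>. \<psi> (Y \<omega>))) U"
      using that by (intro tendsto_add) (auto simp: good_def)
    ultimately show ?thesis unfolding good_def using m good_int[OF m(1) C(1)] good_int[OF m(2) C(2)] by auto
  qed
  have good_scale: "good (\<lambda>x. c * \<phi> x)" if g: "good \<phi>" for \<phi> c
  proof -
    obtain C where C: "\<And>x. \<bar>\<phi> x\<bar> \<le> C" using g unfolding good_def by blast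
    have "\<bar>c * \<phi> x\<bar> \<le> \<bar>c\<bar> * C" for x using C[of x] by (simp add: abs_mult mult_left_mono)
    then show ?thesis using g unfolding good_def by (auto intro!: tendsto_mult_left)
  qed
  have good_taylor: "good (\<lambda>x. f (\<Sum>j\<in>J. t j * x j))"
    if f: "f \<in> borel_measurable borel" "\<And>y. \<bar>f y\<bar> \<le> 1"
      and taylor: "\<And>n y. \<bar>f y - (\<Sum>m<n. c m * y ^ m)\<bar> \<le> \<bar>y\<bar> ^ n / fact n" for f c t
  proof -
    define L where "L x = (\<Sum>j\<in>J. t j * x j)" for x :: "nat \<Rightarrow> real"
    have L: "polyfun J 1 L" unfolding L_def by (intro polyfun_sum polyfun_scale polyfun_var) auto
    have Lm: "L \<in> borel_measurable borel" unfolding L_def by measurable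
    \<comment> \<open>An even order makes the Taylor remainder bound itself a polynomial in
      \<open>L\<close>, so that its expectation is covered by the moment hypothesis.\<close>
    define T where "T k = (\<lambda>x. \<Sum>m<2*k. c m * L x ^ m)" for k :: nat
    have T: "polyfun J (2 * k) (T k)" for k unfolding T_def
      by (intro polyfun_sum polyfun_scale) (use polyfun_degree_mono[OF polyfun_power[OF L]] in auto)
    have Lp: "polyfun J (1 * (2 * k)) (\<lambda>x. L x ^ (2 * k))" for k by (rule polyfun_power[OF L])
    have err: "\<bar>f (L x) - T k x\<bar> \<le> L x ^ (2 * k) / fact (2 * k)" for x k
      using taylor[of "L x" "2 * k"] by (simp add: T_def power_even_abs)
    define a where "a k = expectation (\<lambda>\<omega>. L (Y \<omega>) ^ (2 * k)) / fact (2 * k)" for k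
    have fi: "integrable M (\<lambda>\<omega>. f (L (X n \<omega>)))" "integrable M (\<lambda>\<omega>. f (L (Y \<omega>)))" for n
      using good_int[OF measurable_compose[OF Lm f(1)] f(2)] by auto
    have bX: "\<bar>expectation (\<lambda>\<omega>. f (L (X n \<omega>))) - expectation (\<lambda>\<omega>. T k (X n \<omega>))\<bar>
       \<le> expectation (\<lambda>\<omega>. L (X n \<omega>) ^ (2 * k)) / fact (2 * k)" for n k
      using expectation_diff_le[OF fi(1) intX[OF T] _ err, of n k] intX[OF Lp] by simp
    have bY: "\<bar>expectation (\<lambda>\<omega>. f (L (Y \<omega>))) - expectation (\<lambda>\<omega>. T k (Y \<omega>))\<bar> \<le> a k" for k
      using expectation_diff_le[OF fi(2) intY[OF T] _ err, of k] intY[OF Lp] by (simp add: a_def)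
    have "((\<lambda>n. expectation (\<lambda>\<omega>. f (L (X n \<omega>)))) \<longlongrightarrow> expectation (\<lambda>\<omega>. f (L (Y \<omega>)))) U"
    proof (rule tendstoI)
      fix e :: real assume "e > 0"
      \<comment> \<open>The order is chosen from \<open>Y\<close> alone; convergence of the moment
        of order \<open>2 * k\<close> then transfers the bound to \<open>X n\<close>, eventually
        along \<open>U\<close>.\<close>
      have "a \<longlonglongrightarrow> 0" using tail[of t] unfolding a_def L_def .
      then have "\<forall>\<^sub>F k in sequentially. a k < e / 4" using \<open>e > 0\<close> by (intro order_tendstoD) auto
      then obtain k where k: "a k < e / 4" by (auto simp: eventually_sequentially)
      have "((\<lambda>n. expectation (\<lambda>\<omega>. L (X n \<omega>) ^ (2 * k)) / fact (2 * k)) \<longlongrightarrow> a k) U"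
        unfolding a_def by (intro tendsto_divide mom[OF Lp] tendsto_const) auto
      then have 1: "\<forall>\<^sub>F n in U. expectation (\<lambda>\<omega>. L (X n \<omega>) ^ (2 * k)) / fact (2 * k) < e / 4"
        using k by (rule order_tendstoD)
      have 2: "\<forall>\<^sub>F n in U. dist (expectation (\<lambda>\<omega>. T k (X n \<omega>))) (expectation (\<lambda>\<omega>. T k (Y \<omega>))) < e / 4"
        using \<open>e > 0\<close> by (intro tendstoD[OF mom[OF T]]) auto
      from 1 2 show "\<forall>\<^sub>F n in U. dist (expectation (\<lambda>\<omega>. f (L (X n \<omega>)))) (expectation (\<lambda>\<omega>. f (L (Y \<omega>)))) < e"
      proof eventually_elim
        case (elim n)
        then show ?case using bX[of n k] bY[of k] k unfolding dist_real_def by linarith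
      qed
    qed
    then show ?thesis unfolding good_def using measurable_compose[OF Lm f(1)] f(2) by (auto simp: L_def)
  qed
  have cos: "good (\<lambda>x. cos (\<Sum>j\<in>J. t j * x j))" for t
  proof (rule good_taylor)
    fix n :: nat and y :: real
    obtain s where "cos y = (\<Sum>m<n. cos_coeff m * y ^ m) + (cos (s + 1/2 * real n * pi) / fact n) * y ^ n"
      using Maclaurin_cos_expansion by blast
    then have "\<bar>cos y - (\<Sum>m<n. cos_coeff m * y ^ m)\<bar> = \<bar>cos (s + 1/2 * real n * pi)\<bar> * (\<bar>y\<bar> ^ n / fact n)"
      by (simp add: abs_mult power_abs)
    also have "\<dots> \<le> 1 * (\<bar>y\<bar> ^ n / fact n)" by (intro mult_right_mono abs_cos_le_one) auto
    finally show "\<bar>cos y - (\<Sum>m<n. cos_coeff m * y ^ m)\<bar> \<le> \<bar>y\<bar> ^ n / fact n" by simp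
  qed auto
  have sin: "good (\<lambda>x. sin (\<Sum>j\<in>J. t j * x j))" for t
  proof (rule good_taylor)
    fix n :: nat and y :: real
    obtain s where "sin y = (\<Sum>m<n. sin_coeff m * y ^ m) + (sin (s + 1/2 * real n * pi) / fact n) * y ^ n"
      using Maclaurin_sin_expansion by blast
    then have "\<bar>sin y - (\<Sum>m<n. sin_coeff m * y ^ m)\<bar> = \<bar>sin (s + 1/2 * real n * pi)\<bar> * (\<bar>y\<bar> ^ n / fact n)"
      by (simp add: abs_mult power_abs)
    also have "\<dots> \<le> 1 * (\<bar>y\<bar> ^ n / fact n)" by (intro mult_right_mono abs_sin_le_one) auto
    finally show "\<bar>sin y - (\<Sum>m<n. sin_coeff m * y ^ m)\<bar> \<le> \<bar>y\<bar> ^ n / fact n" by simp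
  qed auto
  \<comment> \<open>Arbitrary frequencies \<open>t\<close> and phases \<open>c\<close> are carried
    along because the product formula for a cosine and \<open>sin (a * x b)\<close> shifts the
    frequency at \<open>b\<close> by \<open>a\<close> or \<open>- a\<close>, and turning the
    resulting sines into cosines shifts the phase by \<open>pi / 2\<close>.\<close>
  have trig: "good (\<lambda>x. cos ((\<Sum>j\<in>J. t j * x j) + c) * q (\<lambda>j. sin (a * x j)))" if "polyfun J d q" for t c d q a
    using that
  proof (induction arbitrary: t c rule: polyfun.induct)
    case (const d r)
    have "good (\<lambda>x. (r * cos c) * cos (\<Sum>j\<in>J. t j * x j) + (- r * sin c) * sin (\<Sum>j\<in>J. t j * x j))"
      by (intro good_add good_scale cos sin)
    then show ?case by (simp add: cos_add algebra_simps)
  next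
    case (add d f g)
    from good_add[OF add.IH(1)[of t c] add.IH(2)[of t c]] show ?case by (simp only: distrib_left)
  next
    case (var_mult b d f)
    have lin: "(\<Sum>j\<in>J. (t(b := t b + s)) j * x j) = (\<Sum>j\<in>J. t j * x j) + s * x b" for x s
    proof -
      have "(\<Sum>j\<in>J. (t(b := t b + s)) j * x j) = (\<Sum>j\<in>J. t j * x j + (if j = b then s * x b else 0))"
        by (intro sum.cong) (auto simp: distrib_right)
      then show ?thesis using J var_mult(1) by (simp add: sum.distrib)
    qed
    have "good (\<lambda>x. (1/2) * (cos ((\<Sum>j\<in>J. (t(b := t b + a)) j * x j) + (c - pi / 2)) * f (\<lambda>j. sin (a * x j)))
       + (-1/2) * (cos ((\<Sum>j\<in>J. (t(b := t b + (- a))) j * x j) + (c - pi / 2)) * f (\<lambda>j. sin (a * x j))))"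
      by (intro good_add good_scale var_mult.IH)
    also have "(\<lambda>x. (1/2) * (cos ((\<Sum>j\<in>J. (t(b := t b + a)) j * x j) + (c - pi / 2)) * f (\<lambda>j. sin (a * x j)))
       + (-1/2) * (cos ((\<Sum>j\<in>J. (t(b := t b + (- a))) j * x j) + (c - pi / 2)) * f (\<lambda>j. sin (a * x j))))
       = (\<lambda>x. cos ((\<Sum>j\<in>J. t j * x j) + c) * (sin (a * x b) * f (\<lambda>j. sin (a * x j))))"
    proof
      fix x
      define y where "y = (\<Sum>j\<in>J. t j * x j) + c"
      have "cos (y + a * x b - pi / 2) = sin (y + a * x b)" "cos (y - a * x b - pi / 2) = sin (y - a * x b)"
        by (simp_all add: cos_diff)
      then have "1/2 * cos (y + a * x b - pi / 2) + (-1/2) * cos (y - a * x b - pi / 2) = cos y * sin (a * x b)"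
        by (simp add: sin_add sin_diff field_simps)
      then have "(1/2 * cos (y + a * x b - pi / 2) + (-1/2) * cos (y - a * x b - pi / 2)) * f (\<lambda>j. sin (a * x j))
         = cos y * sin (a * x b) * f (\<lambda>j. sin (a * x j))" by simp
      moreover have "(\<Sum>j\<in>J. t j * x j) + a * x b + (c - pi / 2) = y + a * x b - pi / 2"
        "(\<Sum>j\<in>J. t j * x j) + - a * x b + (c - pi / 2) = y - a * x b - pi / 2" by (simp_all add: y_def)
      ultimately show "(1/2) * (cos ((\<Sum>j\<in>J. (t(b := t b + a)) j * x j) + (c - pi / 2)) * f (\<lambda>j. sin (a * x j)))
         + (-1/2) * (cos ((\<Sum>j\<in>J. (t(b := t b + (- a))) j * x j) + (c - pi / 2)) * f (\<lambda>j. sin (a * x j)))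
         = cos ((\<Sum>j\<in>J. t j * x j) + c) * (sin (a * x b) * f (\<lambda>j. sin (a * x j)))"
        unfolding lin y_def[symmetric] by (simp only: distrib_right mult.assoc)
    qed
    finally show ?case .
  qed
  have trig0: "good (\<lambda>x. q (\<lambda>j. sin (a * x j)))" if "polyfun J d q" for d q a
    using trig[OF that, of "\<lambda>_. 0" 0 a] by simp
  have hm: "h \<in> borel_measurable borel" by (rule borel_measurable_continuous_onI[OF h])
  note hint = good_int[OF hm hK]
  define m2 where "m2 x = (\<Sum>j\<in>J. (x j)\<^sup>2)" for x :: "nat \<Rightarrow> real"
  have m2: "polyfun J 2 m2" unfolding m2_def
    by (intro polyfun_sum) (use polyfun_power[OF polyfun_var[of _ J 1], of _ 2] in auto)
  have K0: "K \<ge> 0" using hK[of "\<lambda>_. 0"] by linarith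
  show ?thesis
  proof (rule tendstoI)
    fix e :: real assume e: "e > 0"
    define s where "s = expectation (\<lambda>\<omega>. m2 (Y \<omega>))"
    have s0: "s \<ge> 0" unfolding s_def m2_def by (intro Bochner_Integration.integral_nonneg sum_nonneg) auto
    \<comment> \<open>The cap at 1 bounds the approximant by \<open>K + 1\<close> and the error
      outside the cube by \<open>2 * K + 1\<close>; the share \<open>e / 8\<close> leaves room for
      the remaining errors.\<close>
    define \<delta> where "\<delta> = min 1 (e / 8)"
    have \<delta>: "0 < \<delta>" "\<delta> \<le> 1" "\<delta> \<le> e / 8" using e by (auto simp: \<delta>_def)
    \<comment> \<open>Chosen so that \<open>(2 * K + 1) * (s + 1) / R\<^sup>2\<close> is at most
      \<open>e / 8\<close>, where \<open>s + 1\<close> eventually dominates the second moments of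
      \<open>X n\<close>. The final 1 keeps \<open>R\<close> at least 1.\<close>
    define R where "R = sqrt (8 * (2 * K + 1) * (s + 1) / e) + 1"
    have R1: "R \<ge> 1" unfolding R_def using K0 s0 e by simp
    have Rsq: "(2 * K + 1) * (s + 1) / R\<^sup>2 \<le> e / 8"
    proof -
      have "8 * (2 * K + 1) * (s + 1) / e = (sqrt (8 * (2 * K + 1) * (s + 1) / e))\<^sup>2" using K0 s0 e by simp
      also have "\<dots> \<le> R\<^sup>2" unfolding R_def using K0 s0 e by (intro power_mono) auto
      finally have "8 * (2 * K + 1) * (s + 1) \<le> R\<^sup>2 * e" using e by (simp only: pos_divide_le_eq)
      then have "(2 * K + 1) * (s + 1) \<le> e / 8 * R\<^sup>2" by argo
      then show ?thesis using R1 by (subst pos_divide_le_eq) auto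
    qed
    \<comment> \<open>On the cube of half-width \<open>R\<close> this inverts
      \<open>x \<mapsto> sin (pi / (2 * R) * x)\<close> in each coordinate of \<open>J\<close>, so
      \<open>H\<close> at the sines is \<open>h\<close> at \<open>x\<close>. Clamping to the domain
      of \<open>arcsin\<close> makes \<open>H\<close> continuous everywhere.\<close>
    define H where "H y = h (\<lambda>j. if j \<in> J then 2 * R / pi * arcsin (max (-1) (min 1 (y j))) else 0)" for y
    have Hc: "continuous_on UNIV H" unfolding H_def
    proof (rule continuous_on_compose2[OF h])
      show "continuous_on UNIV (\<lambda>y j. if j \<in> J then 2 * R / pi * arcsin (max (-1) (min 1 (y j))) else 0)"
      proof (rule continuous_on_coordinatewise_then_product)
        fix j
        have "continuous_on UNIV (\<lambda>y::nat \<Rightarrow> real. max (-1) (min 1 (y j)))"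
          by (intro continuous_intros continuous_on_product_coordinates)
        then have "continuous_on UNIV (\<lambda>y::nat \<Rightarrow> real. arcsin (max (-1) (min 1 (y j))))"
          by (rule continuous_on_compose2[OF continuous_on_arcsin']) auto
        then show "continuous_on UNIV (\<lambda>y. if j \<in> J then 2 * R / pi * arcsin (max (-1) (min 1 (y j))) else 0)"
          by (cases "j \<in> J") (auto intro!: continuous_intros)
      qed
    qed auto
    obtain d q where q: "polyfun J d q"
      and near: "\<And>y. (\<And>j. j \<in> J \<Longrightarrow> \<bar>y j\<bar> \<le> 1) \<Longrightarrow> (\<And>j. j \<notin> J \<Longrightarrow> y j = 0) \<Longrightarrow> \<bar>H y - q y\<bar> < \<delta>"
      using polyfun_dense_on_cube[OF Hc \<delta>(1) J] by blast
    define a where "a = pi / (2 * R)"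
    define \<phi> where "\<phi> x = q (\<lambda>j. sin (a * x j))" for x
    have \<phi>: "good \<phi>" unfolding \<phi>_def by (rule trig0[OF q])
    obtain C where C: "\<And>x. \<bar>\<phi> x\<bar> \<le> C" and \<phi>m: "\<phi> \<in> borel_measurable borel" using \<phi> unfolding good_def by blast
    note \<phi>int = good_int[OF \<phi>m C]
    have diff: "\<bar>h x - \<phi> x\<bar> \<le> \<delta> + (2 * K + 1) / R\<^sup>2 * m2 x" if x0: "\<And>j. j \<notin> J \<Longrightarrow> x j = 0" for x
    proof -
      define y where "y j = sin (a * x j)" for j
      have "\<bar>H y - q y\<bar> < \<delta>" by (rule near) (auto simp: y_def x0)
      moreover have "\<phi> x = q y" unfolding \<phi>_def y_def[abs_def] by (rule refl)
      ultimately have hq: "\<bar>H y - \<phi> x\<bar> < \<delta>" by simp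
      have m0: "m2 x \<ge> 0" unfolding m2_def by (intro sum_nonneg) auto
      show ?thesis
      proof (cases "\<forall>j\<in>J. \<bar>x j\<bar> \<le> R")
        case True
        have "2 * R / pi * arcsin (max (-1) (min 1 (y j))) = x j" if "j \<in> J" for j
        proof -
          have "\<bar>a * x j\<bar> \<le> pi / 2"
            using True that R1 by (auto simp: a_def abs_mult field_simps)
          then have "arcsin (sin (a * x j)) = a * x j" by (intro arcsin_sin) auto
          moreover have "max (-1) (min 1 (y j)) = y j" by (simp add: y_def)
          ultimately show ?thesis using R1 by (simp add: y_def a_def)
        qed
        then have "(\<lambda>j. if j \<in> J then 2 * R / pi * arcsin (max (-1) (min 1 (y j))) else 0) = x"
          using x0 by (auto simp: fun_eq_iff)
        then have "H y = h x" by (simp add: H_def)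
        moreover have "(2 * K + 1) / R\<^sup>2 * m2 x \<ge> 0" using K0 m0 by simp
        ultimately show ?thesis using hq by simp
      next
        case False
        then obtain j where j: "j \<in> J" "R < \<bar>x j\<bar>" by auto
        have "R\<^sup>2 \<le> \<bar>x j\<bar>\<^sup>2" using j R1 by (intro power_mono) auto
        also have "\<dots> \<le> m2 x" unfolding m2_def using j J member_le_sum[of j J "\<lambda>j. (x j)\<^sup>2"] by simp
        finally have "1 \<le> m2 x / R\<^sup>2" using R1 by (subst le_divide_eq_1_pos) auto
        then have "(2 * K + 1) * 1 \<le> (2 * K + 1) * (m2 x / R\<^sup>2)" using K0 by (intro mult_left_mono) auto
        moreover have "\<bar>H y\<bar> \<le> K" unfolding H_def by (rule hK)
        ultimately show ?thesis using hq hK[of x] \<delta> by simp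
      qed
    qed
    have bX: "\<bar>expectation (\<lambda>\<omega>. h (X n \<omega>)) - expectation (\<lambda>\<omega>. \<phi> (X n \<omega>))\<bar>
        \<le> \<delta> + (2 * K + 1) / R\<^sup>2 * expectation (\<lambda>\<omega>. m2 (X n \<omega>))" for n
      using expectation_diff_le[OF hint(1)[of n] \<phi>int(1)[of n] _ diff[OF X0]] intX[OF m2, of n] by (simp add: prob_space)
    have bY: "\<bar>expectation (\<lambda>\<omega>. h (Y \<omega>)) - expectation (\<lambda>\<omega>. \<phi> (Y \<omega>))\<bar> \<le> \<delta> + (2 * K + 1) / R\<^sup>2 * s"
      using expectation_diff_le[OF hint(2) \<phi>int(2) _ diff[OF Y0]] intY[OF m2] by (simp add: prob_space s_def)
    have cs: "(2 * K + 1) / R\<^sup>2 * z \<le> e / 8" if "z \<le> s + 1" for z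
    proof -
      have "(2 * K + 1) / R\<^sup>2 * z \<le> (2 * K + 1) / R\<^sup>2 * (s + 1)" using that K0 by (intro mult_left_mono) auto
      also have "\<dots> = (2 * K + 1) * (s + 1) / R\<^sup>2" by simp
      finally show ?thesis using Rsq by linarith
    qed
    have "\<forall>\<^sub>F n in U. expectation (\<lambda>\<omega>. m2 (X n \<omega>)) < s + 1"
      using mom[OF m2] by (rule order_tendstoD) (simp add: s_def)
    moreover have "\<forall>\<^sub>F n in U. dist (expectation (\<lambda>\<omega>. \<phi> (X n \<omega>))) (expectation (\<lambda>\<omega>. \<phi> (Y \<omega>))) < e / 4"
      using \<phi> e unfolding good_def by (intro tendstoD) auto
    ultimately show "\<forall>\<^sub>F n in U. dist (expectation (\<lambda>\<omega>. h (X n \<omega>))) (expectation (\<lambda>\<omega>. h (Y \<omega>))) < e"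
    proof eventually_elim
      case (elim n)
      have "(2 * K + 1) / R\<^sup>2 * expectation (\<lambda>\<omega>. m2 (X n \<omega>)) \<le> e / 8" using elim(1) by (intro cs) simp
      moreover have "(2 * K + 1) / R\<^sup>2 * s \<le> e / 8" by (intro cs) simp
      ultimately show ?case using bX[of n] bY elim(2) \<delta> e unfolding dist_real_def by linarith
    qed
  qed
qed

end

section \<open>Moments of Gaussian linear forms\<close>

context gaussian_family
begin

text \<open>Integration by parts lowers the power of the form by two, with factor
  \<open>2 * k + 1\<close> times the variance. The results are the terms of an exponential series,
  which is why the Taylor remainders tend to 0.\<close>

lemma linear_form_moment:
  assumes J: "finite J"
  shows "EG (\<lambda>x. (\<Sum>j\<in>J. t j * x j) ^ (2 * k)) / fact (2 * k) = ((\<Sum>j\<in>J. (t j)\<^sup>2) / 2) ^ k / fact k"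
proof (induction k)
  case (Suc k)
  define L where "L x = (\<Sum>j\<in>J. t j * x j)" for x :: "nat \<Rightarrow> real"
  define T where "T = (\<Sum>j\<in>J. (t j)\<^sup>2)"
  have L: "polyfun J 1 L" unfolding L_def by (intro polyfun_sum polyfun_scale polyfun_var) auto
  have Lp: "polyfun J m (\<lambda>x. L x ^ m)" for m using polyfun_power[OF L, of m] by simp
  have pd: "pdiff j (\<lambda>x. L x ^ Suc m) = (\<lambda>x. (real (Suc m) * t j) * L x ^ m)" if j: "j \<in> J" for j m
  proof (rule ext, rule pdiff_eqI)
    fix x
    have Ls: "L (x(j := s)) = L (x(j := 0)) + t j * s" for s
    proof -
      have "L (x(j := s)) = (\<Sum>i\<in>J. t i * (x(j := 0)) i + (if i = j then t j * s else 0))"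
        unfolding L_def by (intro sum.cong) auto
      then show ?thesis using J j by (simp add: L_def sum.distrib)
    qed
    have "(\<lambda>s. L (x(j := s)) ^ Suc m) = (\<lambda>s. (L (x(j := 0)) + t j * s) ^ Suc m)"
      by (rule ext, rule arg_cong[where f="\<lambda>z. z ^ Suc m"], rule Ls)
    moreover have "((\<lambda>s. (L (x(j := 0)) + t j * s) ^ Suc m) has_real_derivative
       (real (Suc m) * t j) * (L (x(j := 0)) + t j * x j) ^ m) (at (x j))"
    proof -
      have "((\<lambda>s. L (x(j := 0)) + t j * s) has_real_derivative t j) (at (x j))"
        by (auto intro!: derivative_eq_intros)
      from DERIV_power_Suc[OF this, of m] show ?thesis by (simp add: ac_simps)
    qed
    moreover have "L (x(j := 0)) + t j * x j = L x"
      using Ls[of "x j", symmetric] by (simp only: fun_upd_triv)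
    ultimately show "((\<lambda>s. L (x(j := s)) ^ Suc m) has_real_derivative (real (Suc m) * t j) * L x ^ m) (at (x j))"
      by (simp only:)
  qed
  have Lc: "L x * c = (\<Sum>j\<in>J. t j * (x j * c))" for x c
    unfolding L_def by (simp only: sum_distrib_right mult.assoc)
  have "2 * Suc k = Suc (Suc (2 * k))" by simp
  then have "EG (\<lambda>x. L x ^ (2 * Suc k)) = EG (\<lambda>x. \<Sum>j\<in>J. t j * (x j * L x ^ Suc (2 * k)))"
    by (simp only: power_Suc[of _ "Suc (2 * k)"] Lc)
  also have "\<dots> = (\<Sum>j\<in>J. EG (\<lambda>x. t j * (x j * L x ^ Suc (2 * k))))"
    by (rule EG_sum[OF _ J]) (rule polyfun_scale[OF polyfun.var_mult[OF _ Lp]])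
  also have "\<dots> = (\<Sum>j\<in>J. t j * EG (\<lambda>x. (real (Suc (2 * k)) * t j) * L x ^ (2 * k)))"
    by (intro sum.cong refl) (simp only: EG_scale EG_by_parts[OF Lp J] pd)
  also have "\<dots> = real (Suc (2 * k)) * T * EG (\<lambda>x. L x ^ (2 * k))"
  proof -
    have "t j * (real (Suc (2 * k)) * t j * E) = real (Suc (2 * k)) * (t j)\<^sup>2 * E" for j E by (simp add: power2_eq_square)
    then show ?thesis unfolding EG_scale T_def by (simp only: sum_distrib_left sum_distrib_right)
  qed
  finally have *: "EG (\<lambda>x. L x ^ (2 * Suc k)) = real (Suc (2 * k)) * T * EG (\<lambda>x. L x ^ (2 * k))" .
  have f: "(fact (2 * Suc k) :: real) = real (2 * Suc k) * (real (Suc (2 * k)) * fact (2 * k))"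
    by (simp add: algebra_simps)
  have "EG (\<lambda>x. L x ^ (2 * Suc k)) / fact (2 * Suc k) = T / real (2 * Suc k) * (EG (\<lambda>x. L x ^ (2 * k)) / fact (2 * k))"
  proof -
    have "a * T * E / (b * (a * c)) = T / b * (E / c)" if "a \<noteq> 0" for a b c E :: real using that by simp
    then show ?thesis unfolding * f by simp
  qed
  also have "EG (\<lambda>x. L x ^ (2 * k)) / fact (2 * k) = (T / 2) ^ k / fact k" using Suc by (simp add: L_def T_def)
  also have "T / real (2 * Suc k) * ((T / 2) ^ k / fact k) = (T / 2) ^ Suc k / fact (Suc k)"
  proof -
    have "T / real (2 * Suc k) = (T / 2) / real (Suc k)" by simp
    moreover have "fact (Suc k) = real (Suc k) * fact k" by simp
    ultimately show ?thesis by (simp only: times_divide_times_eq power_Suc)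
  qed
  finally show ?case by (simp only: L_def T_def)
qed simp

lemma linear_form_tail:
  assumes "finite J"
  shows "(\<lambda>k. EG (\<lambda>x. (\<Sum>j\<in>J. t j * x j) ^ (2 * k)) / fact (2 * k)) \<longlonglongrightarrow> 0"
  unfolding linear_form_moment[OF assms]
  using summable_LIMSEQ_zero[OF summable_exp[of "(\<Sum>j\<in>J. (t j)\<^sup>2) / 2"]] by (simp add: field_simps)

end

subsection \<open>Polynomials as finitely supported maps\<close>

lemma eval_mpoly_polyfun:
  assumes "total_degree_le p d"
  shows "polyfun (\<Union>m\<in>Poly_Mapping.keys p. Poly_Mapping.keys m) d (eval_mpoly p)"
  unfolding eval_mpoly_def[abs_def]
proof (intro polyfun_sum polyfun_scale)
  fix m assume m: "m \<in> Poly_Mapping.keys p"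
  have "polyfun (\<Union>m\<in>Poly_Mapping.keys p. Poly_Mapping.keys m) (\<Sum>j\<in>Poly_Mapping.keys m. Poly_Mapping.lookup m j)
     (\<lambda>x. \<Prod>j\<in>Poly_Mapping.keys m. x j ^ Poly_Mapping.lookup m j)"
    by (rule polyfun_monomial) (use m in auto)
  then show "polyfun (\<Union>m\<in>Poly_Mapping.keys p. Poly_Mapping.keys m) d
     (\<lambda>x. \<Prod>j\<in>Poly_Mapping.keys m. x j ^ Poly_Mapping.lookup m j)"
    by (rule polyfun_degree_mono) (use m assms in \<open>auto simp: total_degree_le_def\<close>)
qed

lemma eval_mpoly_superset:
  assumes "finite S" "Poly_Mapping.keys p \<subseteq> S"
  shows "eval_mpoly p x = (\<Sum>m\<in>S. Poly_Mapping.lookup p m * (\<Prod>j\<in>Poly_Mapping.keys m. x j ^ Poly_Mapping.lookup m j))"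
  unfolding eval_mpoly_def by (rule sum.mono_neutral_left) (use assms in \<open>auto simp: in_keys_iff\<close>)

lemma eval_mpoly_add: "eval_mpoly (p + q) x = eval_mpoly p x + eval_mpoly q x"
proof -
  let ?S = "Poly_Mapping.keys p \<union> Poly_Mapping.keys q"
  have S: "finite ?S" "Poly_Mapping.keys p \<subseteq> ?S" "Poly_Mapping.keys q \<subseteq> ?S" "Poly_Mapping.keys (p + q) \<subseteq> ?S"
    using keys_add[of p q] by auto
  show ?thesis
    unfolding eval_mpoly_superset[OF S(1,2)] eval_mpoly_superset[OF S(1,3)] eval_mpoly_superset[OF S(1,4)]
    by (simp add: lookup_add distrib_right sum.distrib)
qed

lemma eval_mpoly_0: "eval_mpoly 0 x = 0"
  by (simp add: eval_mpoly_def)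

lemma eval_mpoly_single:
  "eval_mpoly (Poly_Mapping.single m c) x = c * (\<Prod>j\<in>Poly_Mapping.keys m. x j ^ Poly_Mapping.lookup m j)"
  using eval_mpoly_superset[of "{m}" "Poly_Mapping.single m c" x] by simp

lemma total_degree_le_add: "total_degree_le p d \<Longrightarrow> total_degree_le q d \<Longrightarrow> total_degree_le (p + q) d"
  unfolding total_degree_le_def using keys_add[of p q] by blast

lemma monomial_superset:
  assumes "finite S" "Poly_Mapping.keys m \<subseteq> S"
  shows "(\<Prod>j\<in>Poly_Mapping.keys m. x j ^ Poly_Mapping.lookup m j) = (\<Prod>j\<in>S. (x j :: real) ^ Poly_Mapping.lookup m j)"
    "(\<Sum>j\<in>Poly_Mapping.keys m. Poly_Mapping.lookup m j) = (\<Sum>j\<in>S. Poly_Mapping.lookup (m :: nat \<Rightarrow>\<^sub>0 nat) j)"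
  by (rule prod.mono_neutral_left, use assms in \<open>auto simp: in_keys_iff\<close>)
     (rule sum.mono_neutral_left, use assms in \<open>auto simp: in_keys_iff\<close>)

lemma monomial_times_var:
  fixes m :: "nat \<Rightarrow>\<^sub>0 nat" and x :: "nat \<Rightarrow> real" and b :: nat
  defines "m' \<equiv> m + Poly_Mapping.single b 1"
  shows "(\<Prod>j\<in>Poly_Mapping.keys m'. x j ^ Poly_Mapping.lookup m' j)
      = x b * (\<Prod>j\<in>Poly_Mapping.keys m. x j ^ Poly_Mapping.lookup m j)"
    "(\<Sum>j\<in>Poly_Mapping.keys m'. Poly_Mapping.lookup m' j) = Suc (\<Sum>j\<in>Poly_Mapping.keys m. Poly_Mapping.lookup m j)"
proof -
  define S where "S = insert b (Poly_Mapping.keys m)"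
  have S: "finite S" "Poly_Mapping.keys m \<subseteq> S" "Poly_Mapping.keys m' \<subseteq> S" "b \<in> S"
    using keys_add[of m "Poly_Mapping.single b 1"] by (auto simp: S_def m'_def split: if_splits)
  have l: "Poly_Mapping.lookup m' j = Poly_Mapping.lookup m j + (if j = b then 1 else 0)" for j
    by (simp add: m'_def lookup_add lookup_single when_def)
  have "(\<Prod>j\<in>S. x j ^ Poly_Mapping.lookup m' j) = (\<Prod>j\<in>S. x j ^ Poly_Mapping.lookup m j * (if j = b then x b else 1))"
    by (intro prod.cong) (auto simp: l)
  also have "\<dots> = (\<Prod>j\<in>S. x j ^ Poly_Mapping.lookup m j) * x b"
    using S by (simp add: prod.distrib prod.delta)
  finally show "(\<Prod>j\<in>Poly_Mapping.keys m'. x j ^ Poly_Mapping.lookup m' j)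
      = x b * (\<Prod>j\<in>Poly_Mapping.keys m. x j ^ Poly_Mapping.lookup m j)"
    unfolding monomial_superset(1)[OF S(1,2)] monomial_superset(1)[OF S(1,3)] by (simp add: mult.commute)
  have "(\<Sum>j\<in>S. Poly_Mapping.lookup m' j) = Suc (\<Sum>j\<in>S. Poly_Mapping.lookup m j)"
    unfolding l using S by (simp add: sum.distrib)
  then show "(\<Sum>j\<in>Poly_Mapping.keys m'. Poly_Mapping.lookup m' j) = Suc (\<Sum>j\<in>Poly_Mapping.keys m. Poly_Mapping.lookup m j)"
    unfolding monomial_superset(2)[OF S(1,2)] monomial_superset(2)[OF S(1,3)] .
qed

text \<open>The product is assembled one monomial at a time, because evaluation is additive and on a
  single monomial the exponent of \<open>b\<close> just increases by 1.\<close>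

lemma mpoly_var_mult:
  assumes "total_degree_le p d"
  shows "\<exists>p'. total_degree_le p' (Suc d) \<and> (\<forall>x. eval_mpoly p' x = x b * eval_mpoly p x)"
proof -
  have "\<exists>p'. total_degree_le p' (Suc d) \<and> (\<forall>x. eval_mpoly p' x
      = x b * (\<Sum>m\<in>A. Poly_Mapping.lookup p m * (\<Prod>j\<in>Poly_Mapping.keys m. x j ^ Poly_Mapping.lookup m j)))"
    if "finite A" "A \<subseteq> Poly_Mapping.keys p" for A
    using that
  proof (induction A rule: finite_induct)
    case empty
    show ?case by (rule exI[of _ 0]) (simp add: total_degree_le_def eval_mpoly_0)
  next
    case (insert m A)
    then obtain p' where p': "total_degree_le p' (Suc d)" "\<And>x. eval_mpoly p' x
      = x b * (\<Sum>m\<in>A. Poly_Mapping.lookup p m * (\<Prod>j\<in>Poly_Mapping.keys m. x j ^ Poly_Mapping.lookup m j))" by auto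
    let ?s = "Poly_Mapping.single (m + Poly_Mapping.single b 1) (Poly_Mapping.lookup p m)"
    have "(\<Sum>j\<in>Poly_Mapping.keys m. Poly_Mapping.lookup m j) \<le> d"
      using insert.prems assms by (auto simp: total_degree_le_def)
    then have "total_degree_le ?s (Suc d)"
      unfolding total_degree_le_def using monomial_times_var(2)[of m b] by (simp split: if_splits)
    then have "total_degree_le (?s + p') (Suc d)" using p'(1) by (rule total_degree_le_add)
    moreover have "eval_mpoly (?s + p') x
      = x b * (\<Sum>m\<in>insert m A. Poly_Mapping.lookup p m * (\<Prod>j\<in>Poly_Mapping.keys m. x j ^ Poly_Mapping.lookup m j))" for x
      unfolding eval_mpoly_add eval_mpoly_single monomial_times_var(1) p'(2) using insert.hyps
      by (simp add: algebra_simps)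
    ultimately show ?case by blast
  qed
  from this[OF finite_keys order_refl] show ?thesis unfolding eval_mpoly_def .
qed

text \<open>The way back to syntax: the limits are built from polynomial functions, whereas
  membership in \<open>polys_of\<close> refers to \<open>eval_mpoly\<close>.\<close>

lemma polyfun_eval_mpoly:
  assumes "polyfun V d f"
  shows "\<exists>p. total_degree_le p d \<and> eval_mpoly p = f"
  using assms
proof (induction rule: polyfun.induct)
  case (const d c)
  have "total_degree_le (Poly_Mapping.single 0 c) d" by (simp add: total_degree_le_def)
  moreover have "eval_mpoly (Poly_Mapping.single 0 c) = (\<lambda>x. c)" by (simp add: fun_eq_iff eval_mpoly_single)
  ultimately show ?case by blast
next
  case (add d f g)
  then obtain p q where "total_degree_le p d" "eval_mpoly p = f" "total_degree_le q d" "eval_mpoly q = g" by blast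
  then have "total_degree_le (p + q) d \<and> eval_mpoly (p + q) = (\<lambda>x. f x + g x)"
    by (auto simp: fun_eq_iff eval_mpoly_add intro: total_degree_le_add)
  then show ?case by blast
next
  case (var_mult b d f)
  then obtain p where p: "total_degree_le p d" "eval_mpoly p = f" by blast
  from mpoly_var_mult[OF p(1), of b] obtain p' where "total_degree_le p' (Suc d)" "\<forall>x. eval_mpoly p' x = x b * f x"
    unfolding p(2) by blast
  then show ?case by (intro exI[of _ p']) auto
qed

subsection \<open>Square integrable random variables\<close>

lemma L2_functionsD:
  assumes "X \<in> L2_functions M"
  shows "X \<in> borel_measurable M" "integrable M (\<lambda>\<omega>. (X \<omega>)\<^sup>2)"
  using assms by (auto simp: L2_functions_def)

lemma L2_functions_diff:
  assumes X: "X \<in> L2_functions M" and Y: "Y \<in> L2_functions M"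
  shows "(\<lambda>\<omega>. X \<omega> - Y \<omega>) \<in> L2_functions M"
proof -
  have "integrable M (\<lambda>\<omega>. (X \<omega>)\<^sup>2 - 2 * (X \<omega> * Y \<omega>) + (Y \<omega>)\<^sup>2)"
    using integrable_mult_of_squares[OF L2_functionsD(1)[OF X] L2_functionsD(1)[OF Y] L2_functionsD(2)[OF X] L2_functionsD(2)[OF Y]]
      L2_functionsD[OF X] L2_functionsD[OF Y] by simp
  then show ?thesis using L2_functionsD(1)[OF X] L2_functionsD(1)[OF Y]
    by (auto simp: L2_functions_def power2_diff algebra_simps)
qed

context prob_space
begin

lemma L2_imp_integrable:
  assumes "X \<in> L2_functions M"
  shows "integrable M X" "expectation (\<lambda>\<omega>. \<bar>X \<omega>\<bar>) \<le> sqrt (expectation (\<lambda>\<omega>. (X \<omega>)\<^sup>2))"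
proof -
  note X = L2_functionsD[OF assms]
  show "integrable M X" using integrable_mult_of_squares[of X M "\<lambda>_. 1"] X by simp
  show "expectation (\<lambda>\<omega>. \<bar>X \<omega>\<bar>) \<le> sqrt (expectation (\<lambda>\<omega>. (X \<omega>)\<^sup>2))"
    using integral_cauchy_schwarz[of "\<lambda>\<omega>. \<bar>X \<omega>\<bar>" M "\<lambda>_. 1"] X by (simp add: prob_space)
qed

text \<open>The explicit geometric rate makes the increments summable in mean, so the sequence
  itself converges almost surely. Fatou's lemma, applied to nonnegative extended integrals because
  integrability of the limit is not yet known, carries the estimate over.\<close>

lemma L2_complete:
  fixes X :: "nat \<Rightarrow> 'a \<Rightarrow> real"
  assumes X: "\<And>r. X r \<in> L2_functions M"
    and cauchy: "\<And>r s. sqrt (expectation (\<lambda>\<omega>. (X r \<omega> - X s \<omega>)\<^sup>2)) \<le> (1/2) ^ r + (1/2) ^ s"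
  obtains Y where "Y \<in> L2_functions M" "\<And>r. sqrt (expectation (\<lambda>\<omega>. (Y \<omega> - X r \<omega>)\<^sup>2)) \<le> 2 * (1/2) ^ r"
proof -
  have [measurable]: "X r \<in> borel_measurable M" for r using L2_functionsD(1)[OF X] .
  define \<Delta> where "\<Delta> r \<omega> = \<bar>X (Suc r) \<omega> - X r \<omega>\<bar>" for r \<omega>
  have [measurable]: "\<Delta> r \<in> borel_measurable M" for r unfolding \<Delta>_def by measurable
  note XX = L2_functions_diff[OF X X]
  have e: "(\<integral>\<^sup>+\<omega>. ennreal (\<Delta> r \<omega>) \<partial>M) \<le> ennreal (2 * (1/2) ^ r)" for r
  proof -
    have "integrable M (\<Delta> r)" unfolding \<Delta>_def using L2_imp_integrable(1)[OF XX[of "Suc r" r]] by simp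
    then have "(\<integral>\<^sup>+\<omega>. ennreal (\<Delta> r \<omega>) \<partial>M) = ennreal (expectation (\<Delta> r))"
      by (rule nn_integral_eq_integral) (simp add: \<Delta>_def)
    moreover have "expectation (\<Delta> r) \<le> (1/2) ^ Suc r + (1/2) ^ r"
      unfolding \<Delta>_def using L2_imp_integrable(2)[OF XX[of "Suc r" r]] cauchy[of "Suc r" r] by linarith
    moreover have "(1/2) ^ Suc r + (1/2) ^ r \<le> 2 * (1/2 :: real) ^ r" by simp
    ultimately show ?thesis by (simp only: ennreal_leI[OF order_trans])
  qed
  have "(\<integral>\<^sup>+\<omega>. suminf (\<lambda>r. ennreal (\<Delta> r \<omega>)) \<partial>M) = suminf (\<lambda>r. \<integral>\<^sup>+\<omega>. ennreal (\<Delta> r \<omega>) \<partial>M)"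
    by (rule nn_integral_suminf) measurable
  also have "\<dots> \<le> suminf (\<lambda>r. ennreal (2 * (1/2) ^ r))" by (intro suminf_le e summableI)
  also have "\<dots> = ennreal (suminf (\<lambda>r. 2 * (1/2) ^ r))" by (rule suminf_ennreal2) (auto intro: summable_mult summable_geometric)
  finally have "(\<integral>\<^sup>+\<omega>. suminf (\<lambda>r. ennreal (\<Delta> r \<omega>)) \<partial>M) \<noteq> \<infinity>"
    using ennreal_less_top[of "suminf (\<lambda>r. 2 * (1/2) ^ r)"] by (auto simp: top_unique)
  then have "AE \<omega> in M. suminf (\<lambda>r. ennreal (\<Delta> r \<omega>)) \<noteq> \<infinity>" by (intro nn_integral_PInf_AE) measurable
  then have conv: "AE \<omega> in M. convergent (\<lambda>r. X r \<omega>)"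
  proof eventually_elim
    case (elim \<omega>)
    then have "summable (\<lambda>r. \<Delta> r \<omega>)" by (intro summable_suminf_not_top) (auto simp: \<Delta>_def)
    then have "summable (\<lambda>r. X (Suc r) \<omega> - X r \<omega>)" unfolding \<Delta>_def by (rule summable_rabs_cancel)
    then have "convergent (\<lambda>n. X n \<omega> - X 0 \<omega>)"
      unfolding summable_iff_convergent by (simp only: sum_lessThan_telescope[of "\<lambda>r. X r \<omega>"])
    then have "convergent (\<lambda>n. (X n \<omega> - X 0 \<omega>) + X 0 \<omega>)" by (intro convergent_add convergent_const)
    then show ?case by simp
  qed
  define Y where "Y \<omega> = lim (\<lambda>r. X r \<omega>)" for \<omega>
  have [measurable]: "Y \<in> borel_measurable M" unfolding Y_def by (rule borel_measurable_lim_metric) measurable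
  have Y: "(\<integral>\<^sup>+\<omega>. ennreal ((Y \<omega> - X r \<omega>)\<^sup>2) \<partial>M) \<le> ennreal ((2 * (1/2) ^ r)\<^sup>2)" for r
  proof -
    have "(\<integral>\<^sup>+\<omega>. ennreal ((Y \<omega> - X r \<omega>)\<^sup>2) \<partial>M) = (\<integral>\<^sup>+\<omega>. liminf (\<lambda>s. ennreal ((X s \<omega> - X r \<omega>)\<^sup>2)) \<partial>M)"
    proof (rule nn_integral_cong_AE)
      show "AE \<omega> in M. ennreal ((Y \<omega> - X r \<omega>)\<^sup>2) = liminf (\<lambda>s. ennreal ((X s \<omega> - X r \<omega>)\<^sup>2))"
        using conv
      proof eventually_elim
        case (elim \<omega>)
        then have "(\<lambda>s. X s \<omega>) \<longlonglongrightarrow> Y \<omega>" unfolding Y_def by (simp add: convergent_LIMSEQ_iff)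
        then have "(\<lambda>s. ennreal ((X s \<omega> - X r \<omega>)\<^sup>2)) \<longlonglongrightarrow> ennreal ((Y \<omega> - X r \<omega>)\<^sup>2)"
          by (intro tendsto_ennrealI tendsto_intros)
        from lim_imp_Liminf[OF _ this] show ?case by simp
      qed
    qed
    also have "\<dots> \<le> liminf (\<lambda>s. \<integral>\<^sup>+\<omega>. ennreal ((X s \<omega> - X r \<omega>)\<^sup>2) \<partial>M)"
      by (rule nn_integral_liminf) measurable
    also have "\<dots> \<le> ennreal ((2 * (1/2) ^ r)\<^sup>2)"
    proof (rule Liminf_le)
      show "\<forall>\<^sub>F s in sequentially. (\<integral>\<^sup>+\<omega>. ennreal ((X s \<omega> - X r \<omega>)\<^sup>2) \<partial>M) \<le> ennreal ((2 * (1/2) ^ r)\<^sup>2)"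
        using eventually_ge_at_top[of r]
      proof eventually_elim
        case (elim s)
        have "(1/2 :: real) ^ s \<le> (1/2) ^ r" using elim by (intro power_decreasing) auto
        then have "sqrt (expectation (\<lambda>\<omega>. (X s \<omega> - X r \<omega>)\<^sup>2)) \<le> 2 * (1/2) ^ r" using cauchy[of s r] by linarith
        then have "(sqrt (expectation (\<lambda>\<omega>. (X s \<omega> - X r \<omega>)\<^sup>2)))\<^sup>2 \<le> (2 * (1/2) ^ r)\<^sup>2" by (intro power_mono) auto
        then have "expectation (\<lambda>\<omega>. (X s \<omega> - X r \<omega>)\<^sup>2) \<le> (2 * (1/2) ^ r)\<^sup>2" by simp
        then show ?case
          using nn_integral_eq_integral[OF L2_functionsD(2)[OF XX[of s r]]] by (auto intro!: ennreal_leI)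
      qed
    qed simp
    finally show ?thesis .
  qed
  have int: "integrable M (\<lambda>\<omega>. (Y \<omega> - X r \<omega>)\<^sup>2)" for r
  proof (rule integrableI_bounded)
    have "(\<integral>\<^sup>+\<omega>. ennreal (norm ((Y \<omega> - X r \<omega>)\<^sup>2)) \<partial>M) \<le> ennreal ((2 * (1/2) ^ r)\<^sup>2)" using Y[of r] by simp
    then show "(\<integral>\<^sup>+\<omega>. ennreal (norm ((Y \<omega> - X r \<omega>)\<^sup>2)) \<partial>M) < \<infinity>" by (rule le_less_trans) simp
  qed measurable
  show ?thesis
  proof (rule that[of Y])
    have d: "(\<lambda>\<omega>. X 0 \<omega> - Y \<omega>) \<in> L2_functions M"
      using int[of 0] by (auto simp: L2_functions_def power2_commute[of "X 0 _"])
    from L2_functions_diff[OF X[of 0] this] show "Y \<in> L2_functions M" by simp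
    fix r
    have "ennreal (expectation (\<lambda>\<omega>. (Y \<omega> - X r \<omega>)\<^sup>2)) \<le> ennreal ((2 * (1/2) ^ r)\<^sup>2)"
      using Y[of r] nn_integral_eq_integral[OF int[of r]] by simp
    then have "expectation (\<lambda>\<omega>. (Y \<omega> - X r \<omega>)\<^sup>2) \<le> (2 * (1/2) ^ r)\<^sup>2" by (simp add: ennreal_le_iff)
    then show "sqrt (expectation (\<lambda>\<omega>. (Y \<omega> - X r \<omega>)\<^sup>2)) \<le> 2 * (1/2) ^ r" by (intro real_le_lsqrt) auto
  qed
qed

text \<open>Products of factors bounded by 1 differ by at most the sum of the differences of the
  factors, and the mean of an absolute value is at most the L2 norm. This is the comparison used
  whenever variables are replaced by close ones under a test function.\<close>

lemma expectation_prod_lipschitz: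
  fixes X Y :: "nat \<Rightarrow> 'a \<Rightarrow> real" and g :: "nat \<Rightarrow> real \<Rightarrow> real"
  assumes I: "finite I" and X: "\<And>i. i \<in> I \<Longrightarrow> X i \<in> L2_functions M" and Y: "\<And>i. i \<in> I \<Longrightarrow> Y i \<in> L2_functions M"
    and g: "\<And>i. continuous_on UNIV (g i)" "\<And>i x. \<bar>g i x\<bar> \<le> 1" "\<And>i x y. \<bar>g i x - g i y\<bar> \<le> k * \<bar>x - y\<bar>"
  shows "\<bar>expectation (\<lambda>\<omega>. \<Prod>i\<in>I. g i (X i \<omega>)) - expectation (\<lambda>\<omega>. \<Prod>i\<in>I. g i (Y i \<omega>))\<bar>
    \<le> (\<Sum>i\<in>I. k * sqrt (expectation (\<lambda>\<omega>. (X i \<omega> - Y i \<omega>)\<^sup>2)))"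
proof -
  have k: "k \<ge> 0" using order_trans[OF abs_ge_zero g(3)[of 0 1 0]] by simp
  have gm: "g i \<in> borel_measurable borel" for i by (rule borel_measurable_continuous_onI[OF g(1)])
  have le1: "\<bar>\<Prod>i\<in>I. g i (z i)\<bar> \<le> 1" for z unfolding abs_prod by (intro prod_le_1) (auto simp: g(2))
  have int: "integrable M (\<lambda>\<omega>. \<Prod>i\<in>I. g i (Z i \<omega>))" if "\<And>i. i \<in> I \<Longrightarrow> Z i \<in> L2_functions M" for Z
    by (rule integrable_bounded[of _ 1]) (auto intro!: borel_measurable_prod measurable_compose[OF L2_functionsD(1)[OF that] gm] simp: le1)
  note d = L2_functions_diff[OF X Y]
  have di: "integrable M (\<lambda>\<omega>. \<bar>X i \<omega> - Y i \<omega>\<bar>)" if "i \<in> I" for i using L2_imp_integrable(1)[OF d[OF that that]] by simp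
  have "\<bar>expectation (\<lambda>\<omega>. \<Prod>i\<in>I. g i (X i \<omega>)) - expectation (\<lambda>\<omega>. \<Prod>i\<in>I. g i (Y i \<omega>))\<bar>
     \<le> expectation (\<lambda>\<omega>. \<Sum>i\<in>I. k * \<bar>X i \<omega> - Y i \<omega>\<bar>)"
  proof (rule expectation_diff_le[OF int[OF X] int[OF Y]])
    show "integrable M (\<lambda>\<omega>. \<Sum>i\<in>I. k * \<bar>X i \<omega> - Y i \<omega>\<bar>)" using di by (intro Bochner_Integration.integrable_sum integrable_mult_right)
    fix \<omega>
    have "\<bar>(\<Prod>i\<in>I. g i (X i \<omega>)) - (\<Prod>i\<in>I. g i (Y i \<omega>))\<bar> \<le> (\<Sum>i\<in>I. \<bar>g i (X i \<omega>) - g i (Y i \<omega>)\<bar>)"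
      using norm_prod_diff[of I "\<lambda>i. g i (X i \<omega>)" "\<lambda>i. g i (Y i \<omega>)"] g(2) by simp
    also have "\<dots> \<le> (\<Sum>i\<in>I. k * \<bar>X i \<omega> - Y i \<omega>\<bar>)" by (intro sum_mono g(3))
    finally show "\<bar>(\<Prod>i\<in>I. g i (X i \<omega>)) - (\<Prod>i\<in>I. g i (Y i \<omega>))\<bar> \<le> (\<Sum>i\<in>I. k * \<bar>X i \<omega> - Y i \<omega>\<bar>)" .
  qed
  also have "\<dots> = (\<Sum>i\<in>I. k * expectation (\<lambda>\<omega>. \<bar>X i \<omega> - Y i \<omega>\<bar>))"
    using di by (subst Bochner_Integration.integral_sum) auto
  also have "\<dots> \<le> (\<Sum>i\<in>I. k * sqrt (expectation (\<lambda>\<omega>. (X i \<omega> - Y i \<omega>)\<^sup>2)))"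
    using k L2_imp_integrable(2)[OF d] by (intro sum_mono mult_left_mono) auto
  finally show ?thesis .
qed

end

subsection \<open>Test functions for weak convergence\<close>

text \<open>Equal to 1 up to \<open>a\<close>, then falling linearly with slope \<open>- k\<close>
  to 0: a Lipschitz test function that decreases to the indicator of \<open>{..a}\<close> as
  \<open>k\<close> grows.\<close>

definition ramp :: "real \<Rightarrow> nat \<Rightarrow> real \<Rightarrow> real" where
  "ramp a k x = max 0 (min 1 (1 - real k * (x - a)))"

lemma ramp_continuous: "continuous_on UNIV (ramp a k)"
  unfolding ramp_def[abs_def] by (intro continuous_intros)

lemma ramp_bounded: "0 \<le> ramp a k x" "ramp a k x \<le> 1" "\<bar>ramp a k x\<bar> \<le> 1"
  by (auto simp: ramp_def)

lemma ramp_lipschitz: "\<bar>ramp a k x - ramp a k y\<bar> \<le> real k * \<bar>x - y\<bar>"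
proof -
  have "\<bar>ramp a k x - ramp a k y\<bar> \<le> \<bar>(1 - real k * (x - a)) - (1 - real k * (y - a))\<bar>"
    unfolding ramp_def by linarith
  also have "(1 - real k * (x - a)) - (1 - real k * (y - a)) = real k * (y - x)" by (simp add: algebra_simps)
  also have "\<bar>real k * (y - x)\<bar> = real k * \<bar>x - y\<bar>" by (simp add: abs_mult abs_minus_commute)
  finally show ?thesis .
qed

lemma ramp_tendsto: "(\<lambda>k. ramp a k x) \<longlonglongrightarrow> indicator {..a} x"
proof (cases "x \<le> a")
  case True
  then have "ramp a k x = 1" for k by (auto simp: ramp_def mult_nonneg_nonpos)
  then show ?thesis using True by simp
next
  case False
  obtain m where m: "1 < real m * (x - a)" using False reals_Archimedean3[of "x - a"] by auto
  have "ramp a k x = 0" if "k \<ge> m" for k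
  proof -
    have "real m * (x - a) \<le> real k * (x - a)" using that False by (intro mult_right_mono) auto
    then show ?thesis using m by (auto simp: ramp_def)
  qed
  then have "\<forall>\<^sub>F k in sequentially. ramp a k x = 0" by (auto simp: eventually_sequentially)
  from tendsto_eventually[OF this] show ?thesis using False by simp
qed

lemma sets_PiM_borel_atMost:
  fixes I :: "nat set"
  assumes I: "finite I"
  shows "sets (\<Pi>\<^sub>M i\<in>I. (borel :: real measure))
    = sigma_sets (\<Pi>\<^sub>E i\<in>I. UNIV) (range (\<lambda>a. \<Pi>\<^sub>E i\<in>I. {..a i}))"
proof
  let ?\<Omega> = "\<Pi>\<^sub>E i\<in>I. (UNIV :: real set)" and ?E = "range (\<lambda>a. \<Pi>\<^sub>E i\<in>I. {..a i :: real})"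
  have sp: "space (\<Pi>\<^sub>M i\<in>I. (borel :: real measure)) = ?\<Omega>" by (simp add: space_PiM)
  have EP: "?E \<subseteq> Pow ?\<Omega>" by auto
  have "?E \<subseteq> sets (\<Pi>\<^sub>M i\<in>I. (borel :: real measure))" using I by (auto intro!: sets_PiM_I_finite)
  from sets.sigma_sets_subset[OF this] show "sigma_sets ?\<Omega> ?E \<subseteq> sets (\<Pi>\<^sub>M i\<in>I. (borel :: real measure))"
    by (simp add: sp)
  have spS: "space (sigma ?\<Omega> ?E) = ?\<Omega>" "sets (sigma ?\<Omega> ?E) = sigma_sets ?\<Omega> ?E" using EP by auto
  have coord: "(\<lambda>x. x i) \<in> borel_measurable (sigma ?\<Omega> ?E)" if i: "i \<in> I" for i
    unfolding borel_measurable_iff_le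
  proof
    fix a :: real
    \<comment> \<open>A half-space is exhausted by orthants whose other coordinates are bounded by
      \<open>n\<close>; finiteness of \<open>I\<close> lets one \<open>n\<close> serve all
      coordinates.\<close>
    have "{x \<in> space (sigma ?\<Omega> ?E). x i \<le> a} = (\<Union>n::nat. \<Pi>\<^sub>E j\<in>I. {..(if j = i then a else real n)})"
    proof (intro equalityI subsetI)
      fix x assume x: "x \<in> {x \<in> space (sigma ?\<Omega> ?E). x i \<le> a}"
      obtain n :: nat where n: "(\<Sum>j\<in>I. \<bar>x j\<bar>) \<le> real n" using real_arch_simple by blast
      have "x j \<le> real n" if "j \<in> I" for j
        using member_le_sum[of j I "\<lambda>j. \<bar>x j\<bar>"] that I n by auto
      then have "x \<in> (\<Pi>\<^sub>E j\<in>I. {..(if j = i then a else real n)})"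
        using x unfolding spS by (auto simp: PiE_def)
      then show "x \<in> (\<Union>n::nat. \<Pi>\<^sub>E j\<in>I. {..(if j = i then a else real n)})" by blast
    next
      fix x assume "x \<in> (\<Union>n::nat. \<Pi>\<^sub>E j\<in>I. {..(if j = i then a else real n)})"
      then obtain n :: nat where x: "x \<in> (\<Pi>\<^sub>E j\<in>I. {..(if j = i then a else real n)})" by blast
      then have "x i \<le> a" using i by (auto dest: PiE_mem)
      then show "x \<in> {x \<in> space (sigma ?\<Omega> ?E). x i \<le> a}" using x unfolding spS by (auto simp: PiE_def)
    qed
    also have "\<dots> \<in> sets (sigma ?\<Omega> ?E)"
    proof (rule sets.countable_UN, rule image_subsetI)
      fix n :: nat
      have "(\<Pi>\<^sub>E j\<in>I. {..(\<lambda>j. if j = i then a else real n) j}) \<in> ?E" by (rule rangeI)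
      then show "(\<Pi>\<^sub>E j\<in>I. {..(if j = i then a else real n)}) \<in> sets (sigma ?\<Omega> ?E)"
        unfolding spS by (intro sigma_sets.Basic) simp
    qed
    finally show "{x \<in> space (sigma ?\<Omega> ?E). x i \<le> a} \<in> sets (sigma ?\<Omega> ?E)" .
  qed
  have id: "(\<lambda>x. \<lambda>i\<in>I. x i) \<in> measurable (sigma ?\<Omega> ?E) (\<Pi>\<^sub>M i\<in>I. (borel :: real measure))"
    by (rule measurable_restrict) (rule coord)
  show "sets (\<Pi>\<^sub>M i\<in>I. (borel :: real measure)) \<subseteq> sigma_sets ?\<Omega> ?E"
  proof
    fix A assume A: "A \<in> sets (\<Pi>\<^sub>M i\<in>I. (borel :: real measure))"
    have "(\<lambda>x. \<lambda>i\<in>I. x i) -` A \<inter> ?\<Omega> = A"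
      using sets.sets_into_space[OF A] unfolding sp by (auto simp: PiE_restrict)
    then show "A \<in> sigma_sets ?\<Omega> ?E" using measurable_sets[OF id A] unfolding spS by simp
  qed
qed

text \<open>By dominated convergence the products of ramps recover the measure of every orthant, and
  the orthants form an intersection-stable generator. Only bounded Lipschitz products are therefore
  needed to identify a law.\<close>

lemma PiM_eq_by_ramps:
  fixes I :: "nat set" and \<mu> \<nu> :: "(nat \<Rightarrow> real) measure"
  assumes I: "finite I" and \<mu>: "prob_space \<mu>" "sets \<mu> = sets (\<Pi>\<^sub>M i\<in>I. borel)"
    and \<nu>: "prob_space \<nu>" "sets \<nu> = sets (\<Pi>\<^sub>M i\<in>I. borel)"
    and eq: "\<And>a k. (\<integral>x. (\<Prod>i\<in>I. ramp (a i) k (x i)) \<partial>\<mu>) = (\<integral>x. (\<Prod>i\<in>I. ramp (a i) k (x i)) \<partial>\<nu>)"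
  shows "\<mu> = \<nu>"
proof -
  let ?\<Omega> = "\<Pi>\<^sub>E i\<in>I. (UNIV :: real set)" and ?E = "range (\<lambda>a. \<Pi>\<^sub>E i\<in>I. {..a i :: real})"
  have box: "measure \<rho> (\<Pi>\<^sub>E i\<in>I. {..a i}) = lim (\<lambda>k. \<integral>x. (\<Prod>i\<in>I. ramp (a i) k (x i)) \<partial>\<rho>)"
    if \<rho>: "prob_space \<rho>" "sets \<rho> = sets (\<Pi>\<^sub>M i\<in>I. borel)" for \<rho> and a :: "nat \<Rightarrow> real"
  proof -
    interpret \<rho>: prob_space \<rho> by fact
    have sp: "space \<rho> = ?\<Omega>" using sets_eq_imp_space_eq[OF \<rho>(2)] by (simp add: space_PiM)
    have m[measurable]: "(\<lambda>x. x i) \<in> borel_measurable \<rho>" if "i \<in> I" for i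
      using measurable_component_singleton[OF that, of "\<lambda>_. borel :: real measure"]
      by (simp add: measurable_cong_sets[OF \<rho>(2) refl])
    have A: "(\<Pi>\<^sub>E i\<in>I. {..a i}) \<in> sets \<rho>" unfolding \<rho>(2) using I by (auto intro!: sets_PiM_I_finite)
    have ind: "(\<Prod>i\<in>I. indicator {..a i} (x i)) = (indicator (\<Pi>\<^sub>E i\<in>I. {..a i}) x :: real)" if "x \<in> space \<rho>" for x
      using that I unfolding sp by (auto simp: indicator_def PiE_def Pi_def prod_eq_1_iff intro!: prod.neutral split: if_splits)
    have "(\<lambda>k. \<integral>x. (\<Prod>i\<in>I. ramp (a i) k (x i)) \<partial>\<rho>) \<longlonglongrightarrow> (\<integral>x. (\<Prod>i\<in>I. indicator {..a i} (x i)) \<partial>\<rho>)"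
    proof (rule integral_dominated_convergence[where w="\<lambda>_. 1"])
      show "(\<lambda>x. \<Prod>i\<in>I. ramp (a i) k (x i)) \<in> borel_measurable \<rho>" for k
        by (intro borel_measurable_prod measurable_compose[OF m borel_measurable_continuous_onI[OF ramp_continuous]])
      show "(\<lambda>x. \<Prod>i\<in>I. indicator {..a i} (x i) :: real) \<in> borel_measurable \<rho>"
        by (intro borel_measurable_prod measurable_compose[OF m]) auto
      show "AE x in \<rho>. (\<lambda>k. \<Prod>i\<in>I. ramp (a i) k (x i)) \<longlonglongrightarrow> (\<Prod>i\<in>I. indicator {..a i} (x i))"
        by (intro AE_I2 tendsto_prod ramp_tendsto)
      show "AE x in \<rho>. norm (\<Prod>i\<in>I. ramp (a i) k (x i)) \<le> 1" for k
        by (intro AE_I2) (auto simp: abs_prod intro!: prod_le_1 ramp_bounded)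
    qed simp
    also have "(\<integral>x. (\<Prod>i\<in>I. indicator {..a i} (x i) :: real) \<partial>\<rho>) = (\<integral>x. indicator (\<Pi>\<^sub>E i\<in>I. {..a i}) x \<partial>\<rho>)"
      by (rule Bochner_Integration.integral_cong[OF refl]) (rule ind)
    also have "\<dots> = measure \<rho> (\<Pi>\<^sub>E i\<in>I. {..a i})" using A sets.sets_into_space[OF A] by (simp add: Int_absorb2)
    finally show ?thesis by (rule limI[symmetric])
  qed
  show ?thesis
  proof (rule measure_eqI_generator_eq[where E="?E" and \<Omega>="?\<Omega>" and A="\<lambda>n. \<Pi>\<^sub>E i\<in>I. {..real n}"])
    show "Int_stable ?E"
    proof (rule Int_stableI)
      fix A B assume "A \<in> ?E" "B \<in> ?E"
      then obtain a b where "A = (\<Pi>\<^sub>E i\<in>I. {..a i})" "B = (\<Pi>\<^sub>E i\<in>I. {..b i})" by auto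
      then have "A \<inter> B = (\<Pi>\<^sub>E i\<in>I. {..min (a i) (b i)})" by (auto simp: PiE_def Pi_def)
      then show "A \<inter> B \<in> ?E" by (rule range_eqI[of _ _ "\<lambda>i. min (a i) (b i)"])
    qed
    show "?E \<subseteq> Pow ?\<Omega>" by auto
    show "sets \<mu> = sigma_sets ?\<Omega> ?E" "sets \<nu> = sigma_sets ?\<Omega> ?E"
      using sets_PiM_borel_atMost[OF I] \<mu>(2) \<nu>(2) by auto
    show "range (\<lambda>n. \<Pi>\<^sub>E i\<in>I. {..real n}) \<subseteq> ?E" by auto
    show "(\<Union>n. \<Pi>\<^sub>E i\<in>I. {..real n}) = ?\<Omega>"
    proof (intro equalityI subsetI)
      fix x assume x: "x \<in> ?\<Omega>"
      obtain n :: nat where n: "(\<Sum>j\<in>I. \<bar>x j\<bar>) \<le> real n" using real_arch_simple by blast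
      have "x j \<le> real n" if "j \<in> I" for j
        using member_le_sum[of j I "\<lambda>j. \<bar>x j\<bar>"] that I n by auto
      then have "x \<in> (\<Pi>\<^sub>E i\<in>I. {..real n})" using x by (auto simp: PiE_def)
      then show "x \<in> (\<Union>n. \<Pi>\<^sub>E i\<in>I. {..real n})" by blast
    qed auto
    show "emeasure \<mu> (\<Pi>\<^sub>E i\<in>I. {..real n}) \<noteq> \<infinity>" for n
      using finite_measure.emeasure_finite[OF prob_space.axioms(1)[OF \<mu>(1)]] by simp
    fix X assume "X \<in> ?E"
    then obtain a where X: "X = (\<Pi>\<^sub>E i\<in>I. {..a i})" by auto
    have "measure \<mu> X = measure \<nu> X" unfolding X box[OF \<mu>] box[OF \<nu>] eq ..
    then show "emeasure \<mu> X = emeasure \<nu> X"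
      using finite_measure.emeasure_eq_measure[OF prob_space.axioms(1)[OF \<mu>(1)]]
        finite_measure.emeasure_eq_measure[OF prob_space.axioms(1)[OF \<nu>(1)]] by simp
  qed
qed

lemma weak_conv_on_prod:
  fixes g :: "nat \<Rightarrow> real \<Rightarrow> real"
  assumes "weak_conv_on I \<mu> \<nu>" "finite I" "\<And>i. continuous_on UNIV (g i)" "\<And>i x. \<bar>g i x\<bar> \<le> 1"
  shows "(\<lambda>n. \<integral>x. (\<Prod>i\<in>I. g i (x i)) \<partial>\<mu> n) \<longlonglongrightarrow> (\<integral>x. (\<Prod>i\<in>I. g i (x i)) \<partial>\<nu>)"
proof -
  have "continuous_map (product_topology (\<lambda>_. euclideanreal) I) euclideanreal (\<lambda>x. \<Prod>i\<in>I. g i (x i))"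
  proof (rule continuous_map_prod[OF assms(2)])
    fix i assume "i \<in> I"
    then have "continuous_map (product_topology (\<lambda>_. euclideanreal) I) euclideanreal (\<lambda>x. x i)"
      by (rule continuous_map_product_projection)
    moreover have "continuous_map euclideanreal euclideanreal (g i)" using assms(3) by simp
    ultimately show "continuous_map (product_topology (\<lambda>_. euclideanreal) I) euclideanreal (\<lambda>x. g i (x i))"
      using continuous_map_compose[unfolded o_def] by blast
  qed
  moreover have "bounded ((\<lambda>x. \<Prod>i\<in>I. g i (x i)) ` (\<Pi>\<^sub>E i\<in>I. UNIV))"
    by (rule boundedI[of _ 1]) (auto simp: abs_prod intro!: prod_le_1 assms(4))
  ultimately show ?thesis using assms(1) unfolding weak_conv_on_def by blast
qed

lemma integral_marginal_law_prod:
  fixes g :: "nat \<Rightarrow> real \<Rightarrow> real"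
  assumes "finite I" "\<And>i. X i \<in> borel_measurable M" "\<And>i. continuous_on UNIV (g i)"
  shows "(\<integral>x. (\<Prod>i\<in>I. g i (x i)) \<partial>(marginal_law M X I)) = (\<integral>\<omega>. (\<Prod>i\<in>I. g i (X i \<omega>)) \<partial>M)"
proof -
  have "(\<lambda>\<omega>. \<lambda>i\<in>I. X i \<omega>) \<in> measurable M (\<Pi>\<^sub>M i\<in>I. borel)" by (rule measurable_restrict) (rule assms(2))
  moreover have "(\<lambda>x. \<Prod>i\<in>I. g i (x i)) \<in> borel_measurable (\<Pi>\<^sub>M i\<in>I. borel)"
  proof (rule borel_measurable_prod)
    fix i assume "i \<in> I"
    from measurable_component_singleton[OF this, of "\<lambda>_. borel"]
    show "(\<lambda>x. g i (x i)) \<in> borel_measurable (\<Pi>\<^sub>M i\<in>I. borel)"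
      by (rule measurable_compose) (rule borel_measurable_continuous_onI[OF assms(3)])
  qed
  ultimately have "(\<integral>x. (\<Prod>i\<in>I. g i (x i)) \<partial>(marginal_law M X I)) = (\<integral>\<omega>. (\<Prod>i\<in>I. g i ((\<lambda>i\<in>I. X i \<omega>) i)) \<partial>M)"
    unfolding marginal_law_def by (rule integral_distr)
  then show ?thesis by simp
qed

lemma one_over_Suc_tendsto: "(\<lambda>n. 1 / (real n + 1)) \<longlonglongrightarrow> 0"
  using LIMSEQ_inverse_real_of_nat by (simp add: inverse_eq_divide add.commute)

section \<open>Approximation by polynomials and uniform L2 bounds\<close>

context gaussian_family
begin

lemma polyfun_L2:
  assumes "polyfun V d f" "finite V"
  shows "(\<lambda>\<omega>. f (\<lambda>j. G j \<omega>)) \<in> L2_functions M"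
  using polyfun_integrable[OF assms] polyfun_integrable[OF polyfun_mult[OF assms(1) assms(1)] assms(2)]
  by (auto simp: L2_functions_def power2_eq_square)

lemma nrm_diff_eq: "nrm (\<lambda>x. f x - g x) = sqrt (expectation (\<lambda>\<omega>. (f (\<lambda>j. G j \<omega>) - g (\<lambda>j. G j \<omega>))\<^sup>2))"
  by (simp add: nrm_def EG_def)

lemma polys_of_approx:
  assumes "X \<in> polys_of M G d" "\<epsilon> > 0"
  obtains p where "total_degree_le p d" "sqrt (expectation (\<lambda>\<omega>. (X \<omega> - eval_mpoly p (\<lambda>j. G j \<omega>))\<^sup>2)) < \<epsilon>"
  using assms unfolding polys_of_def L2_closure_def by blast

lemma polys_of_L2: "X \<in> polys_of M G d \<Longrightarrow> X \<in> L2_functions M"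
  unfolding polys_of_def L2_closure_def by blast

lemma polys_of_limit:
  assumes Y: "Y \<in> L2_functions M" and f: "\<And>r. \<exists>V. finite V \<and> polyfun V d (f r)"
    and lim: "\<And>r. sqrt (expectation (\<lambda>\<omega>. (Y \<omega> - f r (\<lambda>j. G j \<omega>))\<^sup>2)) \<le> 2 * (1/2) ^ r"
  shows "Y \<in> polys_of M G d"
  unfolding polys_of_def L2_closure_def
proof (intro CollectI conjI Y allI impI)
  fix \<epsilon> :: real assume e: "\<epsilon> > 0"
  have "(\<lambda>r. 2 * (1/2 :: real) ^ r) \<longlonglongrightarrow> 2 * 0" by (intro tendsto_mult tendsto_const LIMSEQ_realpow_zero) auto
  then have "\<forall>\<^sub>F r in sequentially. 2 * (1/2 :: real) ^ r < \<epsilon>" using e by (intro order_tendstoD) auto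
  then obtain r where r: "2 * (1/2 :: real) ^ r < \<epsilon>" by (auto simp: eventually_sequentially)
  obtain V where V: "finite V" "polyfun V d (f r)" using f by blast
  obtain p where p: "total_degree_le p d" "eval_mpoly p = f r" using polyfun_eval_mpoly[OF V(2)] by blast
  show "\<exists>X\<in>{\<lambda>\<omega>. eval_mpoly p (\<lambda>j. G j \<omega>) |p. total_degree_le p d} \<inter> L2_functions M.
      sqrt (expectation (\<lambda>\<omega>. (Y \<omega> - X \<omega>)\<^sup>2)) < \<epsilon>"
  proof (rule bexI[of _ "\<lambda>\<omega>. f r (\<lambda>j. G j \<omega>)"])
    show "sqrt (expectation (\<lambda>\<omega>. (Y \<omega> - f r (\<lambda>j. G j \<omega>))\<^sup>2)) < \<epsilon>" using lim[of r] r by linarith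
    show "(\<lambda>\<omega>. f r (\<lambda>j. G j \<omega>)) \<in> {\<lambda>\<omega>. eval_mpoly p (\<lambda>j. G j \<omega>) |p. total_degree_le p d} \<inter> L2_functions M"
      by (intro IntI CollectI exI[of _ p] conjI polyfun_L2[OF V(2,1)]) (simp_all add: p)
  qed
qed

text \<open>
  Since fourth moments are controlled by second moments, a polynomial of bounded degree with large second
  moment is large with probability bounded below, which tightness forbids.
\<close>

lemma tight_imp_L2_bounded:
  fixes \<nu> :: "real measure" and F :: "nat \<Rightarrow> 'a \<Rightarrow> real"
  assumes p: "\<And>n. polyfun (V n) d (p n)" and V: "\<And>n. finite (V n)" and F: "\<And>n. F n \<in> L2_functions M"
    and near: "\<And>n. sqrt (expectation (\<lambda>\<omega>. (F n \<omega> - p n (\<lambda>j. G j \<omega>))\<^sup>2)) \<le> 1 / (real n + 1)"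
    and \<nu>: "prob_space \<nu>" "sets \<nu> = sets borel"
    and lim: "\<And>g :: real \<Rightarrow> real. continuous_on UNIV g \<Longrightarrow> (\<And>x. \<bar>g x\<bar> \<le> 1) \<Longrightarrow>
       (\<lambda>n. expectation (\<lambda>\<omega>. g (F n \<omega>))) \<longlonglongrightarrow> (\<integral>x. g x \<partial>\<nu>)"
  shows "\<exists>B. \<forall>n. nrm (p n) \<le> B"
proof -
  interpret \<nu>: prob_space \<nu> by fact
  obtain C where C0: "C \<ge> 0" and C: "\<And>V f g. finite V \<Longrightarrow> polyfun V d f \<Longrightarrow> polyfun V d g \<Longrightarrow>
      nrm (\<lambda>x. f x * g x) \<le> C * (nrm f * nrm g)"
    using polyfun_product_bound[of d d] by blast
  \<comment> \<open>Its square root is \<open>1 / (2 * (C + 1))\<close>, so the Cauchy-Schwarz bound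
    for the part of the second moment beyond \<open>R\<close> is at most half of the second moment
    and can be absorbed on the left.\<close>
  define \<kappa> where "\<kappa> = 1 / (2 * (C + 1))\<^sup>2"
  have \<kappa>: "\<kappa> > 0" using C0 by (simp add: \<kappa>_def)
  \<comment> \<open>Zero on \<open>[-R, R]\<close> and 1 beyond \<open>R + 1\<close>: a continuous
    1-Lipschitz majorant of the indicator of large values, to which both weak convergence and the L2
    comparison apply.\<close>
  define bump where "bump R x = min 1 (max 0 (\<bar>x\<bar> - real R))" for R :: nat and x :: real
  have bump: "continuous_on UNIV (bump R)" "\<bar>bump R x\<bar> \<le> 1" "0 \<le> bump R x" "bump R x \<le> 1"
    for R x unfolding bump_def[abs_def] by (auto intro!: continuous_intros)
  have bump_lipschitz: "\<bar>bump R x - bump R y\<bar> \<le> 1 * \<bar>x - y\<bar>" for R x y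
    unfolding bump_def min_def max_def by (auto simp: abs_if)
  have "(\<lambda>R. \<integral>x. bump R x \<partial>\<nu>) \<longlonglongrightarrow> (\<integral>x. 0 \<partial>\<nu>)"
  proof (rule integral_dominated_convergence[where w="\<lambda>_. 1"])
    show "bump R \<in> borel_measurable \<nu>" for R
      using borel_measurable_continuous_onI[OF bump(1)] by (simp add: measurable_cong_sets[OF \<nu>(2) refl])
    have "(\<lambda>R. bump R x) \<longlonglongrightarrow> 0" for x
    proof -
      obtain m :: nat where m: "\<bar>x\<bar> \<le> real m" using real_arch_simple by blast
      have "bump R x = 0" if "R \<ge> m" for R using m that by (simp add: bump_def)
      then have "\<forall>\<^sub>F R in sequentially. bump R x = 0" by (auto simp: eventually_sequentially)
      then show ?thesis by (rule tendsto_eventually)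
    qed
    then show "AE x in \<nu>. (\<lambda>R. bump R x) \<longlonglongrightarrow> 0" by simp
  qed (auto simp: bump)
  then have "\<forall>\<^sub>F R in sequentially. (\<integral>x. bump R x \<partial>\<nu>) < \<kappa> / 2" using \<kappa> by (intro order_tendstoD) auto
  then obtain R where R: "(\<integral>x. bump R x \<partial>\<nu>) < \<kappa> / 2" by (auto simp: eventually_sequentially)
  have 1: "\<forall>\<^sub>F n in sequentially. expectation (\<lambda>\<omega>. bump R (F n \<omega>)) < \<kappa> / 2"
    using lim[OF bump(1) bump(2)] R by (rule order_tendstoD)
  have 2: "\<forall>\<^sub>F n in sequentially. 1 / (real n + 1) < \<kappa> / 2" using \<kappa> by (intro order_tendstoD(2)[OF one_over_Suc_tendsto]) auto
  define S where "S = sqrt (2 * (real R + 1)\<^sup>2)"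
  have bound: "\<forall>\<^sub>F n in sequentially. nrm (p n) \<le> S"
    using 1 2
  proof eventually_elim
    case (elim n)
    define P where "P \<omega> = p n (\<lambda>j. G j \<omega>)" for \<omega>
    have P: "P \<in> L2_functions M" unfolding P_def by (rule polyfun_L2[OF p V])
    have PP: "(\<lambda>\<omega>. (P \<omega>)\<^sup>2) \<in> L2_functions M"
      unfolding P_def power2_eq_square by (rule polyfun_L2[OF polyfun_mult[OF p p] V])
    note Pm = L2_functionsD(1)[OF P]
    have bm: "(\<lambda>\<omega>. bump R (P \<omega>)) \<in> borel_measurable M"
      by (rule measurable_compose[OF Pm borel_measurable_continuous_onI[OF bump(1)]])
    have bi: "integrable M (\<lambda>\<omega>. bump R (P \<omega>))" by (rule integrable_bounded[OF bm bump(2)])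
    have b2i: "integrable M (\<lambda>\<omega>. (bump R (P \<omega>))\<^sup>2)"
    proof (rule integrable_bounded[of _ 1])
      show "(\<lambda>\<omega>. (bump R (P \<omega>))\<^sup>2) \<in> borel_measurable M" using bm by measurable
      show "\<bar>(bump R (P \<omega>))\<^sup>2\<bar> \<le> 1" for \<omega> using bump(2)[of R "P \<omega>"] by (simp add: abs_square_le_1)
    qed
    \<comment> \<open>The general comparison for products, used for a single factor.\<close>
    have "\<bar>expectation (\<lambda>\<omega>. \<Prod>i\<in>{0::nat}. bump R (P \<omega>)) - expectation (\<lambda>\<omega>. \<Prod>i\<in>{0::nat}. bump R (F n \<omega>))\<bar>
       \<le> (\<Sum>i\<in>{0::nat}. 1 * sqrt (expectation (\<lambda>\<omega>. (P \<omega> - F n \<omega>)\<^sup>2)))"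
      by (rule expectation_prod_lipschitz[where X="\<lambda>_. P" and Y="\<lambda>_. F n" and g="\<lambda>_. bump R"])
         (simp, rule P, rule F, rule bump(1), rule bump(2), rule bump_lipschitz)
    then have "expectation (\<lambda>\<omega>. bump R (P \<omega>)) < \<kappa>"
      using elim near[of n] unfolding P_def by (simp add: power2_commute[of "p n _"])
    moreover have "expectation (\<lambda>\<omega>. (bump R (P \<omega>))\<^sup>2) \<le> expectation (\<lambda>\<omega>. bump R (P \<omega>))"
    proof (rule integral_mono[OF b2i bi])
      fix \<omega> show "(bump R (P \<omega>))\<^sup>2 \<le> bump R (P \<omega>)"
        using bump(3,4)[of R "P \<omega>"] by (simp add: power2_eq_square mult_left_le)
    qed
    ultimately have "sqrt (expectation (\<lambda>\<omega>. (bump R (P \<omega>))\<^sup>2)) \<le> sqrt \<kappa>" by simp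
    also have "sqrt \<kappa> = 1 / (2 * (C + 1))" unfolding \<kappa>_def using C0 by (simp add: real_sqrt_divide)
    finally have sq: "sqrt (expectation (\<lambda>\<omega>. (bump R (P \<omega>))\<^sup>2)) \<le> 1 / (2 * (C + 1))" .
    have nP: "(nrm (p n))\<^sup>2 = expectation (\<lambda>\<omega>. (P \<omega>)\<^sup>2)" unfolding nrm_sq EG_def P_def ..
    have pw: "(P \<omega>)\<^sup>2 \<le> (real R + 1)\<^sup>2 + (P \<omega>)\<^sup>2 * bump R (P \<omega>)" for \<omega>
    proof (cases "\<bar>P \<omega>\<bar> \<le> real R + 1")
      case True
      then have "\<bar>P \<omega>\<bar>\<^sup>2 \<le> (real R + 1)\<^sup>2" by (intro power_mono) auto
      moreover have "0 \<le> (P \<omega>)\<^sup>2 * bump R (P \<omega>)" using bump(3) by simp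
      ultimately show ?thesis by simp
    next
      case False
      then have "bump R (P \<omega>) = 1" by (simp add: bump_def)
      then show ?thesis by simp
    qed
    have PBi: "integrable M (\<lambda>\<omega>. (P \<omega>)\<^sup>2 * bump R (P \<omega>))"
      by (rule integrable_mult_of_squares[OF L2_functionsD(1)[OF PP] bm L2_functionsD(2)[OF PP] b2i])
    have "(nrm (p n))\<^sup>2 \<le> expectation (\<lambda>\<omega>. (real R + 1)\<^sup>2 + (P \<omega>)\<^sup>2 * bump R (P \<omega>))"
      unfolding nP using PBi L2_functionsD(2)[OF P] by (intro integral_mono pw) auto
    also have "\<dots> = (real R + 1)\<^sup>2 + expectation (\<lambda>\<omega>. (P \<omega>)\<^sup>2 * bump R (P \<omega>))" using PBi by (simp add: prob_space)
    also have "expectation (\<lambda>\<omega>. (P \<omega>)\<^sup>2 * bump R (P \<omega>))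
       \<le> sqrt (expectation (\<lambda>\<omega>. ((P \<omega>)\<^sup>2)\<^sup>2)) * sqrt (expectation (\<lambda>\<omega>. (bump R (P \<omega>))\<^sup>2))"
      using integral_cauchy_schwarz[OF L2_functionsD(1)[OF PP] bm L2_functionsD(2)[OF PP] b2i] by linarith
    also have "sqrt (expectation (\<lambda>\<omega>. ((P \<omega>)\<^sup>2)\<^sup>2)) = nrm (\<lambda>x. p n x * p n x)"
      by (simp add: nrm_def EG_def P_def power2_eq_square)
    also have "nrm (\<lambda>x. p n x * p n x) * sqrt (expectation (\<lambda>\<omega>. (bump R (P \<omega>))\<^sup>2))
       \<le> (C * (nrm (p n) * nrm (p n))) * (1 / (2 * (C + 1)))"
      by (rule mult_mono[OF C[OF V p p] sq]) (use C0 in auto)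
    also have "\<dots> \<le> (nrm (p n))\<^sup>2 / 2"
    proof -
      have "C / (C + 1) \<le> 1" using C0 by simp
      then have "(nrm (p n))\<^sup>2 / 2 * (C / (C + 1)) \<le> (nrm (p n))\<^sup>2 / 2 * 1" by (rule mult_left_mono) simp
      then show ?thesis by (simp add: power2_eq_square ac_simps)
    qed
    finally have "(nrm (p n))\<^sup>2 \<le> 2 * (real R + 1)\<^sup>2" by linarith
    then show ?case unfolding S_def by (rule real_le_rsqrt)
  qed
  then obtain N where N: "\<And>n. n \<ge> N \<Longrightarrow> nrm (p n) \<le> S" by (auto simp: eventually_sequentially)
  have S0: "S \<ge> 0" by (simp add: S_def)
  have "nrm (p n) \<le> (\<Sum>n<N. nrm (p n)) + S" for n
  proof (cases "n < N")
    case True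
    then have "nrm (p n) \<le> (\<Sum>n<N. nrm (p n))" by (intro member_le_sum) auto
    then show ?thesis using S0 by simp
  next
    case False
    then show ?thesis using N[of n] by (simp add: add_increasing sum_nonneg)
  qed
  then show ?thesis by blast
qed

end

section \<open>From the ultraproduct back to the Gaussian sequence\<close>

context wiener_ultraproduct
begin

lemma EU_psub:
  assumes gs: "gaussian_system D B" and W: "finite W" "W \<subseteq> B" and inj: "inj_on idx W" and P: "polyfun W e P"
  shows "EU (psub P) = EG (\<lambda>x. P (\<lambda>b. x (idx b)))"
  unfolding psub_def[abs_def]
proof (rule primitive_gaussian[OF W(1) _ _ inj P])
  show "\<exists>k\<le>D. primitive k b" if "b \<in> W" for b using gs W(2) that by (auto simp: gaussian_system_def)
  show "orthonormal W" using gs W(2) unfolding gaussian_system_def orthonormal_def by blast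
qed

text \<open>All joint moments of the members of \<open>W\<close> converge to Gaussian ones by
  \<open>EU_psub\<close>, and Gaussian moments grow slowly enough for the method of moments by
  \<open>linear_form_tail\<close>.\<close>

lemma psub_weak_convergence:
  assumes gs: "gaussian_system D B" and W: "finite W" "W \<subseteq> B" and inj: "inj_on idx W"
    and I: "finite I" and p: "\<And>i. i \<in> I \<Longrightarrow> polyfun W d (p i)"
    and g: "\<And>i. continuous_on UNIV (g i)" "\<And>i x. \<bar>g i x\<bar> \<le> (1::real)"
  shows "((\<lambda>n. EG (\<lambda>x. \<Prod>i\<in>I. g i (psub (p i) n x))) \<longlongrightarrow> EG (\<lambda>x. \<Prod>i\<in>I. g i (p i (\<lambda>b. x (idx b))))) U"
proof -
  define J where "J = idx ` W"
  define \<xi> where "\<xi> = inv_into W idx"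
  have \<xi>W: "\<xi> j \<in> W" if "j \<in> J" for j using that unfolding J_def \<xi>_def by (rule inv_into_into)
  have idx\<xi>: "idx (\<xi> j) = j" if "j \<in> J" for j using that unfolding J_def \<xi>_def by (rule f_inv_into_f)
  have \<xi>idx: "\<xi> (idx b) = b" if "b \<in> W" for b unfolding \<xi>_def by (rule inv_into_f_f[OF inj that])
  have J: "finite J" using W by (simp add: J_def)
  \<comment> \<open>The members of \<open>W\<close> are placed at the coordinates \<open>J\<close>
    and padded by zeros, the form in which the method of moments treats finite random vectors;
    \<open>Y\<close> is the Gaussian counterpart.\<close>
  define X where "X n \<omega> j = (if j \<in> J then \<xi> j n (\<lambda>j. G j \<omega>) else 0)" for n \<omega> j
  define Y where "Y \<omega> j = (if j \<in> J then G j \<omega> else 0)" for \<omega> j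
  define h where "h z = (\<Prod>i\<in>I. g i (p i (\<lambda>b. z (idx b))))" for z :: "nat \<Rightarrow> real"
  have \<xi>p: "polyfun (V n) D (\<xi> j n)" if "j \<in> J" for j n
    using bpoly_polyfun[OF gaussian_system_bpoly[OF gs]] \<xi>W[OF that] W(2) by blast
  have q: "polyfun J d (\<lambda>z. p i (\<lambda>b. z (idx b)))" if "i \<in> I" for i
    using polyfun_subst[OF p[OF that], of J 1 "\<lambda>b x. x (idx b)"] by (simp add: J_def polyfun_var)
  have QX: "Q (X n \<omega>) = Q (\<lambda>j. \<xi> j n (\<lambda>j. G j \<omega>))" if "polyfun J e Q" for Q e n \<omega>
    by (rule polyfun_cong[OF that]) (simp add: X_def)
  have QY: "Q (Y \<omega>) = Q (\<lambda>j. G j \<omega>)" if "polyfun J e Q" for Q e \<omega>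
    by (rule polyfun_cong[OF that]) (simp add: Y_def)
  have sub: "polyfun (V n) (e * D) (\<lambda>x. Q (\<lambda>j. \<xi> j n x))" if "polyfun J e Q" for Q e n
    by (rule polyfun_subst[OF that]) (rule \<xi>p)
  have "((\<lambda>n. expectation (\<lambda>\<omega>. h (X n \<omega>))) \<longlongrightarrow> expectation (\<lambda>\<omega>. h (Y \<omega>))) U"
  proof (rule moments_imp_weak_convergence[OF J, where X=X and Y=Y and h=h and K=1])
    show "X n \<in> borel_measurable M" for n
    proof (rule measurable_coordinatewise_then_product)
      fix j
      show "(\<lambda>\<omega>. X n \<omega> j) \<in> borel_measurable M"
      proof (cases "j \<in> J")
        case True
        then show ?thesis unfolding X_def using borel_measurable_integrable[OF polyfun_integrable[OF \<xi>p[OF True] fin]] by simp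
      qed (simp add: X_def)
    qed
    show "Y \<in> borel_measurable M"
    proof (rule measurable_coordinatewise_then_product)
      fix j
      show "(\<lambda>\<omega>. Y \<omega> j) \<in> borel_measurable M" by (cases "j \<in> J") (simp_all add: Y_def)
    qed
    show "X n \<omega> j = 0" if "j \<notin> J" for n \<omega> j using that by (simp add: X_def)
    show "Y \<omega> j = 0" if "j \<notin> J" for \<omega> j using that by (simp add: Y_def)
    show "integrable M (\<lambda>\<omega>. Q (X n \<omega>))" if "polyfun J e Q" for n e Q
      unfolding QX[OF that] by (rule polyfun_integrable[OF sub[OF that] fin])
    show "integrable M (\<lambda>\<omega>. Q (Y \<omega>))" if "polyfun J e Q" for e Q
      unfolding QY[OF that] by (rule polyfun_integrable[OF that J])
    show "((\<lambda>n. expectation (\<lambda>\<omega>. Q (X n \<omega>))) \<longlongrightarrow> expectation (\<lambda>\<omega>. Q (Y \<omega>))) U" if Q: "polyfun J e Q" for e Q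
    proof -
      define P where "P y = Q (\<lambda>j. y (\<xi> j))" for y
      have P: "polyfun W e P" unfolding P_def
        using polyfun_subst[OF Q, of W 1 "\<lambda>j y. y (\<xi> j)"] \<xi>W by (simp add: polyfun_var)
      have "(\<lambda>x. P (\<lambda>b. x (idx b))) = Q"
        unfolding P_def by (rule ext, rule polyfun_cong[OF Q]) (simp add: idx\<xi>)
      then have "((\<lambda>n. EG (psub P n)) \<longlongrightarrow> EG Q) U"
        using EU_tendsto[OF bpoly_psub[OF gaussian_system_bpoly[OF gs] W(2) P]] EU_psub[OF gs W inj P] by simp
      moreover have "EG (psub P n) = expectation (\<lambda>\<omega>. Q (X n \<omega>))" for n
        unfolding QX[OF Q] EG_def psub_def P_def eval_at_def ..
      moreover have "EG Q = expectation (\<lambda>\<omega>. Q (Y \<omega>))" unfolding QY[OF Q] EG_def ..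
      ultimately show ?thesis by simp
    qed
    show "(\<lambda>k. expectation (\<lambda>\<omega>. (\<Sum>j\<in>J. t j * Y \<omega> j) ^ (2 * k)) / fact (2 * k)) \<longlonglongrightarrow> 0" for t
      using linear_form_tail[OF J, of t] unfolding EG_def by (simp add: Y_def)
    show "continuous_on UNIV h" unfolding h_def
    proof (rule continuous_on_prod)
      fix i assume "i \<in> I"
      then show "continuous_on UNIV (\<lambda>z. g i (p i (\<lambda>b. z (idx b))))"
        by (intro continuous_on_compose2[OF g(1)] polyfun_continuous[OF q]) auto
    qed
    show "\<bar>h x\<bar> \<le> 1" for x unfolding h_def abs_prod by (intro prod_le_1) (auto simp: g(2))
  qed
  moreover have "h (X n \<omega>) = (\<Prod>i\<in>I. g i (psub (p i) n (\<lambda>j. G j \<omega>)))" for n \<omega>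
    unfolding h_def
  proof (intro prod.cong refl arg_cong[where f="g _"])
    fix i assume i: "i \<in> I"
    show "p i (\<lambda>b. X n \<omega> (idx b)) = psub (p i) n (\<lambda>j. G j \<omega>)"
      unfolding psub_def by (rule polyfun_cong[OF p[OF i]]) (simp add: X_def J_def \<xi>idx eval_at_def)
  qed
  moreover have "h (Y \<omega>) = (\<Prod>i\<in>I. g i (p i (\<lambda>b. G (idx b) \<omega>)))" for \<omega>
    unfolding h_def
  proof (intro prod.cong refl arg_cong[where f="g _"])
    fix i assume i: "i \<in> I"
    show "p i (\<lambda>b. Y \<omega> (idx b)) = p i (\<lambda>b. G (idx b) \<omega>)"
      by (rule polyfun_cong[OF p[OF i]]) (simp add: Y_def J_def)
  qed
  ultimately show ?thesis unfolding EG_def by simp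
qed

text \<open>One injection \<open>idx\<close> serves all \<open>i\<close> and \<open>r\<close>, so
  the resulting polynomials in \<open>G\<close> reproduce joint laws across components. Replacing
  the system by \<open>G\<close> preserves norms, which makes each \<open>q i\<close> a Cauchy
  sequence; the last clause says that along \<open>U\<close> the law of the \<open>u i\<close> is
  that of the \<open>q i r\<close> up to a geometric error.\<close>

lemma ultraproduct_limit:
  assumes u: "\<And>i::nat. bpoly d (u i)"
  obtains q :: "nat \<Rightarrow> nat \<Rightarrow> (nat \<Rightarrow> real) \<Rightarrow> real" where
    "\<And>i r. \<exists>J. finite J \<and> polyfun J d (q i r)"
    "\<And>i r s. nrm (\<lambda>x. q i r x - q i s x) \<le> (1/2) ^ r + (1/2) ^ s"
    "\<And>I g k a r. finite I \<Longrightarrow> (\<And>i. continuous_on UNIV (g i)) \<Longrightarrow> (\<And>i x. \<bar>g i x\<bar> \<le> (1::real)) \<Longrightarrow>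
       (\<And>i x y. \<bar>g i x - g i y\<bar> \<le> k * \<bar>x - y\<bar>) \<Longrightarrow>
       ((\<lambda>n. EG (\<lambda>x. \<Prod>i\<in>I. g i (u i n x))) \<longlongrightarrow> a) U \<Longrightarrow>
       \<bar>a - EG (\<lambda>x. \<Prod>i\<in>I. g i (q i r x))\<bar> \<le> k * real (card I) * (1/2) ^ r"
proof -
  obtain B where gs: "gaussian_system d B" and max: "\<And>B'. gaussian_system d B' \<Longrightarrow> B \<subseteq> B' \<Longrightarrow> B' = B"
    using maximal_gaussian_system[of d] by blast
  note Bp = gaussian_system_bpoly[OF gs]
  define A where "A i r wp \<longleftrightarrow> finite (fst wp) \<and> fst wp \<subseteq> B \<and> polyfun (fst wp) d (snd wp) \<and>
     unrm (\<lambda>n x. u i n x - psub (snd wp) n x) < (1/2) ^ r" for i r wp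
  define WP where "WP i r = (SOME wp. A i r wp)" for i r
  have "A i r (WP i r)" for i r
  proof -
    have "appr B d (u i)" by (rule maximal_gaussian_system_dense_bpoly[OF gs max u])
    from apprD[OF this, of "(1/2) ^ r"] obtain W p where "finite W" "W \<subseteq> B" "polyfun W d p"
      "unrm (\<lambda>n x. u i n x - psub p n x) < (1/2) ^ r" by auto
    then have "A i r (W, p)" by (simp add: A_def)
    then show ?thesis unfolding WP_def by (rule someI)
  qed
  then have W: "\<And>i r. finite (fst (WP i r))" "\<And>i r. fst (WP i r) \<subseteq> B" "\<And>i r. polyfun (fst (WP i r)) d (snd (WP i r))"
    and near: "\<And>i r. unrm (\<lambda>n x. u i n x - psub (snd (WP i r)) n x) < (1/2) ^ r" by (auto simp: A_def)
  define p where "p i r = snd (WP i r)" for i r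
  \<comment> \<open>The system may be uncountable, but only the members occurring in the chosen
    approximants matter. There are countably many of them, so they can be numbered by indices of
    \<open>G\<close>.\<close>
  define B' where "B' = (\<Union>i. \<Union>r. fst (WP i r))"
  have "countable B'" unfolding B'_def by (intro countable_UN countableI_type countable_finite[OF W(1)])
  then have inj: "inj_on (to_nat_on B') B'" by (rule inj_on_to_nat_on)
  define idx where "idx = to_nat_on B'"
  define q where "q i r x = p i r (\<lambda>b. x (idx b))" for i r and x :: "nat \<Rightarrow> real"
  have pb: "bpoly (d * d) (psub (p i r))" for i r unfolding p_def by (rule bpoly_psub[OF Bp W(2,3)])
  have inj': "inj_on idx W'" if "W' \<subseteq> B'" for W' unfolding idx_def using inj that by (rule inj_on_subset)
  show ?thesis
  proof (rule that[of q])
    fix i r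
    have "polyfun (idx ` fst (WP i r)) (d * 1) (q i r)"
      unfolding q_def p_def by (rule polyfun_subst[OF W(3)]) (simp add: polyfun_var)
    then show "\<exists>J. finite J \<and> polyfun J d (q i r)" using W(1)[of i r] by (intro exI[of _ "idx ` fst (WP i r)"]) simp
  next
    fix i r s
    let ?W = "fst (WP i r) \<union> fst (WP i s)"
    \<comment> \<open>The squared difference is again a polynomial, so \<open>EU_psub\<close>
      applies to it and shows that replacing the sequences by Gaussian variables is an
      isometry.\<close>
    define P where "P y = (p i r y - p i s y) * (p i r y - p i s y)" for y
    have "polyfun ?W d (\<lambda>y. p i r y - p i s y)" unfolding p_def
      by (intro polyfun_diff polyfun_vars_mono[OF W(3)]) auto
    from polyfun_mult[OF this this] have P: "polyfun ?W (d + d) P" unfolding P_def .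
    have WB': "?W \<subseteq> B'" unfolding B'_def by blast
    have "EU (psub P) = EG (\<lambda>x. P (\<lambda>b. x (idx b)))"
      by (rule EU_psub[OF gs _ _ inj'[OF WB'] P]) (use W(1,2) in auto)
    moreover have "EU (psub P) = (unrm (\<lambda>n x. psub (p i r) n x - psub (p i s) n x))\<^sup>2"
      using EU_square[OF bpoly_diff[OF pb pb]] by (simp add: psub_def[abs_def] P_def)
    moreover have "EG (\<lambda>x. P (\<lambda>b. x (idx b))) = (nrm (\<lambda>x. q i r x - q i s x))\<^sup>2"
      by (simp only: P_def EG_square[of "\<lambda>x. p i r (\<lambda>b. x (idx b)) - p i s (\<lambda>b. x (idx b))"] q_def)
    ultimately have "(nrm (\<lambda>x. q i r x - q i s x))\<^sup>2 = (unrm (\<lambda>n x. psub (p i r) n x - psub (p i s) n x))\<^sup>2" by simp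
    then have "nrm (\<lambda>x. q i r x - q i s x) = unrm (\<lambda>n x. psub (p i r) n x - psub (p i s) n x)"
      using unrm_nonneg[OF bpoly_diff[OF pb pb]] by (simp add: power2_eq_iff_nonneg)
    also have "\<dots> \<le> unrm (\<lambda>n x. psub (p i r) n x - u i n x) + unrm (\<lambda>n x. u i n x - psub (p i s) n x)"
      by (rule unrm_triangle3[OF pb u pb])
    also have "\<dots> \<le> (1/2) ^ r + (1/2) ^ s"
      using near[of i r] near[of i s] unrm_minus_commute[of "psub (p i r)" "u i"] unfolding p_def by linarith
    finally show "nrm (\<lambda>x. q i r x - q i s x) \<le> (1/2) ^ r + (1/2) ^ s" .
  next
    fix I :: "nat set" and g :: "nat \<Rightarrow> real \<Rightarrow> real" and k a :: real and r :: nat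
    assume I: "finite I" and g: "\<And>i. continuous_on UNIV (g i)" "\<And>i x. \<bar>g i x\<bar> \<le> 1"
      "\<And>i x y. \<bar>g i x - g i y\<bar> \<le> k * \<bar>x - y\<bar>"
      and lim: "((\<lambda>n. EG (\<lambda>x. \<Prod>i\<in>I. g i (u i n x))) \<longlongrightarrow> a) U"
    have k: "k \<ge> 0" using order_trans[OF abs_ge_zero g(3)[of 0 1 0]] by simp
    define W' where "W' = (\<Union>i\<in>I. fst (WP i r))"
    have "((\<lambda>n. EG (\<lambda>x. \<Prod>i\<in>I. g i (psub (p i r) n x))) \<longlongrightarrow> EG (\<lambda>x. \<Prod>i\<in>I. g i (p i r (\<lambda>b. x (idx b))))) U"
    proof (rule psub_weak_convergence[OF gs _ _ _ I _ g(1,2)])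
      show "finite W'" unfolding W'_def using W(1) I by blast
      show "W' \<subseteq> B" unfolding W'_def using W(2) by blast
      show "inj_on idx W'" by (rule inj') (auto simp: W'_def B'_def)
      show "polyfun W' d (p i r)" if "i \<in> I" for i
        unfolding p_def by (rule polyfun_vars_mono[OF W(3)]) (use that in \<open>auto simp: W'_def\<close>)
    qed
    then have lim': "((\<lambda>n. EG (\<lambda>x. \<Prod>i\<in>I. g i (psub (p i r) n x))) \<longlongrightarrow> EG (\<lambda>x. \<Prod>i\<in>I. g i (q i r x))) U"
      unfolding q_def .
    have "\<bar>a - EG (\<lambda>x. \<Prod>i\<in>I. g i (q i r x))\<bar> \<le> (\<Sum>i\<in>I. k * unrm (\<lambda>n x. u i n x - psub (p i r) n x))"
    proof (rule tendsto_le[OF not_bot])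
      show "((\<lambda>n. \<Sum>i\<in>I. k * nrm (\<lambda>x. u i n x - psub (p i r) n x)) \<longlongrightarrow> (\<Sum>i\<in>I. k * unrm (\<lambda>n x. u i n x - psub (p i r) n x))) U"
        by (intro tendsto_sum tendsto_mult tendsto_const unrm_tendsto[OF bpoly_diff'[OF u pb]])
      show "((\<lambda>n. \<bar>EG (\<lambda>x. \<Prod>i\<in>I. g i (u i n x)) - EG (\<lambda>x. \<Prod>i\<in>I. g i (psub (p i r) n x))\<bar>)
         \<longlongrightarrow> \<bar>a - EG (\<lambda>x. \<Prod>i\<in>I. g i (q i r x))\<bar>) U"
        by (intro tendsto_rabs tendsto_diff lim lim')
      show "\<forall>\<^sub>F n in U. \<bar>EG (\<lambda>x. \<Prod>i\<in>I. g i (u i n x)) - EG (\<lambda>x. \<Prod>i\<in>I. g i (psub (p i r) n x))\<bar>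
         \<le> (\<Sum>i\<in>I. k * nrm (\<lambda>x. u i n x - psub (p i r) n x))"
      proof (rule always_eventually, rule allI)
        fix n
        show "\<bar>EG (\<lambda>x. \<Prod>i\<in>I. g i (u i n x)) - EG (\<lambda>x. \<Prod>i\<in>I. g i (psub (p i r) n x))\<bar>
         \<le> (\<Sum>i\<in>I. k * nrm (\<lambda>x. u i n x - psub (p i r) n x))"
          unfolding EG_def nrm_diff_eq
          by (rule expectation_prod_lipschitz[OF I polyfun_L2[OF bpoly_polyfun[OF u] fin] polyfun_L2[OF bpoly_polyfun[OF pb] fin] g])
      qed
    qed
    also have "\<dots> \<le> (\<Sum>i\<in>I. k * (1/2) ^ r)"
      by (intro sum_mono mult_left_mono k) (use near in \<open>simp add: p_def less_imp_le\<close>)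
    finally show "\<bar>a - EG (\<lambda>x. \<Prod>i\<in>I. g i (q i r x))\<bar> \<le> k * real (card I) * (1/2) ^ r" by (simp add: ac_simps)
  qed
qed

end

text \<open>Convergence in law enters twice: for single components it gives tightness and hence
  bounded norms, and for finite sets of components it provides the law with which the limit along
  the ultrafilter is identified.\<close>

theorem theorem3p1:
  fixes M :: "'a measure" and G :: "nat \<Rightarrow> 'a \<Rightarrow> real"
    and F :: "nat \<Rightarrow> nat \<Rightarrow> 'a \<Rightarrow> real" and d :: nat
  assumes "prob_space M"
    and "d \<ge> 1"
    and "\<And>j. distributed M lborel (G j) std_normal_density"
    and "prob_space.indep_vars M (\<lambda>_. borel) G UNIV"
    and "\<And>i n. F i n \<in> polys_of M G d"
    and "converges_in_law M F"
  shows "\<exists>Q. (\<forall>i. Q i \<in> polys_of M G d) \<and> converges_in_law_to M F Q"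
proof -
  interpret prob_space M by fact
  interpret gaussian_family M G by unfold_locales (use assms(3,4) in auto)
  note F = assms(5)
  note FL = polys_of_L2[OF F]
  have Fm: "F i n \<in> borel_measurable M" for i n using L2_functionsD(1)[OF FL] .
  \<comment> \<open>\<open>F i n\<close> is only an L2 limit of ordinary polynomials. The error
    \<open>1 / (real n + 1)\<close> tends to 0, so the replacement changes neither tightness nor the
    limit law.\<close>
  define A where "A i n p \<longleftrightarrow> total_degree_le p d \<and>
    sqrt (expectation (\<lambda>\<omega>. (F i n \<omega> - eval_mpoly p (\<lambda>j. G j \<omega>))\<^sup>2)) < 1 / (real n + 1)" for i n p
  define P where "P i n = (SOME p. A i n p)" for i n
  have AP: "A i n (P i n)" for i n
  proof -
    have "0 < 1 / (real n + 1)" by simp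
    from polys_of_approx[OF F this] obtain p where "A i n p" unfolding A_def by blast
    then show ?thesis unfolding P_def by (rule someI)
  qed
  define vars where "vars i n = (\<Union>m\<in>Poly_Mapping.keys (P i n). Poly_Mapping.keys m)" for i n
  have vars: "finite (vars i n)" for i n by (simp add: vars_def)
  have poly: "polyfun (vars i n) d (eval_mpoly (P i n))" for i n
    unfolding vars_def by (rule eval_mpoly_polyfun) (use AP in \<open>simp add: A_def\<close>)
  have near: "sqrt (expectation (\<lambda>\<omega>. (F i n \<omega> - eval_mpoly (P i n) (\<lambda>j. G j \<omega>))\<^sup>2)) \<le> 1 / (real n + 1)" for i n
    using AP[of i n] by (simp add: A_def)
  have law: "\<exists>\<nu>. prob_space \<nu> \<and> sets \<nu> = sets (\<Pi>\<^sub>M i\<in>I. borel) \<and>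
     weak_conv_on I (\<lambda>n. marginal_law M (\<lambda>i. F i n) I) \<nu>" if "finite I" for I
    using assms(6) that unfolding converges_in_law_def by blast
  have bounded: "\<exists>B. \<forall>n. nrm (eval_mpoly (P i n)) \<le> B" for i
  proof -
    have "finite {i}" by simp
    from law[OF this] obtain \<nu> where \<nu>: "prob_space \<nu>" "sets \<nu> = sets (\<Pi>\<^sub>M i\<in>{i}. borel)"
      and wc: "weak_conv_on {i} (\<lambda>n. marginal_law M (\<lambda>i. F i n) {i}) \<nu>" by blast
    have m: "(\<lambda>x. x i) \<in> measurable \<nu> borel"
      using measurable_component_singleton[of i "{i}" "\<lambda>_. borel :: real measure"]
      by (simp add: measurable_cong_sets[OF \<nu>(2) refl])
    show ?thesis
    proof (rule tight_imp_L2_bounded[OF poly vars FL near])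
      show "prob_space (distr \<nu> borel (\<lambda>x. x i))" by (rule prob_space.prob_space_distr[OF \<nu>(1) m])
      fix g :: "real \<Rightarrow> real" assume g: "continuous_on UNIV g" "\<And>x. \<bar>g x\<bar> \<le> 1"
      have "(\<integral>x. g x \<partial>(distr \<nu> borel (\<lambda>x. x i))) = (\<integral>x. g (x i) \<partial>\<nu>)"
        by (rule integral_distr[OF m borel_measurable_continuous_onI[OF g(1)]])
      then show "(\<lambda>n. expectation (\<lambda>\<omega>. g (F i n \<omega>))) \<longlonglongrightarrow> (\<integral>x. g x \<partial>(distr \<nu> borel (\<lambda>x. x i)))"
        using weak_conv_on_prod[OF wc, of "\<lambda>_. g"] g
          integral_marginal_law_prod[of "{i}" "\<lambda>i. F i n" M "\<lambda>_. g" for n, OF _ Fm g(1)] by simp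
    qed simp
  qed
  obtain U :: "nat filter" where U: "free_ultrafilter U"
    using free_ultrafilter_exists unfolding free_ultrafilter_def by blast
  \<comment> \<open>Each stage may involve only finitely many variables although there are
    infinitely many components, so stage \<open>n\<close> serves the components
    \<open>i \<le> n\<close>.\<close>
  define V where "V n = (\<Union>i\<le>n. vars i n)" for n
  interpret wiener_ultraproduct M G U V
    by (intro wiener_ultraproduct.intro wiener_ultraproduct_axioms.intro U gaussian_family_axioms) (simp add: V_def vars)
  \<comment> \<open>The default 0 affects only the finitely many stages \<open>n < i\<close>, which
    are invisible along a free ultrafilter.\<close>
  define u where "u i n = (if i \<le> n then eval_mpoly (P i n) else (\<lambda>x. 0))" for i n
  have u: "bpoly d (u i)" for i
  proof -
    obtain B where B: "\<And>n. nrm (eval_mpoly (P i n)) \<le> B" using bounded[of i] by blast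
    have "B \<ge> 0" using order_trans[OF nrm_nonneg B] .
    moreover have "polyfun (V n) d (eval_mpoly (P i n))" if "i \<le> n" for n
      by (rule polyfun_vars_mono[OF poly]) (use that in \<open>auto simp: V_def\<close>)
    ultimately show ?thesis by (intro bpolyI[of d _ B]) (auto simp: u_def B intro: polyfun.const)
  qed
  obtain q where qp: "\<And>i r. \<exists>J. finite J \<and> polyfun J d (q i r)"
    and qc: "\<And>i r s. nrm (\<lambda>x. q i r x - q i s x) \<le> (1/2) ^ r + (1/2) ^ s"
    and ql: "\<And>I g k a r. finite I \<Longrightarrow> (\<And>i. continuous_on UNIV (g i)) \<Longrightarrow> (\<And>i x. \<bar>g i x\<bar> \<le> (1::real)) \<Longrightarrow>
       (\<And>i x y. \<bar>g i x - g i y\<bar> \<le> k * \<bar>x - y\<bar>) \<Longrightarrow>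
       ((\<lambda>n. EG (\<lambda>x. \<Prod>i\<in>I. g i (u i n x))) \<longlongrightarrow> a) U \<Longrightarrow>
       \<bar>a - EG (\<lambda>x. \<Prod>i\<in>I. g i (q i r x))\<bar> \<le> k * real (card I) * (1/2) ^ r"
    using ultraproduct_limit[of d u, OF u] by blast
  have qL: "(\<lambda>\<omega>. q i r (\<lambda>j. G j \<omega>)) \<in> L2_functions M" for i r
    using qp[of i r] polyfun_L2 by blast
  have "\<forall>i. \<exists>Y. Y \<in> L2_functions M \<and> (\<forall>r. sqrt (expectation (\<lambda>\<omega>. (Y \<omega> - q i r (\<lambda>j. G j \<omega>))\<^sup>2)) \<le> 2 * (1/2) ^ r)"
  proof
    fix i
    have "sqrt (expectation (\<lambda>\<omega>. (q i r (\<lambda>j. G j \<omega>) - q i s (\<lambda>j. G j \<omega>))\<^sup>2)) \<le> (1/2) ^ r + (1/2) ^ s" for r s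
      using qc[of i r s] unfolding nrm_diff_eq .
    from L2_complete[OF qL this] show "\<exists>Y. Y \<in> L2_functions M \<and> (\<forall>r. sqrt (expectation (\<lambda>\<omega>. (Y \<omega> - q i r (\<lambda>j. G j \<omega>))\<^sup>2)) \<le> 2 * (1/2) ^ r)"
      by blast
  qed
  from choice[OF this] obtain Q where QL: "\<And>i. Q i \<in> L2_functions M"
    and Qq: "\<And>i r. sqrt (expectation (\<lambda>\<omega>. (Q i \<omega> - q i r (\<lambda>j. G j \<omega>))\<^sup>2)) \<le> 2 * (1/2) ^ r" by blast
  have Qm: "Q i \<in> borel_measurable M" for i using L2_functionsD(1)[OF QL] .
  have "converges_in_law_to M F Q"
    unfolding converges_in_law_to_def
  proof (intro allI impI)
    fix I :: "nat set" assume I: "finite I"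
    from law[OF I] obtain \<nu> where \<nu>: "prob_space \<nu>" "sets \<nu> = sets (\<Pi>\<^sub>M i\<in>I. borel)"
      and wc: "weak_conv_on I (\<lambda>n. marginal_law M (\<lambda>i. F i n) I) \<nu>" by blast
    \<comment> \<open>\<nu> is already the weak limit of the full sequence, so it is enough to
      recognise it as the law of \<open>Q\<close>; for this the limit along \<open>U\<close>
      suffices.\<close>
    have "\<nu> = marginal_law M Q I"
    proof (rule PiM_eq_by_ramps[OF I \<nu>])
      have "(\<lambda>\<omega>. \<lambda>i\<in>I. Q i \<omega>) \<in> measurable M (\<Pi>\<^sub>M i\<in>I. borel)" by (rule measurable_restrict) (rule Qm)
      then show "prob_space (marginal_law M Q I)" unfolding marginal_law_def by (rule prob_space_distr)
      show "sets (marginal_law M Q I) = sets (\<Pi>\<^sub>M i\<in>I. borel)" by (simp add: marginal_law_def)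
      fix a :: "nat \<Rightarrow> real" and k :: nat
      define g where "g i = ramp (a i) k" for i
      have g: "\<And>i. continuous_on UNIV (g i)" "\<And>i x. \<bar>g i x\<bar> \<le> 1" "\<And>i x y. \<bar>g i x - g i y\<bar> \<le> real k * \<bar>x - y\<bar>"
        unfolding g_def by (rule ramp_continuous ramp_bounded ramp_lipschitz)+
      define \<alpha> where "\<alpha> = (\<integral>x. (\<Prod>i\<in>I. g i (x i)) \<partial>\<nu>)"
      have "(\<lambda>n. expectation (\<lambda>\<omega>. \<Prod>i\<in>I. g i (F i n \<omega>))) \<longlonglongrightarrow> \<alpha>"
        using weak_conv_on_prod[OF wc I g(1,2)] unfolding \<alpha>_def integral_marginal_law_prod[OF I Fm g(1)] .
      then have lF: "((\<lambda>n. expectation (\<lambda>\<omega>. \<Prod>i\<in>I. g i (F i n \<omega>))) \<longlongrightarrow> \<alpha>) U"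
        by (rule tendsto_mono[OF le_sequentially])
      have "(\<lambda>n. \<Sum>i\<in>I. real k * (1 / (real n + 1))) \<longlonglongrightarrow> (\<Sum>i\<in>I. real k * 0)"
        by (intro tendsto_sum tendsto_mult tendsto_const one_over_Suc_tendsto)
      then have small: "((\<lambda>n. \<Sum>i\<in>I. real k * (1 / (real n + 1))) \<longlongrightarrow> 0) U"
        using tendsto_mono[OF le_sequentially] by simp
      have uL: "(\<lambda>\<omega>. u i n (\<lambda>j. G j \<omega>)) \<in> L2_functions M" for i n
        by (rule polyfun_L2[OF bpoly_polyfun[OF u] fin])
      have "((\<lambda>n. EG (\<lambda>x. \<Prod>i\<in>I. g i (u i n x)) - expectation (\<lambda>\<omega>. \<Prod>i\<in>I. g i (F i n \<omega>))) \<longlongrightarrow> 0) U"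
      proof (rule Lim_null_comparison[OF _ small])
        show "\<forall>\<^sub>F n in U. norm (EG (\<lambda>x. \<Prod>i\<in>I. g i (u i n x)) - expectation (\<lambda>\<omega>. \<Prod>i\<in>I. g i (F i n \<omega>)))
           \<le> (\<Sum>i\<in>I. real k * (1 / (real n + 1)))"
          \<comment> \<open>\<open>\<Sum>I\<close> is at least every element of \<open>I\<close>, so
            from this stage on no component in \<open>I\<close> takes its default value.\<close>
          using eventually_ge[of "\<Sum>I"]
        proof eventually_elim
          case (elim n)
          have "\<bar>EG (\<lambda>x. \<Prod>i\<in>I. g i (u i n x)) - expectation (\<lambda>\<omega>. \<Prod>i\<in>I. g i (F i n \<omega>))\<bar>
             \<le> (\<Sum>i\<in>I. real k * sqrt (expectation (\<lambda>\<omega>. (u i n (\<lambda>j. G j \<omega>) - F i n \<omega>)\<^sup>2)))"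
            unfolding EG_def by (rule expectation_prod_lipschitz[OF I uL FL g])
          also have "\<dots> \<le> (\<Sum>i\<in>I. real k * (1 / (real n + 1)))"
          proof (intro sum_mono mult_left_mono)
            fix i assume "i \<in> I"
            then have "i \<le> n" using elim member_le_sum[of i I "\<lambda>i. i"] I by simp
            then show "sqrt (expectation (\<lambda>\<omega>. (u i n (\<lambda>j. G j \<omega>) - F i n \<omega>)\<^sup>2)) \<le> 1 / (real n + 1)"
              using near[of i n] by (simp add: u_def power2_commute)
          qed simp
          finally show ?case by simp
        qed
      qed
      from tendsto_add[OF this lF] have lu: "((\<lambda>n. EG (\<lambda>x. \<Prod>i\<in>I. g i (u i n x))) \<longlongrightarrow> \<alpha>) U" by simp
      define \<beta> where "\<beta> = expectation (\<lambda>\<omega>. \<Prod>i\<in>I. g i (Q i \<omega>))"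
      \<comment> \<open>The polynomials \<open>q i r\<close> are the intermediary: \<alpha> is close
        to their expectation by the ultraproduct estimate and \<beta> by L2 distance, both with an
        error geometric in \<open>r\<close>.\<close>
      have "\<bar>\<alpha> - \<beta>\<bar> \<le> (3 * (real k * real (card I))) * (1/2) ^ r" for r
      proof -
        have "\<bar>\<beta> - EG (\<lambda>x. \<Prod>i\<in>I. g i (q i r x))\<bar> \<le> (\<Sum>i\<in>I. real k * sqrt (expectation (\<lambda>\<omega>. (Q i \<omega> - q i r (\<lambda>j. G j \<omega>))\<^sup>2)))"
          unfolding \<beta>_def EG_def by (rule expectation_prod_lipschitz[OF I QL qL g])
        also have "\<dots> \<le> (\<Sum>i\<in>I. real k * (2 * (1/2) ^ r))" by (intro sum_mono mult_left_mono Qq) simp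
        finally have "\<bar>\<beta> - EG (\<lambda>x. \<Prod>i\<in>I. g i (q i r x))\<bar> \<le> 2 * (real k * real (card I)) * (1/2) ^ r" by (simp add: ac_simps)
        moreover have "\<bar>\<alpha> - EG (\<lambda>x. \<Prod>i\<in>I. g i (q i r x))\<bar> \<le> real k * real (card I) * (1/2) ^ r"
          by (rule ql[OF I g lu])
        ultimately show ?thesis by argo
      qed
      moreover have "(\<lambda>r. (3 * (real k * real (card I))) * (1/2) ^ r) \<longlonglongrightarrow> (3 * (real k * real (card I))) * 0"
        by (intro tendsto_mult tendsto_const LIMSEQ_realpow_zero) auto
      ultimately have "\<bar>\<alpha> - \<beta>\<bar> \<le> 3 * (real k * real (card I)) * 0"
        by (intro LIMSEQ_le_const[of _ _ "\<bar>\<alpha> - \<beta>\<bar>"]) auto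
      then have "\<alpha> = \<beta>" by simp
      then show "(\<integral>x. (\<Prod>i\<in>I. ramp (a i) k (x i)) \<partial>\<nu>) = (\<integral>x. (\<Prod>i\<in>I. ramp (a i) k (x i)) \<partial>(marginal_law M Q I))"
        using integral_marginal_law_prod[OF I Qm g(1)] unfolding \<alpha>_def \<beta>_def g_def by simp
    qed
    then show "weak_conv_on I (\<lambda>n. marginal_law M (\<lambda>i. F i n) I) (marginal_law M Q I)" using wc by simp
  qed
  moreover have "Q i \<in> polys_of M G d" for i by (rule polys_of_limit[OF QL qp Qq])
  ultimately show ?thesis by blast
qed

end
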